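(* Let $M$ be a connected smooth manifold of dimension $n\ge 2$ with a Riemannian conformal structure $c$. Let $g\in c$, let $\gamma$ be an admissible family, with associated $\delta>0$, and let $(\widetilde M,\widetilde g)$ be the Lorentzian manifold constructed from $g$ and $\gamma$. Let $u\in C^\infty(M)$ and let $\Psi^u\colon M\to\widetilde M$, $\Psi^u(x)=(e^{u(x)},0,x)$, with lightlike normal vector field $\xi^u=e^u\,\partial_t|_{\Psi^u}$. Let $$\bigl(\Psi^{u*}(T\widetilde M),\ \mathrm{Span}(\xi^u),\ \widetilde g^u,\ \widetilde\nabla^u\bigr)$$ be the tractor bundle associated with the pair $(\Psi^u,\xi^u)$, where $\widetilde g^u$ is the restriction of $\widetilde g$ along $\Psi^u$ and $\widetilde\nabla^u$ is the connection induced along $\Psi^u$ by the Levi-Civita connection of $\widetilde g$. Then $\bigl(\Psi^{u*}(T\widetilde M),\mathrm{Span}(\xi^u),\widetilde g^u,\widetilde\nabla^u\bigr)$ is the normal conformal tractor bundle of $(M,c)$ if and only if $$\widetilde{\mathrm{Ric}}|_{r=0}(V,W)=0\qquad\text{for every } V,W\in\mathfrak L(M),$$ where $\widetilde{\mathrm{Ric}}$ is the Ricci tensor of $(\widetilde M,\widetilde g)$.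
   Context: **Admissible family.** Given a Riemannian conformal structure $(M,c)$, a smooth one-parameter family $\gamma$ of $(1,1)$-tensor fields $\gamma(r)$, $r\in\mathbb R$, on $M$ is admissible if: (1) each $\gamma(r)$ is self-adjoint with respect to any metric of $c$; (2) $\gamma(0)=\mathrm{Id}$; (3) there is $\delta>0$ such that $\gamma(r)$ is nonsingular for all $|r|<\delta$. We write $\dot\gamma(r)(V_x)=\lim_{\varepsilon\to0}\frac{\gamma(r+\varepsilon)(V_x)-\gamma(r)(V_x)}{\varepsilon}$. **The Lorentzian manifold.** For $g\in c$ put $\langle V,W\rangle^g_r=g(\gamma(r)(V),W)$, which is positive definite for $|r|<\delta$. Let $\widetilde M=\mathbb R_{>0}\times(-\delta,\delta)\times M$, with coordinates $(t,r)$ on the first two factors, and $$\widetilde g=d(rt)\otimes dt+dt\otimes d(rt)+t^2\langle-,-\rangle^g_r .$$ $\mathfrak L(M)\subset\mathfrak X(\widetilde M)$ is the set of natural lifts to $\widetilde M$ of vector fields on $M$. The restriction $|_{r=0}$ is to the hypersurface $\{r=0\}\subset\widetilde M$. **The immersion.** $\Psi^u$ is a spacelike immersion with $\Psi^{u*}(\widetilde g)=e^{2u}g$. The field $\xi^u$ is normal and lightlike, it is parallel for the normal connection, and its Weingarten endomorphism is $-\mathrm{Id}$. **Conformal tractor bundles.** A conformal tractor bundle on $M^n$ is a rank $n+2$ real vector bundle $\mathcal T\to M$ with a Lorentzian bundle metric $\mathbf h$ and a distinguished oriented lightlike line subbundle $\mathcal T^1\subset\mathcal T$. A tractor connection is a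 linear connection $\nabla^{\mathcal T}$ on $\mathcal T$ with $\nabla^{\mathcal T}\mathbf h=0$ such that $\beta\colon TM\to\mathrm{Hom}(\mathcal T^1,(\mathcal T^1)^\perp/\mathcal T^1)$, $\beta(V_x)(\sigma(x))=\nabla^{\mathcal T}_{V_x}\sigma+\mathcal T^1_x$ for $\sigma\in\Gamma(\mathcal T^1)$, is a vector bundle isomorphism. Each nonvanishing local section $\sigma$ of $\mathcal T^1$ gives an isomorphism $\beta_\sigma\colon TM\to(\mathcal T^1)^\perp/\mathcal T^1$, $V\mapsto\nabla^{\mathcal T}_V\sigma+\mathcal T^1$, and a Riemannian metric $\mathbf h^\sigma(V,W)=\mathbf h(\beta_\sigma V,\beta_\sigma W)$. These metrics, for different $\sigma$, are conformally related, so they determine a conformal class. If this class is $c$, then $(\mathcal T,\mathcal T^1,\mathbf h,\nabla^{\mathcal T})$ is called a standard conformal tractor bundle for $(M,c)$. **Normality.** A standard conformal tractor bundle with tractor connection is the normal conformal tractor bundle of $(M,c)$ if the curvature $R$ of $\nabla^{\mathcal T}$ satisfies the following normalization conditions. (i) $R(V,W)(\mathcal T^1)\subset\mathcal T^1$ for all $V,W$. Then, since $\nabla^{\mathcal T}\mathbf h=0$, $R(V,W)$ preserves $(\mathcal T^1)^\perp$ and induces an endomorphism of $(\mathcal T^1)^\perp/\mathcal T^1$. Via $\beta_\sigma$ this gives an endomorphism $\mathcal W(V,W)$ of $TM$ that does not depend on $\sigma$. (ii) $\mathrm{trace}\bigl(V\mapsto\mathcal W(V,W)Z\bigr)=0$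 for all $W,Z$. For $n\ge3$ these conditions determine $(\mathcal T,\mathcal T^1,\mathbf h,\nabla^{\mathcal T})$ uniquely up to isomorphism. For $n=2$ they make sense but do not give uniqueness, and "is the normal conformal tractor bundle" then means only that the conditions hold. **Tractor bundle associated with a pair.** Let $\Psi\colon M^n\to(\widetilde M^{n+2},\widetilde g)$ be a spacelike immersion into a Lorentzian manifold with a global lightlike normal frame $\{\xi,\ell\}$, $\widetilde g(\xi,\ell)=-1$, such that the Weingarten endomorphism of $\xi$ is $-\mathrm{Id}$ and $\nabla^\perp\xi=0$. The tractor bundle associated with $(\Psi,\xi)$ is the standard conformal tractor bundle $(\Psi^*(T\widetilde M),\mathrm{Span}(\xi),\widetilde g,\widetilde\nabla)$ of $(M,[\Psi^*\widetilde g])$, where $\mathrm{Span}(\xi)$ plays the role of $\mathcal T^1$ (oriented by $\xi$), the bundle metric is the one induced by $\widetilde g$, and the connection is the pullback of the Levi-Civita connection of $\widetilde g$. *)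

theory Defs
  imports "HOL-Analysis.Analysis" "HOL-Library.FuncSet"
begin

section \<open>Smooth manifolds\<close>

primrec Ck_on :: "nat \<Rightarrow> 'a::euclidean_space set \<Rightarrow> ('a \<Rightarrow> 'b::real_normed_vector) \<Rightarrow> bool" where
  "Ck_on 0 S f \<longleftrightarrow> continuous_on S f"
| "Ck_on (Suc k) S f \<longleftrightarrow>
     (\<forall>x\<in>S. f differentiable (at x)) \<and> (\<forall>v. Ck_on k S (\<lambda>x. frechet_derivative f (at x) v))"

text \<open>Only meant for open \<open>S\<close>.\<close>

definition smooth_on :: "'a::euclidean_space set \<Rightarrow> ('a \<Rightarrow> 'b::real_normed_vector) \<Rightarrow> bool" where
  "smooth_on S f \<longleftrightarrow> (\<forall>k. Ck_on k S f)"

text \<open>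
  A chart is a pair of its domain and its coordinate map; the values of the map outside the domain
  are irrelevant. Every point carries a preferred chart \<open>chart_at\<close>. A tangent vector at a point is
  represented by its components in the preferred chart of that point, so that every tangent space
  has the underlying vector space \<open>'e\<close>. Components in an arbitrary chart are obtained from
  \<open>chart_components\<close> below. As the preferred chart may jump from point to point, smoothness of a
  vector field refers to those components and not to the map into \<open>'e\<close> itself.
\<close>

type_synonym ('m, 'e) chart = "'m set \<times> ('m \<Rightarrow> 'e)"

record ('m, 'e) manifold =
  points :: "'m set"
  atlas :: "('m, 'e) chart set"
  chart_at :: "'m \<Rightarrow> ('m, 'e) chart"

abbreviation chart_inv :: "('m, 'e) chart \<Rightarrow> 'e \<Rightarrow> 'm" where
  "chart_inv c \<equiv> inv_into (fst c) (snd c)"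

definition smooth_manifold ::
  "('m::{t2_space,second_countable_topology}, 'e::euclidean_space) manifold \<Rightarrow> bool" where
  "smooth_manifold M \<longleftrightarrow>
     open (points M) \<and>
     (\<forall>c\<in>atlas M. open (fst c) \<and> fst c \<subseteq> points M \<and> open (snd c ` fst c) \<and>
        homeomorphism (fst c) (snd c ` fst c) (snd c) (chart_inv c)) \<and>
     (\<forall>c\<in>atlas M. \<forall>c'\<in>atlas M. smooth_on (snd c ` (fst c \<inter> fst c')) (snd c' \<circ> chart_inv c)) \<and>
     (\<forall>x\<in>points M. chart_at M x \<in> atlas M \<and> x \<in> fst (chart_at M x))"

definition smooth_map_on ::
  "('m::topological_space, 'e::euclidean_space) manifold \<Rightarrow> 'm set \<Rightarrow>
   ('m \<Rightarrow> 'b::real_normed_vector) \<Rightarrow> bool" where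
  "smooth_map_on M U f \<longleftrightarrow>
     (\<forall>c\<in>atlas M. smooth_on (snd c ` (U \<inter> fst c)) (f \<circ> chart_inv c))"

definition line_manifold :: "real set \<Rightarrow> (real, real) manifold" where
  "line_manifold I = \<lparr>points = I, atlas = {(I, \<lambda>s. s)}, chart_at = (\<lambda>_. (I, \<lambda>s. s))\<rparr>"

definition product_chart :: "('m, 'e) chart \<Rightarrow> ('n, 'f) chart \<Rightarrow> ('m \<times> 'n, 'e \<times> 'f) chart" where
  "product_chart c d = (fst c \<times> fst d, \<lambda>(x, y). (snd c x, snd d y))"

definition product_manifold ::
  "('m, 'e) manifold \<Rightarrow> ('n, 'f) manifold \<Rightarrow> ('m \<times> 'n, 'e \<times> 'f) manifold" where
  "product_manifold M N =
     \<lparr>points = points M \<times> points N,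
      atlas = {product_chart c d | c d. c \<in> atlas M \<and> d \<in> atlas N},
      chart_at = (\<lambda>(x, y). product_chart (chart_at M x) (chart_at N y))\<rparr>"

definition chart_components ::
  "('m, 'e::euclidean_space) manifold \<Rightarrow> ('m, 'e) chart \<Rightarrow> 'm \<Rightarrow> 'e \<Rightarrow> 'e" where
  "chart_components M c x =
     frechet_derivative (snd c \<circ> chart_inv (chart_at M x)) (at (snd (chart_at M x) x))"

definition differential ::
  "('m, 'e::euclidean_space) manifold \<Rightarrow> ('m \<Rightarrow> 'b::real_normed_vector) \<Rightarrow> 'm \<Rightarrow> 'e \<Rightarrow> 'b" where
  "differential M f x =
     frechet_derivative (f \<circ> chart_inv (chart_at M x)) (at (snd (chart_at M x) x))"

definition tangent_map ::
  "('m, 'e::euclidean_space) manifold \<Rightarrow> ('n, 'f::euclidean_space) manifold \<Rightarrow> ('m \<Rightarrow> 'n) \<Rightarrow>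
   'm \<Rightarrow> 'e \<Rightarrow> 'f" where
  "tangent_map M N \<Psi> x = differential M (snd (chart_at N (\<Psi> x)) \<circ> \<Psi>) x"


section \<open>Vector bundles and connections\<close>

text \<open>
  All fibres of a vector bundle have the underlying vector space \<open>'v\<close>; the smooth structure is
  given by local trivializations \<open>(U, \<tau>)\<close>, where \<open>\<tau> x\<close> maps the fibre over \<open>x \<in> U\<close> to the model
  fibre. A section is just a function into \<open>'v\<close>, and a bundle is identified with its set of local
  trivializations.
\<close>

type_synonym ('m, 'v) vec_bundle = "('m set \<times> ('m \<Rightarrow> 'v \<Rightarrow> 'v)) set"

definition vector_bundle ::
  "('m::topological_space, 'e::euclidean_space) manifold \<Rightarrow> ('m, 'v::euclidean_space) vec_bundle \<Rightarrow> bool" where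
  "vector_bundle M E \<longleftrightarrow>
     (\<forall>(U, \<tau>)\<in>E. open U \<and> U \<subseteq> points M \<and> (\<forall>x\<in>U. linear (\<tau> x) \<and> bij (\<tau> x))) \<and>
     points M \<subseteq> (\<Union>(U, \<tau>)\<in>E. U) \<and>
     (\<forall>(U, \<tau>)\<in>E. \<forall>(W, \<sigma>)\<in>E. \<forall>v. smooth_map_on M (U \<inter> W) (\<lambda>x. \<sigma> x (inv (\<tau> x) v)))"

definition smooth_section_on ::
  "('m::topological_space, 'e::euclidean_space) manifold \<Rightarrow> ('m, 'v::euclidean_space) vec_bundle \<Rightarrow>
   'm set \<Rightarrow> ('m \<Rightarrow> 'v) \<Rightarrow> bool" where
  "smooth_section_on M E U s \<longleftrightarrow> (\<forall>(W, \<tau>)\<in>E. smooth_map_on M (U \<inter> W) (\<lambda>x. \<tau> x (s x)))"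

definition tangent_bundle :: "('m, 'e::euclidean_space) manifold \<Rightarrow> ('m, 'e) vec_bundle" where
  "tangent_bundle M = (\<lambda>c. (fst c, chart_components M c)) ` atlas M"

definition pullback_bundle ::
  "('m, 'e) manifold \<Rightarrow> ('m \<Rightarrow> 'n) \<Rightarrow> ('n, 'v) vec_bundle \<Rightarrow> ('m, 'v) vec_bundle" where
  "pullback_bundle M \<Psi> E = (\<lambda>(U, \<tau>). ({x \<in> points M. \<Psi> x \<in> U}, \<lambda>x. \<tau> (\<Psi> x))) ` E"

abbreviation smooth_vector_field_on ::
  "('m::topological_space, 'e::euclidean_space) manifold \<Rightarrow> 'm set \<Rightarrow> ('m \<Rightarrow> 'e) \<Rightarrow> bool" where
  "smooth_vector_field_on M \<equiv> smooth_section_on M (tangent_bundle M)"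

definition lie_bracket ::
  "('m, 'e::euclidean_space) manifold \<Rightarrow> ('m \<Rightarrow> 'e) \<Rightarrow> ('m \<Rightarrow> 'e) \<Rightarrow> 'm \<Rightarrow> 'e" where
  "lie_bracket M X Y x =
     (let c = chart_at M x; components = (\<lambda>Z y. chart_components M c y (Z y)) in
      differential M (components Y) x (X x) - differential M (components X) x (Y x))"

text \<open>
  A linear connection is written \<open>D x V s\<close> for the covariant derivative at \<open>x\<close> of the section \<open>s\<close>
  in direction of the tangent vector \<open>V\<close> at \<open>x\<close>. Only sections that are smooth near \<open>x\<close> matter.
  Independence of the values of \<open>s\<close> away from \<open>x\<close> follows from the Leibniz rule, applied with the
  function that is 1 on an open set \<open>U\<close> and 0 elsewhere.
\<close>

type_synonym ('m, 'e, 'v) connection = "'m \<Rightarrow> 'e \<Rightarrow> ('m \<Rightarrow> 'v) \<Rightarrow> 'v"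

definition linear_connection ::
  "('m::topological_space, 'e::euclidean_space) manifold \<Rightarrow> ('m, 'v::euclidean_space) vec_bundle \<Rightarrow>
   ('m, 'e, 'v) connection \<Rightarrow> bool" where
  "linear_connection M E D \<longleftrightarrow>
     (\<forall>U s. open U \<and> U \<subseteq> points M \<and> smooth_section_on M E U s \<longrightarrow>
        (\<forall>x\<in>U. linear (\<lambda>V. D x V s)) \<and>
        (\<forall>X. smooth_vector_field_on M U X \<longrightarrow> smooth_section_on M E U (\<lambda>x. D x (X x) s)) \<and>
        (\<forall>s'. smooth_section_on M E U s' \<longrightarrow>
           (\<forall>x\<in>U. \<forall>V. D x V (\<lambda>y. s y + s' y) = D x V s + D x V s')) \<and>
        (\<forall>f::'m \<Rightarrow> real. smooth_map_on M U f \<longrightarrow>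
           (\<forall>x\<in>U. \<forall>V. D x V (\<lambda>y. f y *\<^sub>R s y) = differential M f x V *\<^sub>R s x + f x *\<^sub>R D x V s)))"

text \<open>
  The curvature tensor at \<open>x\<close>, obtained by extending tangent vectors and fibre elements to local
  sections that are constant in some local trivialization; the curvature being tensorial, any other
  local smooth extensions give the same value.
\<close>

definition extend_at :: "('m, 'v) vec_bundle \<Rightarrow> 'm \<Rightarrow> 'v \<Rightarrow> 'm \<Rightarrow> 'v" where
  "extend_at E x e = (let (U, \<tau>) = (SOME (U, \<tau>). (U, \<tau>) \<in> E \<and> x \<in> U) in (\<lambda>y. inv (\<tau> y) (\<tau> x e)))"

definition curvature_of_fields ::
  "('m, 'e::euclidean_space) manifold \<Rightarrow> ('m, 'e, 'v::real_vector) connection \<Rightarrow>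
   ('m \<Rightarrow> 'e) \<Rightarrow> ('m \<Rightarrow> 'e) \<Rightarrow> ('m \<Rightarrow> 'v) \<Rightarrow> 'm \<Rightarrow> 'v" where
  "curvature_of_fields M D X Y s x =
     D x (X x) (\<lambda>y. D y (Y y) s) - D x (Y x) (\<lambda>y. D y (X y) s) - D x (lie_bracket M X Y x) s"

definition curvature ::
  "('m, 'e::euclidean_space) manifold \<Rightarrow> ('m, 'v::real_vector) vec_bundle \<Rightarrow>
   ('m, 'e, 'v) connection \<Rightarrow> 'm \<Rightarrow> 'e \<Rightarrow> 'e \<Rightarrow> 'v \<Rightarrow> 'v" where
  "curvature M E D x V W e =
     curvature_of_fields M D
       (extend_at (tangent_bundle M) x V) (extend_at (tangent_bundle M) x W) (extend_at E x e) x"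

definition lin_trace :: "('a::euclidean_space \<Rightarrow> 'a) \<Rightarrow> real" where
  "lin_trace A = (\<Sum>b\<in>Basis. A b \<bullet> b)"

definition ricci ::
  "('m, 'e::euclidean_space) manifold \<Rightarrow> ('m, 'e, 'e) connection \<Rightarrow> 'm \<Rightarrow> 'e \<Rightarrow> 'e \<Rightarrow> real" where
  "ricci M D x V W = lin_trace (\<lambda>Z. curvature M (tangent_bundle M) D x Z V W)"


section \<open>Metrics\<close>

text \<open>No nondegeneracy is required of a smooth symmetric bilinear form.\<close>

definition smooth_symmetric_form ::
  "('m::topological_space, 'e::euclidean_space) manifold \<Rightarrow> ('m, 'v::euclidean_space) vec_bundle \<Rightarrow>
   ('m \<Rightarrow> 'v \<Rightarrow> 'v \<Rightarrow> real) \<Rightarrow> bool" where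
  "smooth_symmetric_form M E h \<longleftrightarrow>
     (\<forall>x\<in>points M. bilinear (h x) \<and> (\<forall>v w. h x v w = h x w v)) \<and>
     (\<forall>(U, \<tau>)\<in>E. \<forall>v w. smooth_map_on M U (\<lambda>x. h x (inv (\<tau> x) v) (inv (\<tau> x) w)))"

definition riemannian_metric ::
  "('m::topological_space, 'e::euclidean_space) manifold \<Rightarrow> ('m \<Rightarrow> 'e \<Rightarrow> 'e \<Rightarrow> real) \<Rightarrow> bool" where
  "riemannian_metric M g \<longleftrightarrow>
     smooth_symmetric_form M (tangent_bundle M) g \<and> (\<forall>x\<in>points M. \<forall>v. v \<noteq> 0 \<longrightarrow> g x v v > 0)"

text \<open>Signature (1, k) with exactly one negative direction.\<close>

definition lorentzian_form :: "('v::real_vector \<Rightarrow> 'v \<Rightarrow> real) \<Rightarrow> bool" where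
  "lorentzian_form b \<longleftrightarrow> (\<exists>e. b e e < 0 \<and> (\<forall>v. b e v = 0 \<and> v \<noteq> 0 \<longrightarrow> b v v > 0))"

definition lorentzian_bundle_metric ::
  "('m::topological_space, 'e::euclidean_space) manifold \<Rightarrow> ('m, 'v::euclidean_space) vec_bundle \<Rightarrow>
   ('m \<Rightarrow> 'v \<Rightarrow> 'v \<Rightarrow> real) \<Rightarrow> bool" where
  "lorentzian_bundle_metric M E h \<longleftrightarrow>
     smooth_symmetric_form M E h \<and> (\<forall>x\<in>points M. lorentzian_form (h x))"

definition metric_connection ::
  "('m::topological_space, 'e::euclidean_space) manifold \<Rightarrow> ('m, 'v::euclidean_space) vec_bundle \<Rightarrow>
   ('m \<Rightarrow> 'v \<Rightarrow> 'v \<Rightarrow> real) \<Rightarrow> ('m, 'e, 'v) connection \<Rightarrow> bool" where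
  "metric_connection M E h D \<longleftrightarrow>
     (\<forall>U s s'. open U \<and> U \<subseteq> points M \<and> smooth_section_on M E U s \<and> smooth_section_on M E U s' \<longrightarrow>
        (\<forall>x\<in>U. \<forall>V. differential M (\<lambda>y. h y (s y) (s' y)) x V
           = h x (D x V s) (s' x) + h x (s x) (D x V s')))"

definition torsion_free ::
  "('m::topological_space, 'e::euclidean_space) manifold \<Rightarrow> ('m, 'e, 'e) connection \<Rightarrow> bool" where
  "torsion_free M D \<longleftrightarrow>
     (\<forall>U X Y. open U \<and> U \<subseteq> points M \<and> smooth_vector_field_on M U X \<and> smooth_vector_field_on M U Y \<longrightarrow>
        (\<forall>x\<in>U. D x (X x) Y - D x (Y x) X = lie_bracket M X Y x))"

definition levi_civita_connection ::
  "('m::topological_space, 'e::euclidean_space) manifold \<Rightarrow> ('m \<Rightarrow> 'e \<Rightarrow> 'e \<Rightarrow> real) \<Rightarrow>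
   ('m, 'e, 'e) connection \<Rightarrow> bool" where
  "levi_civita_connection M g D \<longleftrightarrow>
     linear_connection M (tangent_bundle M) D \<and> metric_connection M (tangent_bundle M) g D \<and>
     torsion_free M D"

text \<open>
  The connection induced on the pullback bundle along \<open>\<Psi>\<close> is the linear connection whose value on
  sections of the form \<open>s \<circ> \<Psi>\<close> is given by the chain rule; such sections generate, so it is unique
  (on smooth sections).
\<close>

definition pullback_connection ::
  "('m::topological_space, 'e::euclidean_space) manifold \<Rightarrow>
   ('n::topological_space, 'f::euclidean_space) manifold \<Rightarrow> ('m \<Rightarrow> 'n) \<Rightarrow>
   ('n, 'v::euclidean_space) vec_bundle \<Rightarrow> ('n, 'f, 'v) connection \<Rightarrow> ('m, 'e, 'v) connection \<Rightarrow> bool" where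
  "pullback_connection M N \<Psi> E D D' \<longleftrightarrow>
     linear_connection M (pullback_bundle M \<Psi> E) D' \<and>
     (\<forall>U s. open U \<and> U \<subseteq> points N \<and> smooth_section_on N E U s \<longrightarrow>
        (\<forall>x\<in>points M. \<Psi> x \<in> U \<longrightarrow>
           (\<forall>V. D' x V (s \<circ> \<Psi>) = D (\<Psi> x) (tangent_map M N \<Psi> x V) s)))"


section \<open>Conformal structures and conformal tractor bundles\<close>

definition conformal_on ::
  "('m::topological_space, 'e::euclidean_space) manifold \<Rightarrow> 'm set \<Rightarrow>
   ('m \<Rightarrow> 'e \<Rightarrow> 'e \<Rightarrow> real) \<Rightarrow> ('m \<Rightarrow> 'e \<Rightarrow> 'e \<Rightarrow> real) \<Rightarrow> bool" where
  "conformal_on M U g h \<longleftrightarrow>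
     (\<exists>f. smooth_map_on M U f \<and> (\<forall>x\<in>U. \<forall>V W. h x V W = exp (2 * f x) * g x V W))"

definition conformal_structure ::
  "('m::topological_space, 'e::euclidean_space) manifold \<Rightarrow> ('m \<Rightarrow> 'e \<Rightarrow> 'e \<Rightarrow> real) set \<Rightarrow> bool" where
  "conformal_structure M c \<longleftrightarrow>
     (\<exists>g. riemannian_metric M g \<and>
        c = {h. riemannian_metric M h \<and> conformal_on M (points M) g h})"

text \<open>
  The line subbundle is given by its fibres \<open>line x\<close>, and its orientation by the sets
  \<open>positive x\<close> of positive elements of the fibres.
\<close>

record ('m, 'e, 'v) tractor_data =
  tbundle :: "('m, 'v) vec_bundle"
  line :: "'m \<Rightarrow> 'v set"
  positive :: "'m \<Rightarrow> 'v set"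
  metric :: "'m \<Rightarrow> 'v \<Rightarrow> 'v \<Rightarrow> real"
  connection :: "('m, 'e, 'v) connection"

definition oriented_line_subbundle ::
  "('m::topological_space, 'e::euclidean_space) manifold \<Rightarrow> ('m, 'v::euclidean_space) vec_bundle \<Rightarrow>
   ('m \<Rightarrow> 'v set) \<Rightarrow> ('m \<Rightarrow> 'v set) \<Rightarrow> bool" where
  "oriented_line_subbundle M E L P \<longleftrightarrow>
     (\<forall>x\<in>points M. \<exists>U \<sigma>. open U \<and> x \<in> U \<and> U \<subseteq> points M \<and> smooth_section_on M E U \<sigma> \<and>
        (\<forall>y\<in>U. \<sigma> y \<noteq> 0 \<and> L y = span {\<sigma> y} \<and> P y = {a *\<^sub>R \<sigma> y | a. a > 0}))"

definition conformal_tractor_bundle ::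
  "('m::topological_space, 'e::euclidean_space) manifold \<Rightarrow>
   ('m, 'e, 'v::euclidean_space) tractor_data \<Rightarrow> bool" where
  "conformal_tractor_bundle M T \<longleftrightarrow>
     DIM('v) = DIM('e) + 2 \<and>
     vector_bundle M (tbundle T) \<and>
     lorentzian_bundle_metric M (tbundle T) (metric T) \<and>
     oriented_line_subbundle M (tbundle T) (line T) (positive T) \<and>
     (\<forall>x\<in>points M. \<forall>l\<in>line T x. metric T x l l = 0)"

definition line_section_on ::
  "('m::topological_space, 'e::euclidean_space) manifold \<Rightarrow>
   ('m, 'e, 'v::euclidean_space) tractor_data \<Rightarrow> 'm set \<Rightarrow> ('m \<Rightarrow> 'v) \<Rightarrow> bool" where
  "line_section_on M T U \<sigma> \<longleftrightarrow>
     open U \<and> U \<subseteq> points M \<and> smooth_section_on M (tbundle T) U \<sigma> \<and> (\<forall>x\<in>U. \<sigma> x \<in> line T x)"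

definition line_perp :: "('m, 'e, 'v) tractor_data \<Rightarrow> 'm \<Rightarrow> 'v set" where
  "line_perp T x = {v. \<forall>l\<in>line T x. metric T x v l = 0}"

text \<open>Elements of quotient spaces are cosets.\<close>

definition coset :: "'v::real_vector set \<Rightarrow> 'v \<Rightarrow> 'v set" where
  "coset L v = (\<lambda>l. v + l) ` L"

definition line_quotient :: "('m, 'e, 'v::real_vector) tractor_data \<Rightarrow> 'm \<Rightarrow> 'v set set" where
  "line_quotient T x = coset (line T x) ` line_perp T x"

text \<open>
  The linear maps from the fibre of the line subbundle to the fibre of the quotient bundle;
  linear combinations of cosets are computed with representatives.
\<close>

definition line_hom :: "('m, 'e, 'v::real_vector) tractor_data \<Rightarrow> 'm \<Rightarrow> ('v \<Rightarrow> 'v set) set" where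
  "line_hom T x =
     {A \<in> line T x \<rightarrow>\<^sub>E line_quotient T x.
        \<forall>l\<in>line T x. \<forall>m\<in>line T x. \<forall>v\<in>A l. \<forall>w\<in>A m. \<forall>a b.
          A (a *\<^sub>R l + b *\<^sub>R m) = coset (line T x) (a *\<^sub>R v + b *\<^sub>R w)}"

definition tractor_beta_sec ::
  "('m, 'e, 'v::real_vector) tractor_data \<Rightarrow> ('m \<Rightarrow> 'v) \<Rightarrow> 'm \<Rightarrow> 'e \<Rightarrow> 'v set" where
  "tractor_beta_sec T \<sigma> x V = coset (line T x) (connection T x V \<sigma>)"

text \<open>
  The value of \<open>tractor_beta\<close> on \<open>l\<close> does not depend on the section through \<open>l\<close>, by the Leibniz rule.
\<close>

definition tractor_beta ::
  "('m::topological_space, 'e::euclidean_space) manifold \<Rightarrow>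
   ('m, 'e, 'v::euclidean_space) tractor_data \<Rightarrow> 'm \<Rightarrow> 'e \<Rightarrow> 'v \<Rightarrow> 'v set" where
  "tractor_beta M T x V =
     (\<lambda>l\<in>line T x.
        tractor_beta_sec T (SOME \<sigma>. \<sigma> x = l \<and> (\<exists>U. x \<in> U \<and> line_section_on M T U \<sigma>)) x V)"

text \<open>
  Linearity and smoothness of \<open>tractor_beta\<close> are part of the connection being linear and smooth, so
  it is a bundle isomorphism as soon as it is fibrewise a bijection onto the Hom bundle.
\<close>

definition tractor_connection ::
  "('m::topological_space, 'e::euclidean_space) manifold \<Rightarrow>
   ('m, 'e, 'v::euclidean_space) tractor_data \<Rightarrow> bool" where
  "tractor_connection M T \<longleftrightarrow>
     linear_connection M (tbundle T) (connection T) \<and>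
     metric_connection M (tbundle T) (metric T) (connection T) \<and>
     (\<forall>x\<in>points M. bij_betw (tractor_beta M T x) UNIV (line_hom T x))"

text \<open>
  The bundle metric induced on the quotient is evaluated on the representatives given by the
  connection.
\<close>

definition section_metric ::
  "('m, 'e, 'v) tractor_data \<Rightarrow> ('m \<Rightarrow> 'v) \<Rightarrow> 'm \<Rightarrow> 'e \<Rightarrow> 'e \<Rightarrow> real" where
  "section_metric T \<sigma> x V W = metric T x (connection T x V \<sigma>) (connection T x W \<sigma>)"

definition standard_conformal_tractor_bundle ::
  "('m::topological_space, 'e::euclidean_space) manifold \<Rightarrow> ('m \<Rightarrow> 'e \<Rightarrow> 'e \<Rightarrow> real) set \<Rightarrow>
   ('m, 'e, 'v::euclidean_space) tractor_data \<Rightarrow> bool" where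
  "standard_conformal_tractor_bundle M c T \<longleftrightarrow>
     conformal_tractor_bundle M T \<and> tractor_connection M T \<and>
     (\<forall>U \<sigma>. line_section_on M T U \<sigma> \<and> (\<forall>x\<in>U. \<sigma> x \<noteq> 0) \<longrightarrow>
        (\<forall>g\<in>c. conformal_on M U g (section_metric T \<sigma>)))"

abbreviation tractor_curvature ::
  "('m, 'e::euclidean_space) manifold \<Rightarrow> ('m, 'e, 'v::real_vector) tractor_data \<Rightarrow>
   'm \<Rightarrow> 'e \<Rightarrow> 'e \<Rightarrow> 'v \<Rightarrow> 'v" where
  "tractor_curvature M T \<equiv> curvature M (tbundle T) (connection T)"

text \<open>
  The endomorphism of the tangent space induced by the curvature: conjugate the map
  \<open>v + line \<mapsto> R(V,W)v + line\<close> by \<open>tractor_beta_sec T \<sigma> x\<close>.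
\<close>

definition induced_curvature ::
  "('m, 'e::euclidean_space) manifold \<Rightarrow> ('m, 'e, 'v::real_vector) tractor_data \<Rightarrow>
   ('m \<Rightarrow> 'v) \<Rightarrow> 'm \<Rightarrow> 'e \<Rightarrow> 'e \<Rightarrow> 'e \<Rightarrow> 'e" where
  "induced_curvature M T \<sigma> x V W Z =
     inv (tractor_beta_sec T \<sigma> x)
       (coset (line T x) (tractor_curvature M T x V W (connection T x Z \<sigma>)))"

definition normal_conformal_tractor_bundle ::
  "('m::topological_space, 'e::euclidean_space) manifold \<Rightarrow> ('m \<Rightarrow> 'e \<Rightarrow> 'e \<Rightarrow> real) set \<Rightarrow>
   ('m, 'e, 'v::euclidean_space) tractor_data \<Rightarrow> bool" where
  "normal_conformal_tractor_bundle M c T \<longleftrightarrow>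
     standard_conformal_tractor_bundle M c T \<and>
     (\<forall>x\<in>points M. \<forall>V W. tractor_curvature M T x V W ` line T x \<subseteq> line T x) \<and>
     (\<forall>U \<sigma>. line_section_on M T U \<sigma> \<and> (\<forall>x\<in>U. \<sigma> x \<noteq> 0) \<longrightarrow>
        (\<forall>x\<in>U. \<forall>W Z. lin_trace (\<lambda>V. induced_curvature M T \<sigma> x V W Z) = 0))"


section \<open>Admissible families and the associated Lorentzian manifold\<close>

definition nonsingular_within ::
  "('m, 'e::euclidean_space) manifold \<Rightarrow> (real \<Rightarrow> 'm \<Rightarrow> 'e \<Rightarrow> 'e) \<Rightarrow> real \<Rightarrow> bool" where
  "nonsingular_within M \<gamma> \<delta> \<longleftrightarrow> \<delta> > 0 \<and> (\<forall>r. \<bar>r\<bar> < \<delta> \<longrightarrow> (\<forall>x\<in>points M. bij (\<gamma> r x)))"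

text \<open>Smoothness of the family is joint smoothness in the parameter and the point.\<close>

definition admissible_family ::
  "('m::topological_space, 'e::euclidean_space) manifold \<Rightarrow> ('m \<Rightarrow> 'e \<Rightarrow> 'e \<Rightarrow> real) set \<Rightarrow>
   (real \<Rightarrow> 'm \<Rightarrow> 'e \<Rightarrow> 'e) \<Rightarrow> bool" where
  "admissible_family M c \<gamma> \<longleftrightarrow>
     (\<forall>r. \<forall>x\<in>points M. linear (\<gamma> r x)) \<and>
     (\<forall>(U, \<tau>)\<in>tangent_bundle M. \<forall>v.
        smooth_map_on (product_manifold (line_manifold UNIV) M) (UNIV \<times> U)
          (\<lambda>(r, x). \<tau> x (\<gamma> r x (inv (\<tau> x) v)))) \<and>
     (\<forall>h\<in>c. \<forall>r. \<forall>x\<in>points M. \<forall>V W. h x (\<gamma> r x V) W = h x V (\<gamma> r x W)) \<and>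
     (\<forall>x\<in>points M. \<gamma> 0 x = id) \<and>
     (\<exists>\<delta>. nonsingular_within M \<gamma> \<delta>)"

text \<open>
  Points are written \<open>(t, r, x)\<close>. The tangent space at such a point is the product of the
  tangent spaces of the factors; a tangent vector is written \<open>(a, b, V)\<close> with \<open>a = dt\<close>, \<open>b = dr\<close>,
  and \<open>r * a + t * b\<close> is the value of \<open>d(rt)\<close> on it.
\<close>

definition ambient_manifold ::
  "('m, 'e) manifold \<Rightarrow> real \<Rightarrow> (real \<times> real \<times> 'm, real \<times> real \<times> 'e) manifold" where
  "ambient_manifold M \<delta> =
     product_manifold (line_manifold {0<..}) (product_manifold (line_manifold {-\<delta><..<\<delta>}) M)"

definition ambient_metric ::
  "('m \<Rightarrow> 'e \<Rightarrow> 'e \<Rightarrow> real) \<Rightarrow> (real \<Rightarrow> 'm \<Rightarrow> 'e \<Rightarrow> 'e) \<Rightarrow>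
   real \<times> real \<times> 'm \<Rightarrow> real \<times> real \<times> 'e \<Rightarrow> real \<times> real \<times> 'e \<Rightarrow> real" where
  "ambient_metric g \<gamma> = (\<lambda>(t, r, x) (a, b, V) (a', b', V').
     (r * a + t * b) * a' + a * (r * a' + t * b') + t\<^sup>2 * g x (\<gamma> r x V) V')"

definition natural_lifts ::
  "('m::topological_space, 'e::euclidean_space) manifold \<Rightarrow>
   (real \<times> real \<times> 'm \<Rightarrow> real \<times> real \<times> 'e) set" where
  "natural_lifts M = {\<lambda>(t, r, x). (0, 0, X x) | X. smooth_vector_field_on M (points M) X}"

definition ambient_immersion :: "('m \<Rightarrow> real) \<Rightarrow> 'm \<Rightarrow> real \<times> real \<times> 'm" where
  "ambient_immersion u x = (exp (u x), 0, x)"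

definition ambient_normal :: "('m \<Rightarrow> real) \<Rightarrow> 'm \<Rightarrow> real \<times> real \<times> 'e::real_vector" where
  "ambient_normal u x = exp (u x) *\<^sub>R (1, 0, 0)"

text \<open>
  The tractor bundle associated with an immersion \<open>\<Psi>\<close> into \<open>(N, h)\<close> and a lightlike normal field
  \<open>\<xi>\<close>, for a given connection \<open>D\<close> on the pullback of the tangent bundle of \<open>N\<close>.
\<close>

definition associated_tractor_bundle ::
  "('m, 'e) manifold \<Rightarrow> ('n, 'f::euclidean_space) manifold \<Rightarrow> ('n \<Rightarrow> 'f \<Rightarrow> 'f \<Rightarrow> real) \<Rightarrow>
   ('m \<Rightarrow> 'n) \<Rightarrow> ('m \<Rightarrow> 'f) \<Rightarrow> ('m, 'e, 'f) connection \<Rightarrow> ('m, 'e, 'f) tractor_data" where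
  "associated_tractor_bundle M N h \<Psi> \<xi> D =
     \<lparr>tbundle = pullback_bundle M \<Psi> (tangent_bundle N),
      line = (\<lambda>x. span {\<xi> x}),
      positive = (\<lambda>x. {a *\<^sub>R \<xi> x | a. a > 0}),
      metric = (\<lambda>x. h (\<Psi> x)),
      connection = D\<rparr>"

end

theory Submission
  imports Defs
begin

text \<open>
  The position field \<open>t\<partial>\<^sub>t\<close> has covariant derivative \<open>V\<close> in every direction \<open>V\<close>, because it is
  homothetic and dual to the differential of \<open>r t\<^sup>2\<close>. Its restriction along the immersion is the
  lightlike normal field, so the ambient curvature annihilates that field, and by the symmetries of
  the curvature tensor \<open>\<partial>\<^sub>t\<close> drops out of every slot. At \<open>r = 0\<close> the metric dual of \<open>t\<partial>\<^sub>t\<close> is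
  \<open>t\<^sup>2 dr\<close>, so the curvature has no \<open>\<partial>\<^sub>r\<close> component there. Hence the first normalization condition
  is automatic, and the endomorphism induced on the tangent bundle of \<open>M\<close> has the same trace as the
  full ambient curvature, which is the Ricci tensor on lifts. The dilations \<open>t \<mapsto> k t\<close> are
  homotheties, so this trace does not depend on \<open>t\<close> and vanishes on all of \<open>r = 0\<close> as soon as it
  vanishes on the image of the immersion.
\<close>


section \<open>Smooth functions on Euclidean space\<close>

text \<open>Two features of the definitions shape the work. Tangent vectors are components in a
  preferred chart that jumps from point to point, and \<open>curvature\<close> evaluates extensions
  picked by \<open>SOME\<close>. Both are absorbed by the Christoffel formula for the curvature,
  which holds in every chart and for every extension; the geometry then becomes calculus on one
  coordinate domain, in the locale \<open>ambient_chart\<close>. There the metric contains the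
  unspecified family \<open>H\<close>, so only computations that avoid derivatives of
  \<open>H\<close> can be explicit: those involving \<open>\<partial>\<^sub>t\<close>, since
  \<open>H\<close> does not depend on \<open>t\<close>. The slots of the curvature are treated
  separately. The last one uses that the covariant derivative of X =
  \<open>t\<partial>\<^sub>t\<close> is the identity and that the torsion vanishes. The first one
  uses that the flow of X preserves the connection, which expresses R(X, .) by the second covariant
  derivative of X, and this is zero; antisymmetry gives the middle slot. The function
  \<open>u\<close> enters only through the \<open>\<partial>\<^sub>t\<close> component of the
  differential of the immersion and disappears with it. Bump functions come in because natural lifts
  start from fields on all of \<open>M\<close>.\<close>

lemma Ck_on_subset: "Ck_on k S f \<Longrightarrow> T \<subseteq> S \<Longrightarrow> Ck_on k T f"
  by (induction k arbitrary: f) (auto intro: continuous_on_subset)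

lemma Ck_on_cong:
  assumes "open S" "\<And>x. x \<in> S \<Longrightarrow> f x = g x" "Ck_on k S f"
  shows "Ck_on k S g"
  using assms(2,3)
proof (induction k arbitrary: f g)
  case 0
  then show ?case using continuous_on_cong by fastforce
next
  case (Suc k)
  have *: "(g has_derivative frechet_derivative f (at x)) (at x)" if "x \<in> S" for x
    using Suc.prems that assms(1) has_derivative_transform_within_open frechet_derivative_works
    by (metis Ck_on.simps(2))
  have "frechet_derivative f (at x) = frechet_derivative g (at x)" if "x \<in> S" for x
    using *[OF that] by (rule frechet_derivative_at)
  then have "Ck_on k S (\<lambda>x. frechet_derivative g (at x) v)" for v
    using Suc.IH[of "\<lambda>x. frechet_derivative f (at x) v"] Suc.prems(2) by auto
  with * show ?case by (auto simp: differentiable_def)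
qed

lemma Ck_on_Suc_D: "Ck_on (Suc k) S f \<Longrightarrow> Ck_on k S f"
proof (induction k arbitrary: f)
  case 0
  then show ?case
    by (auto simp: intro!: continuous_at_imp_continuous_on differentiable_imp_continuous_within)
qed auto

lemma Ck_on_SucI:
  assumes "open S" "\<And>x. x \<in> S \<Longrightarrow> (f has_derivative f' x) (at x)"
    and "\<And>v. Ck_on k S (\<lambda>x. f' x v)"
  shows "Ck_on (Suc k) S f"
proof -
  have "f' x = frechet_derivative f (at x)" if "x \<in> S" for x
    using assms(2)[OF that] by (rule frechet_derivative_at)
  then have "Ck_on k S (\<lambda>x. frechet_derivative f (at x) v)" for v
    using Ck_on_cong[OF assms(1) _ assms(3)] by simp
  with assms(2) show ?thesis by (auto simp: differentiable_def)
qed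

lemma Ck_on_Union:
  assumes "\<And>S. S \<in> A \<Longrightarrow> open S" "\<And>S. S \<in> A \<Longrightarrow> Ck_on k S f"
  shows "Ck_on k (\<Union>A) f"
  using assms(2)
  by (induction k arbitrary: f) (auto intro: continuous_on_open_Union assms(1))

lemma Ck_on_const: "Ck_on k S (\<lambda>x. c)"
  by (induction k arbitrary: c) auto

lemma Ck_on_bounded_linear: "bounded_linear f \<Longrightarrow> Ck_on k S f"
proof (induction k)
  case 0
  then show ?case by (simp add: linear_continuous_on)
next
  case (Suc k)
  have "f differentiable at x" for x
    using Suc by (simp add: bounded_linear_imp_differentiable)
  moreover have "frechet_derivative f (at x) = f" for x
    using Suc bounded_linear_imp_has_derivative frechet_derivative_at by metis
  ultimately show ?case by (simp add: Ck_on_const)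
qed

lemma Ck_on_add:
  assumes "open S" "Ck_on k S f" "Ck_on k S g"
  shows "Ck_on k S (\<lambda>x. f x + g x)"
  using assms(2,3)
proof (induction k arbitrary: f g)
  case (Suc k)
  let ?d = "\<lambda>f x. frechet_derivative f (at x)"
  from Suc have "((\<lambda>x. f x + g x) has_derivative (\<lambda>v. ?d f x v + ?d g x v)) (at x)" if "x \<in> S" for x
    using that by (intro has_derivative_add) (auto simp: frechet_derivative_works)
  then show ?case using Suc by (intro Ck_on_SucI[OF assms(1)]) auto
qed (auto intro: continuous_on_add)

lemma Ck_on_bilinear:
  assumes "open S" "bounded_bilinear B" "Ck_on k S f" "Ck_on k S g"
  shows "Ck_on k S (\<lambda>x. B (f x) (g x))"
  using assms(3,4)
proof (induction k arbitrary: f g)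
  case 0
  then show ?case by (auto intro!: bounded_bilinear.continuous_on[OF assms(2)])
next
  case (Suc k)
  let ?f = "\<lambda>x. frechet_derivative f (at x)" and ?g = "\<lambda>x. frechet_derivative g (at x)"
  have "((\<lambda>x. B (f x) (g x)) has_derivative (\<lambda>v. B (f x) (?g x v) + B (?f x v) (g x))) (at x)"
    if "x \<in> S" for x
    using Suc.prems that
    by (intro bounded_bilinear.FDERIV[OF assms(2)]) (auto simp: frechet_derivative_works)
  moreover have "Ck_on k S (\<lambda>x. B (f x) (?g x v) + B (?f x v) (g x))" for v
    using Suc.prems Ck_on_Suc_D[of k S f] Ck_on_Suc_D[of k S g]
    by (intro Ck_on_add[OF assms(1)] Suc.IH) auto
  ultimately show ?case by (rule Ck_on_SucI[OF assms(1)])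
qed

lemma Ck_on_sum:
  assumes "open S" "\<And>i. i \<in> I \<Longrightarrow> Ck_on k S (f i)"
  shows "Ck_on k S (\<lambda>x. \<Sum>i\<in>I. f i x)"
  using assms(2) by (induction I rule: infinite_finite_induct) (auto intro: Ck_on_const Ck_on_add assms(1))

text \<open>Trades a varying argument of a linear map for scalar coefficients and fixed basis
  arguments. \<open>Ck_on\<close> speaks of derivatives in fixed directions only, so the chain rule
  and the product rule for families of linear maps pass through this expansion.\<close>

lemma linear_expand:
  fixes f :: "'a::euclidean_space \<Rightarrow> 'b::real_vector"
  assumes "linear f"
  shows "f v = (\<Sum>b\<in>Basis. (v \<bullet> b) *\<^sub>R f b)"
proof -
  have "f v = f (\<Sum>b\<in>Basis. (v \<bullet> b) *\<^sub>R b)" by (simp add: euclidean_representation)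
  also have "\<dots> = (\<Sum>b\<in>Basis. (v \<bullet> b) *\<^sub>R f b)"
    by (simp add: linear_sum[OF assms] linear_scale[OF assms])
  finally show ?thesis .
qed

text \<open>The induction hypothesis covers the derivative of \<open>f\<close> in a fixed direction,
  whereas the chain rule produces the direction \<open>?g x v\<close>, which moves with
  \<open>x\<close>. Expanding it in the basis leaves the compositions \<open>?f (g x) b\<close> with
  fixed \<open>b\<close>, times coefficients that are themselves of class \<open>k\<close>.\<close>

lemma Ck_on_compose:
  fixes g :: "'a::euclidean_space \<Rightarrow> 'b::euclidean_space" and f :: "'b \<Rightarrow> 'c::real_normed_vector"
  assumes "open S" "open T" "Ck_on k S g" "Ck_on k T f" "g ` S \<subseteq> T"
  shows "Ck_on k S (\<lambda>x. f (g x))"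
  using assms(3,4)
proof (induction k arbitrary: f)
  case 0
  then show ?case using assms(5) by (auto intro: continuous_on_compose2)
next
  case (Suc k)
  let ?g = "\<lambda>x. frechet_derivative g (at x)" and ?f = "\<lambda>x. frechet_derivative f (at x)"
  have df: "(f has_derivative ?f (g x)) (at (g x))" if "x \<in> S" for x
    using Suc.prems(2) that assms(5) by (auto simp: frechet_derivative_works)
  have "((\<lambda>x. f (g x)) has_derivative (\<lambda>v. ?f (g x) (?g x v))) (at x)" if "x \<in> S" for x
  proof (rule has_derivative_compose[where g = f and g' = "?f (g x)" and f = g and f' = "?g x", OF _ df[OF that]])
    show "(g has_derivative ?g x) (at x)"
      using Suc.prems(1) that by (auto simp: frechet_derivative_works)
  qed
  moreover have "?f (g x) (?g x v) = (\<Sum>b\<in>Basis. (?g x v \<bullet> b) *\<^sub>R ?f (g x) b)" if "x \<in> S" for x v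
    using df[OF that] has_derivative_linear by (intro linear_expand) blast
  ultimately have "((\<lambda>x. f (g x)) has_derivative (\<lambda>v. \<Sum>b\<in>Basis. (?g x v \<bullet> b) *\<^sub>R ?f (g x) b)) (at x)"
    if "x \<in> S" for x
    using that by simp
  moreover have "Ck_on k S (\<lambda>x. \<Sum>b\<in>Basis. (?g x v \<bullet> b) *\<^sub>R ?f (g x) b)" for v
  proof (intro Ck_on_sum[OF assms(1)] Ck_on_bilinear[OF assms(1) bounded_bilinear_scaleR])
    fix b :: 'b assume "b \<in> Basis"
    show "Ck_on k S (\<lambda>x. ?g x v \<bullet> b)"
      using Suc.prems(1)
      by (intro Ck_on_bilinear[OF assms(1) bounded_bilinear_inner] Ck_on_const) auto
    show "Ck_on k S (\<lambda>x. ?f (g x) b)"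
      using Suc.prems Ck_on_Suc_D by (intro Suc.IH) auto
  qed
  ultimately show ?case by (intro Ck_on_SucI[OF assms(1)])
qed

section \<open>Exponential, logarithm and a flat function\<close>

lemma Ck_on_real:
  fixes f :: "real \<Rightarrow> real"
  assumes "open S" "\<And>x. x \<in> S \<Longrightarrow> (f has_real_derivative f' x) (at x)" "Ck_on k S f'"
  shows "Ck_on (Suc k) S f"
proof (rule Ck_on_SucI[OF assms(1)])
  show "(f has_derivative (\<lambda>v. f' x * v)) (at x)" if "x \<in> S" for x
    using assms(2)[OF that] by (simp add: has_field_derivative_def)
  show "Ck_on k S (\<lambda>x. f' x * v)" for v
    by (intro Ck_on_bilinear[OF assms(1) bounded_bilinear_mult] assms(3) Ck_on_const)
qed

lemma smooth_on_exp: "smooth_on UNIV (exp :: real \<Rightarrow> real)"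
proof -
  have "Ck_on k UNIV (exp :: real \<Rightarrow> real)" for k
  proof (induction k)
    case (Suc k)
    show ?case by (rule Ck_on_real[OF _ _ Suc]) (auto intro: DERIV_exp)
  qed (auto intro: continuous_intros)
  then show ?thesis by (simp add: smooth_on_def)
qed

lemma has_derivative_inverse_power:
  fixes x :: real
  assumes "x > 0"
  shows "((\<lambda>x. inverse x ^ m) has_real_derivative - real m * inverse x ^ Suc m) (at x)"
proof -
  have "((\<lambda>x. inverse x ^ m) has_real_derivative real m * (- (inverse x ^ Suc (Suc 0)) * inverse x ^ (m - Suc 0))) (at x)"
    using DERIV_power[OF DERIV_inverse, of x m] assms by simp
  then show ?thesis by (cases m) (simp_all add: algebra_simps)
qed

text \<open>Differentiation raises the exponent, so the induction has to run over all
  \<open>m\<close> at once; \<open>m = 1\<close> is the derivative of \<open>ln\<close>.\<close>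

lemma Ck_on_inverse_power: "Ck_on k {0<..} (\<lambda>x::real. inverse x ^ m)"
proof (induction k arbitrary: m)
  case (Suc k)
  show ?case
  proof (rule Ck_on_real[OF _ has_derivative_inverse_power])
    show "Ck_on k {0<..} (\<lambda>x. - real m * inverse x ^ Suc m)"
      by (rule Ck_on_bilinear[OF _ bounded_bilinear_mult Ck_on_const Suc.IH]) simp
  qed auto
qed (auto intro!: continuous_intros)

text \<open>The logarithm turns the squared coefficient of a section of the line bundle into the
  exponent of a conformal factor.\<close>

lemma smooth_on_ln: "smooth_on {0<..} (ln :: real \<Rightarrow> real)"
proof -
  have "Ck_on (Suc k) {0<..} (ln :: real \<Rightarrow> real)" for k
    using Ck_on_inverse_power[of k 1]
    by (intro Ck_on_real[where f' = inverse]) (auto intro: DERIV_ln)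
  then show ?thesis unfolding smooth_on_def by (metis Ck_on_Suc_D)
qed

text \<open>The family is closed under differentiation up to linear combinations.\<close>

lemma Ck_on_flat: "Ck_on k UNIV (\<lambda>x::real. if x > 0 then inverse x ^ m * exp (- inverse x) else 0)"
proof (induction k arbitrary: m)
  define F where "F m x = (if x > 0 then inverse x ^ m * exp (- inverse x) else 0)" for m and x :: real
  have deriv: "(F m has_real_derivative F (m + 2) x - real m * F (m + 1) x) (at x)" for m x
  proof -
    consider "x > 0" | "x < 0" | "x = 0" by linarith
    then show ?thesis
    proof cases
      case 1
      have "((\<lambda>x. inverse x ^ m * exp (- inverse x)) has_real_derivative F (m + 2) x - real m * F (m + 1) x) (at x)"
      proof -
        have "((\<lambda>x. exp (- inverse x)) has_real_derivative exp (- inverse x) * inverse x ^ 2) (at x)"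
          using 1 by (auto intro!: derivative_eq_intros simp: power2_eq_square)
        from DERIV_mult[OF has_derivative_inverse_power[OF 1] this]
        show ?thesis using 1 by (simp add: F_def algebra_simps power2_eq_square)
      qed
      then show ?thesis
        by (rule has_field_derivative_transform_within_open[of _ _ _ "{0<..}"]) (use 1 in \<open>auto simp: F_def\<close>)
    next
      case 2
      have "((\<lambda>x. 0) has_real_derivative F (m + 2) x - real m * F (m + 1) x) (at x)"
        using 2 by (simp add: F_def)
      then show ?thesis
        by (rule has_field_derivative_transform_within_open[of _ _ _ "{..<0}"]) (use 2 in \<open>auto simp: F_def\<close>)
    next
      case 3
      have lim: "((\<lambda>y::real. y ^ Suc m / exp y) \<longlongrightarrow> 0) at_top"
        for m by (rule tendsto_power_div_exp_0)
      have "((\<lambda>h::real. inverse h ^ Suc m / exp (inverse h)) \<longlongrightarrow> 0) (at_right 0)"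
        by (rule filterlim_compose[OF lim filterlim_inverse_at_top_right])
      then have "((\<lambda>h. F m h / h) \<longlongrightarrow> 0) (at_right 0)"
        by (rule tendsto_cong[THEN iffD1, rotated])
          (auto simp: eventually_at_filter F_def exp_minus field_simps)
      moreover have "((\<lambda>h. F m h / h) \<longlongrightarrow> 0) (at_left 0)"
        by (rule tendsto_eventually) (auto simp: eventually_at_filter F_def)
      ultimately have "((\<lambda>h. F m h / h) \<longlongrightarrow> 0) (at 0)"
        by (simp add: filterlim_split_at)
      then show ?thesis using 3 by (simp add: DERIV_def F_def)
    qed
  qed
  {
    case 0
    have "isCont (F m) x" for x using deriv DERIV_isCont by blast
    then show ?case unfolding F_def[symmetric, abs_def] by (simp add: continuous_at_imp_continuous_on)
  next
    case (Suc k)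
    then have IH: "Ck_on k UNIV (F m)" for m unfolding F_def[abs_def] by blast
    have "Ck_on k UNIV (\<lambda>x. F (m + 2) x + (- real m) * F (m + 1) x)"
      by (intro Ck_on_add Ck_on_bilinear[OF _ bounded_bilinear_mult] Ck_on_const IH) auto
    then have "Ck_on (Suc k) UNIV (F m)"
      using deriv by (intro Ck_on_real[where f' = "\<lambda>x. F (m + 2) x + (- real m) * F (m + 1) x"]) auto
    then show ?case unfolding F_def[abs_def] .
  }
qed

section \<open>Closure properties of smooth maps\<close>

lemma smooth_on_subset: "smooth_on S f \<Longrightarrow> T \<subseteq> S \<Longrightarrow> smooth_on T f"
  using Ck_on_subset unfolding smooth_on_def by blast

lemma smooth_on_cong:
  "open S \<Longrightarrow> (\<And>x. x \<in> S \<Longrightarrow> f x = g x) \<Longrightarrow> smooth_on S f \<Longrightarrow> smooth_on S g"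
  using Ck_on_cong unfolding smooth_on_def by metis

lemma smooth_on_Union:
  "(\<And>S. S \<in> A \<Longrightarrow> open S) \<Longrightarrow> (\<And>S. S \<in> A \<Longrightarrow> smooth_on S f) \<Longrightarrow> smooth_on (\<Union>A) f"
  using Ck_on_Union unfolding smooth_on_def by blast

lemma smooth_on_const: "smooth_on S (\<lambda>x. c)"
  by (simp add: smooth_on_def Ck_on_const)

lemma smooth_on_bounded_linear: "bounded_linear f \<Longrightarrow> smooth_on S f"
  by (simp add: smooth_on_def Ck_on_bounded_linear)

lemma smooth_on_bilinear:
  "open S \<Longrightarrow> bounded_bilinear B \<Longrightarrow> smooth_on S f \<Longrightarrow> smooth_on S g \<Longrightarrow> smooth_on S (\<lambda>x. B (f x) (g x))"
  by (simp add: smooth_on_def Ck_on_bilinear)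

lemma smooth_on_add:
  "open S \<Longrightarrow> smooth_on S f \<Longrightarrow> smooth_on S g \<Longrightarrow> smooth_on S (\<lambda>x. f x + g x)"
  by (simp add: smooth_on_def Ck_on_add)

lemma smooth_on_sum:
  "open S \<Longrightarrow> (\<And>i. i \<in> I \<Longrightarrow> smooth_on S (f i)) \<Longrightarrow> smooth_on S (\<lambda>x. \<Sum>i\<in>I. f i x)"
  by (simp add: smooth_on_def Ck_on_sum)

lemma smooth_on_compose:
  fixes g :: "'a::euclidean_space \<Rightarrow> 'b::euclidean_space"
  shows "open S \<Longrightarrow> open T \<Longrightarrow> smooth_on S g \<Longrightarrow> smooth_on T f \<Longrightarrow> g ` S \<subseteq> T \<Longrightarrow> smooth_on S (\<lambda>x. f (g x))"
  unfolding smooth_on_def using Ck_on_compose[of S T _ g f] by blast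

lemma smooth_on_linear_compose:
  fixes g :: "'a::euclidean_space \<Rightarrow> 'b::euclidean_space"
  assumes "open S" "smooth_on S g" "linear L"
  shows "smooth_on S (\<lambda>x. L (g x))"
  using smooth_on_compose[OF assms(1) open_UNIV assms(2) smooth_on_bounded_linear] assms(3)
  by (simp add: linear_conv_bounded_linear)

lemma smooth_on_mult:
  fixes f g :: "'a::euclidean_space \<Rightarrow> real"
  shows "open S \<Longrightarrow> smooth_on S f \<Longrightarrow> smooth_on S g \<Longrightarrow> smooth_on S (\<lambda>x. f x * g x)"
  by (rule smooth_on_bilinear[OF _ bounded_bilinear_mult])

lemma smooth_on_inner_const:
  fixes f :: "'a::euclidean_space \<Rightarrow> 'b::euclidean_space"
  shows "open S \<Longrightarrow> smooth_on S f \<Longrightarrow> smooth_on S (\<lambda>x. f x \<bullet> b)"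
  by (rule smooth_on_bilinear[OF _ bounded_bilinear_inner _ smooth_on_const])

lemma smooth_on_Pair:
  fixes f :: "'a::euclidean_space \<Rightarrow> 'b::euclidean_space" and g :: "'a \<Rightarrow> 'c::euclidean_space"
  assumes "open S" "smooth_on S f" "smooth_on S g"
  shows "smooth_on S (\<lambda>x. (f x, g x))"
proof -
  have "smooth_on S (\<lambda>x. (f x, 0 :: 'c) + (0 :: 'b, g x))"
    using assms
    by (intro smooth_on_add smooth_on_linear_compose[where L = "\<lambda>u. (u, 0)"]
        smooth_on_linear_compose[where L = "\<lambda>u. (0, u)"]) (auto intro!: linearI)
  then show ?thesis by simp
qed

lemma smooth_on_derivative: "smooth_on S f \<Longrightarrow> smooth_on S (\<lambda>x. frechet_derivative f (at x) v)"
  unfolding smooth_on_def by (metis Ck_on.simps(2))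

lemma smooth_on_differentiable: "smooth_on S f \<Longrightarrow> x \<in> S \<Longrightarrow> f differentiable (at x)"
  unfolding smooth_on_def by (metis Ck_on.simps(2))

lemma smooth_on_has_derivative:
  "smooth_on S f \<Longrightarrow> x \<in> S \<Longrightarrow> (f has_derivative frechet_derivative f (at x)) (at x)"
  using smooth_on_differentiable frechet_derivative_works by blast

lemma smooth_on_continuous_on: "smooth_on S f \<Longrightarrow> continuous_on S f"
  unfolding smooth_on_def by (metis Ck_on.simps(1))

text \<open>Product rule in the form in which Jacobians and connection coefficients occur:
  \<open>A\<close> is differentiable for each fixed vector, rather than as a map into a space of
  operators.\<close>

lemma has_derivative_linear_family:
  fixes A :: "'a::real_normed_vector \<Rightarrow> 'b::euclidean_space \<Rightarrow> 'c::real_normed_vector"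
  assumes "open S" "x \<in> S" "\<And>q. q \<in> S \<Longrightarrow> linear (A q)"
    and A': "\<And>v. ((\<lambda>q. A q v) has_derivative A' v) (at x)"
    and Y: "(Y has_derivative Y') (at x)"
  shows "((\<lambda>q. A q (Y q)) has_derivative (\<lambda>h. A' (Y x) h + A x (Y' h))) (at x)"
proof -
  have sum: "((\<lambda>q. \<Sum>b\<in>Basis. (Y q \<bullet> b) *\<^sub>R A q b) has_derivative
      (\<lambda>h. \<Sum>b\<in>Basis. (Y x \<bullet> b) *\<^sub>R A' b h + (Y' h \<bullet> b) *\<^sub>R A x b)) (at x)"
    using Y by (intro has_derivative_sum has_derivative_scaleR A' has_derivative_inner_left)
  \<comment> \<open>Linearity of \<open>A'\<close> in its vector argument is obtained here: with
    \<open>Y\<close> frozen at \<open>x\<close>, uniqueness of derivatives forces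
    \<open>A' (Y x)\<close> to be the same combination of the \<open>A' b\<close> as
    \<open>Y x\<close> is of the \<open>b\<close>.\<close>
  have "((\<lambda>q. \<Sum>b\<in>Basis. (Y x \<bullet> b) *\<^sub>R A q b) has_derivative (\<lambda>h. \<Sum>b\<in>Basis. (Y x \<bullet> b) *\<^sub>R A' b h)) (at x)"
    by (intro has_derivative_sum has_derivative_scaleR_right A')
  then have "((\<lambda>q. A q (Y x)) has_derivative (\<lambda>h. \<Sum>b\<in>Basis. (Y x \<bullet> b) *\<^sub>R A' b h)) (at x)"
    by (rule has_derivative_transform_within_open[OF _ assms(1,2)]) (simp add: linear_expand[OF assms(3)])
  then have 1: "A' (Y x) = (\<lambda>h. \<Sum>b\<in>Basis. (Y x \<bullet> b) *\<^sub>R A' b h)"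
    using A' has_derivative_unique by blast
  have 2: "A x (Y' h) = (\<Sum>b\<in>Basis. (Y' h \<bullet> b) *\<^sub>R A x b)" for h
    by (rule linear_expand) (rule assms(3)[OF assms(2)])
  have "((\<lambda>q. A q (Y q)) has_derivative
      (\<lambda>h. \<Sum>b\<in>Basis. (Y x \<bullet> b) *\<^sub>R A' b h + (Y' h \<bullet> b) *\<^sub>R A x b)) (at x)"
    by (rule has_derivative_transform_within_open[OF sum assms(1,2)]) (simp add: linear_expand[OF assms(3)])
  then show ?thesis by (simp add: 1 2 sum.distrib)
qed

lemma has_derivative_bilinear_family:
  fixes B :: "'a::real_normed_vector \<Rightarrow> 'b::euclidean_space \<Rightarrow> 'b \<Rightarrow> 'c::real_normed_vector"
  assumes "open S" "x \<in> S" "\<And>q. q \<in> S \<Longrightarrow> bilinear (B q)"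
    and B': "\<And>v w. ((\<lambda>q. B q v w) has_derivative B' v w) (at x)"
    and "(Y has_derivative Y') (at x)" "(Z has_derivative Z') (at x)"
  shows "((\<lambda>q. B q (Y q) (Z q)) has_derivative
    (\<lambda>h. B' (Y x) (Z x) h + B x (Y' h) (Z x) + B x (Y x) (Z' h))) (at x)"
proof -
  have "((\<lambda>q. B q (Y q) w) has_derivative (\<lambda>h. B' (Y x) w h + B x (Y' h) w)) (at x)" for w
    using assms by (intro has_derivative_linear_family[of S x "\<lambda>q v. B q v w" "\<lambda>v. B' v w" Y Y'])
      (auto simp: bilinear_def)
  then show ?thesis
    using assms by (intro has_derivative_linear_family[of S x "\<lambda>q. B q (Y q)" _ Z Z'])
      (auto simp: bilinear_def)
qed

text \<open>
  Applying the mean value theorem in both directions turns the second difference quotient into a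
  mixed second derivative at a nearby point; the quotient is symmetric in the two directions.
\<close>

lemma second_difference_mean_value:
  fixes f :: "'a::euclidean_space \<Rightarrow> real"
  assumes d: "\<And>y. y \<in> S \<Longrightarrow> f differentiable (at y)"
    and d2: "\<And>y. y \<in> S \<Longrightarrow> (\<lambda>y. frechet_derivative f (at y) u) differentiable (at y)"
    and S: "\<And>a b. 0 \<le> a \<Longrightarrow> a \<le> h \<Longrightarrow> 0 \<le> b \<Longrightarrow> b \<le> h \<Longrightarrow> x + a *\<^sub>R u + b *\<^sub>R w \<in> S" and "h > 0"
  obtains a b where "0 \<le> a" "a \<le> h" "0 \<le> b" "b \<le> h"
    "f (x + h *\<^sub>R u + h *\<^sub>R w) - f (x + h *\<^sub>R u) - f (x + h *\<^sub>R w) + f x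
      = h * h * frechet_derivative (\<lambda>y. frechet_derivative f (at y) u) (at (x + a *\<^sub>R u + b *\<^sub>R w)) w"
proof -
  let ?f' = "\<lambda>y. frechet_derivative f (at y)"
  let ?f'' = "\<lambda>y. frechet_derivative (\<lambda>y. ?f' y u) (at y)"
  have lin': "?f' y (c *\<^sub>R v) = c * ?f' y v" if "y \<in> S" for y c v
    using linear_scale[OF linear_frechet_derivative[OF d[OF that]]] by simp
  have lin'': "?f'' y (c *\<^sub>R v) = c * ?f'' y v" if "y \<in> S" for y c v
    using linear_scale[OF linear_frechet_derivative[OF d2[OF that]]] by simp
  define p where "p s = f (x + s *\<^sub>R u + h *\<^sub>R w) - f (x + s *\<^sub>R u)" for s
  have path: "((\<lambda>s. f (x + s *\<^sub>R u + b *\<^sub>R w)) has_real_derivative ?f' (x + s *\<^sub>R u + b *\<^sub>R w) u) (at s)"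
    if "0 \<le> s" "s \<le> h" "0 \<le> b" "b \<le> h" for s b
  proof -
    have "((\<lambda>s. f (x + s *\<^sub>R u + b *\<^sub>R w)) has_derivative (\<lambda>c. ?f' (x + s *\<^sub>R u + b *\<^sub>R w) (c *\<^sub>R u))) (at s)"
      by (rule has_derivative_compose[where f = "\<lambda>s. x + s *\<^sub>R u + b *\<^sub>R w" and g = f])
        (use S[OF that] in \<open>auto intro!: derivative_eq_intros simp: frechet_derivative_works[symmetric] d\<close>)
    then show ?thesis
      using lin'[OF S[OF that]] by (simp add: has_field_derivative_def mult.commute[of _ "?f' _ _"])
  qed
  have "(p has_real_derivative (?f' (x + s *\<^sub>R u + h *\<^sub>R w) u - ?f' (x + s *\<^sub>R u) u)) (at s)"
    if "0 \<le> s" "s \<le> h" for s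
    unfolding p_def using path[of s h] path[of s 0] that \<open>h > 0\<close> by (auto intro!: DERIV_diff)
  from MVT2[OF \<open>h > 0\<close> this] obtain a where a: "0 < a" "a < h"
    "p h - p 0 = h * (?f' (x + a *\<^sub>R u + h *\<^sub>R w) u - ?f' (x + a *\<^sub>R u) u)" by auto
  have "((\<lambda>s. ?f' (x + a *\<^sub>R u + s *\<^sub>R w) u) has_real_derivative ?f'' (x + a *\<^sub>R u + s *\<^sub>R w) w) (at s)"
    if "0 \<le> s" "s \<le> h" for s
  proof -
    have in_S: "x + a *\<^sub>R u + s *\<^sub>R w \<in> S" using that a by (intro S) auto
    have "((\<lambda>s. ?f' (x + a *\<^sub>R u + s *\<^sub>R w) u) has_derivative (\<lambda>c. ?f'' (x + a *\<^sub>R u + s *\<^sub>R w) (c *\<^sub>R w))) (at s)"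
      by (rule has_derivative_compose[where f = "\<lambda>s. x + a *\<^sub>R u + s *\<^sub>R w" and g = "\<lambda>y. ?f' y u"])
        (use in_S in \<open>auto intro!: derivative_eq_intros simp: frechet_derivative_works[symmetric] d2\<close>)
    then show ?thesis
      using lin''[OF in_S] by (simp add: has_field_derivative_def mult.commute[of _ "?f'' _ _"])
  qed
  from MVT2[OF \<open>h > 0\<close> this] obtain b where b: "0 < b" "b < h"
    "?f' (x + a *\<^sub>R u + h *\<^sub>R w) u - ?f' (x + a *\<^sub>R u) u = h * ?f'' (x + a *\<^sub>R u + b *\<^sub>R w) w" by auto
  have "f (x + h *\<^sub>R u + h *\<^sub>R w) - f (x + h *\<^sub>R u) - f (x + h *\<^sub>R w) + f x = p h - p 0"
    by (simp add: p_def)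
  also have "\<dots> = h * h * ?f'' (x + a *\<^sub>R u + b *\<^sub>R w) w" using a(3) b(3) by simp
  finally show ?thesis using a b by (intro that[of a b]) auto
qed

lemma symmetric_second_derivative_real:
  fixes f :: "'a::euclidean_space \<Rightarrow> real"
  assumes "open S" "x \<in> S" "smooth_on S f"
  shows "frechet_derivative (\<lambda>y. frechet_derivative f (at y) u) (at x) w
    = frechet_derivative (\<lambda>y. frechet_derivative f (at y) w) (at x) u"
proof -
  define g where "g u w y = frechet_derivative (\<lambda>y. frechet_derivative f (at y) u) (at y) w" for u w y
  have "\<bar>g u w x - g w u x\<bar> \<le> e" if "e > 0" for e
  proof -
    have "continuous_on S (g u w)" for u w
      unfolding g_def by (intro smooth_on_continuous_on smooth_on_derivative assms(3))
    then have "(g u w \<longlongrightarrow> g u w x) (nhds x)" for u w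
      using assms(1,2) by (simp add: continuous_on_eq_continuous_at isCont_def tendsto_at_iff_tendsto_nhds)
    then have "eventually (\<lambda>y. dist (g u w y) (g u w x) < e / 2) (nhds x)" for u w
      using that tendstoD half_gt_zero by blast
    then have "eventually (\<lambda>y. dist (g u w y) (g u w x) < e / 2 \<and> dist (g w u y) (g w u x) < e / 2 \<and> y \<in> S) (nhds x)"
      using eventually_nhds_in_open[OF assms(1,2)] by (intro eventually_conj)
    then obtain d where d: "d > 0" and close:
      "\<And>y. dist y x < d \<Longrightarrow> dist (g u w y) (g u w x) < e / 2 \<and> dist (g w u y) (g w u x) < e / 2 \<and> y \<in> S"
      unfolding eventually_nhds_metric by blast
    \<comment> \<open>Small enough for every point \<open>x + a u + b w\<close> with coefficients
      between 0 and \<open>h\<close> to lie in the \<open>d\<close>-ball around \<open>x\<close>;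
      the summand 1 covers \<open>u = w = 0\<close>.\<close>
    define h where "h = d / (2 * (norm u + norm w + 1))"
    have h: "h > 0" using d by (simp add: h_def add_nonneg_pos)
    have near: "dist (x + a *\<^sub>R u + b *\<^sub>R w) x < d" if "0 \<le> a" "a \<le> h" "0 \<le> b" "b \<le> h" for a b
    proof -
      have "norm (a *\<^sub>R u + b *\<^sub>R w) \<le> a * norm u + b * norm w"
        using norm_triangle_ineq[of "a *\<^sub>R u" "b *\<^sub>R w"] that by simp
      also have "\<dots> \<le> h * norm u + h * norm w"
        using that by (intro add_mono mult_right_mono) auto
      also have "\<dots> \<le> h * (norm u + norm w + 1)" using h by (simp add: algebra_simps)
      also have "\<dots> = d / 2"
        using add_nonneg_pos[of "norm u + norm w" 1] by (simp add: h_def field_simps)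
      also have "\<dots> < d" using d by simp
      finally show ?thesis by (simp add: dist_norm add.assoc)
    qed
    have diff: "f differentiable (at y)" "(\<lambda>y. frechet_derivative f (at y) v) differentiable (at y)"
      if "y \<in> S" for y v
      using that assms(3) smooth_on_differentiable smooth_on_derivative by blast+
    obtain a b where 1: "0 \<le> a" "a \<le> h" "0 \<le> b" "b \<le> h"
      "f (x + h *\<^sub>R u + h *\<^sub>R w) - f (x + h *\<^sub>R u) - f (x + h *\<^sub>R w) + f x = h * h * g u w (x + a *\<^sub>R u + b *\<^sub>R w)"
      using second_difference_mean_value[of S f u h x w, OF diff] near close h unfolding g_def by metis
    obtain b' a' where 2: "0 \<le> a'" "a' \<le> h" "0 \<le> b'" "b' \<le> h"
      "f (x + h *\<^sub>R w + h *\<^sub>R u) - f (x + h *\<^sub>R w) - f (x + h *\<^sub>R u) + f x = h * h * g w u (x + b' *\<^sub>R w + a' *\<^sub>R u)"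
    proof (rule second_difference_mean_value[of S f w h x u, OF diff])
      show "x + a *\<^sub>R w + b *\<^sub>R u \<in> S" if "0 \<le> a" "a \<le> h" "0 \<le> b" "b \<le> h" for a b
        using near[of b a] close that by (simp add: algebra_simps)
    qed (use h in \<open>auto simp: g_def\<close>)
    have "h * h * g u w (x + a *\<^sub>R u + b *\<^sub>R w) = h * h * g w u (x + b' *\<^sub>R w + a' *\<^sub>R u)"
      using 1(5) 2(5) by (simp add: algebra_simps)
    then have "g u w (x + a *\<^sub>R u + b *\<^sub>R w) = g w u (x + a' *\<^sub>R u + b' *\<^sub>R w)"
      using h by (simp add: algebra_simps)
    then show ?thesis
      using close[OF near[OF 1(1-4)], THEN conjunct1]
        close[OF near[OF 2(1-4)], THEN conjunct2, THEN conjunct1]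
      unfolding dist_real_def by linarith
  qed
  then have "\<bar>g u w x - g w u x\<bar> \<le> 0" by (rule field_le_epsilon) simp
  then show ?thesis by (simp add: g_def)
qed

lemma symmetric_second_derivative:
  fixes f :: "'a::euclidean_space \<Rightarrow> 'b::euclidean_space"
  assumes "open S" "x \<in> S" "smooth_on S f"
  shows "frechet_derivative (\<lambda>y. frechet_derivative f (at y) u) (at x) w
    = frechet_derivative (\<lambda>y. frechet_derivative f (at y) w) (at x) u"
proof (rule euclidean_eqI)
  fix b :: 'b assume "b \<in> Basis"
  have inner: "frechet_derivative (\<lambda>y. g y \<bullet> b) (at y) v = frechet_derivative g (at y) v \<bullet> b"
    if "y \<in> S" "smooth_on S g" for g :: "'a \<Rightarrow> 'b" and y v
    using frechet_derivative_at[OF has_derivative_inner_left[OF smooth_on_has_derivative[OF that(2,1)]]]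
    by metis
  have "frechet_derivative (\<lambda>y. frechet_derivative f (at y) u) (at x) w \<bullet> b
      = frechet_derivative (\<lambda>y. frechet_derivative (\<lambda>y. f y \<bullet> b) (at y) u) (at x) w" for u w
  proof -
    have "((\<lambda>y. frechet_derivative f (at y) u \<bullet> b) has_derivative
        (\<lambda>w. frechet_derivative (\<lambda>y. frechet_derivative f (at y) u) (at x) w \<bullet> b)) (at x)"
      by (intro has_derivative_inner_left smooth_on_has_derivative[OF _ assms(2)] smooth_on_derivative assms(3))
    then have "((\<lambda>y. frechet_derivative (\<lambda>y. f y \<bullet> b) (at y) u) has_derivative
        (\<lambda>w. frechet_derivative (\<lambda>y. frechet_derivative f (at y) u) (at x) w \<bullet> b)) (at x)"
      by (rule has_derivative_transform_within_open[OF _ assms(1,2)]) (simp add: inner assms(3))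
    from frechet_derivative_at[OF this] show ?thesis by metis
  qed
  then show "frechet_derivative (\<lambda>y. frechet_derivative f (at y) u) (at x) w \<bullet> b
      = frechet_derivative (\<lambda>y. frechet_derivative f (at y) w) (at x) u \<bullet> b"
    using symmetric_second_derivative_real[OF assms(1,2) smooth_on_inner_const[OF assms(1,3)]] by simp
qed


section \<open>Charts and tangent vectors\<close>

lemma frechet_derivative_eqI: "(f has_derivative f') (at x) \<Longrightarrow> frechet_derivative f (at x) = f'"
  by (rule frechet_derivative_at[symmetric])

locale smooth_mfd =
  fixes N :: "('n::{t2_space,second_countable_topology}, 'f::euclidean_space) manifold"
  assumes smooth_N: "smooth_manifold N"
begin

lemma open_points: "open (points N)"
  using smooth_N by (simp add: smooth_manifold_def)

lemma chart_at_atlas: "x \<in> points N \<Longrightarrow> chart_at N x \<in> atlas N"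
  and chart_at_mem: "x \<in> points N \<Longrightarrow> x \<in> fst (chart_at N x)"
  using smooth_N by (auto simp: smooth_manifold_def)

context
  fixes c assumes c: "c \<in> atlas N"
begin

lemma chart_open: "open (fst c)"
  and chart_points: "fst c \<subseteq> points N"
  and chart_homeo: "homeomorphism (fst c) (snd c ` fst c) (snd c) (chart_inv c)"
  and chart_image_open: "open (snd c ` fst c)"
  using smooth_N c by (auto simp: smooth_manifold_def)

lemma chart_inv_chart [simp]: "x \<in> fst c \<Longrightarrow> chart_inv c (snd c x) = x"
  using chart_homeo by (simp add: homeomorphism_def)

lemma chart_inv_mem: "q \<in> snd c ` fst c \<Longrightarrow> chart_inv c q \<in> fst c"
  by (rule inv_into_into)

lemma chart_chart_inv: "q \<in> snd c ` fst c \<Longrightarrow> snd c (chart_inv c q) = q"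
  by (rule f_inv_into_f)

lemma chart_image_open_subset: "open U \<Longrightarrow> U \<subseteq> fst c \<Longrightarrow> open (snd c ` U)"
proof -
  assume U: "open U" "U \<subseteq> fst c"
  have "openin (top_of_set (snd c ` fst c)) (snd c ` U)"
    using homeomorphism_imp_open_map[OF chart_homeo] U by (simp add: open_openin_trans chart_open)
  then show "open (snd c ` U)" using chart_image_open openin_open_eq by blast
qed

end

lemma transition_smooth:
  "c \<in> atlas N \<Longrightarrow> c' \<in> atlas N \<Longrightarrow> smooth_on (snd c ` (fst c \<inter> fst c')) (\<lambda>q. snd c' (chart_inv c q))"
  using smooth_N by (auto simp: smooth_manifold_def o_def)

lemma overlap_image_open:
  "c \<in> atlas N \<Longrightarrow> c' \<in> atlas N \<Longrightarrow> open (snd c ` (fst c \<inter> fst c'))"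
  by (intro chart_image_open_subset open_Int chart_open) auto

definition trans where
  "trans c c' x = frechet_derivative (\<lambda>q. snd c' (chart_inv c q)) (at (snd c x))"

lemma trans_has_derivative:
  assumes "c \<in> atlas N" "c' \<in> atlas N" "x \<in> fst c" "x \<in> fst c'"
  shows "((\<lambda>q. snd c' (chart_inv c q)) has_derivative trans c c' x) (at (snd c x))"
  unfolding trans_def using assms
  by (intro smooth_on_has_derivative[OF transition_smooth]) auto

text \<open>Chain rule through the transition map. With a coordinate map as \<open>f\<close> it
  becomes the cocycle rule for Jacobians; with the preferred chart as \<open>c'\<close> it makes
  \<open>differential\<close> computable in any chart.\<close>

lemma change_of_chart_derivative:
  assumes c: "c \<in> atlas N" "c' \<in> atlas N" "x \<in> fst c" "x \<in> fst c'"
    and f: "((\<lambda>q. f (chart_inv c q)) has_derivative F) (at (snd c x))"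
  shows "((\<lambda>q. f (chart_inv c' q)) has_derivative (\<lambda>v. F (trans c' c x v))) (at (snd c' x))"
proof -
  have "((\<lambda>q. f (chart_inv c (snd c (chart_inv c' q)))) has_derivative (\<lambda>v. F (trans c' c x v))) (at (snd c' x))"
    by (rule has_derivative_compose[where g = "\<lambda>q. f (chart_inv c q)"])
      (use c f trans_has_derivative[of c' c x] in auto)
  then show ?thesis
    by (rule has_derivative_transform_within_open[OF _ overlap_image_open[OF c(2,1)]])
      (use c in auto)
qed

lemma trans_compose:
  assumes "c \<in> atlas N" "c' \<in> atlas N" "c'' \<in> atlas N" "x \<in> fst c" "x \<in> fst c'" "x \<in> fst c''"
  shows "trans c' c'' x (trans c c' x v) = trans c c'' x v"
  using fun_cong[OF has_derivative_unique[OF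
      change_of_chart_derivative[OF assms(2,1,5,4) trans_has_derivative[OF assms(2,3,5,6)]]
      trans_has_derivative[OF assms(1,3,4,6)]]] .

lemma trans_self:
  assumes "c \<in> atlas N" "x \<in> fst c"
  shows "trans c c x = (\<lambda>v. v)"
proof -
  have "((\<lambda>q. snd c (chart_inv c q)) has_derivative (\<lambda>v. v)) (at (snd c x))"
    by (rule has_derivative_transform_within_open[OF has_derivative_ident chart_image_open[OF assms(1)]])
      (use assms chart_chart_inv in auto)
  then show ?thesis using has_derivative_unique trans_has_derivative[OF assms(1,1,2,2)] by blast
qed

abbreviation comp where "comp \<equiv> chart_components N"

lemma comp_eq_trans: "comp c x = trans (chart_at N x) c x"
  by (simp add: chart_components_def trans_def o_def)

lemma comp_chart_at [simp]: "x \<in> points N \<Longrightarrow> comp (chart_at N x) x v = v"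
  by (simp add: comp_eq_trans trans_self chart_at_atlas chart_at_mem)

lemma linear_trans:
  assumes "c \<in> atlas N" "c' \<in> atlas N" "x \<in> fst c" "x \<in> fst c'"
  shows "linear (trans c c' x)"
  using trans_has_derivative[OF assms] by (rule has_derivative_linear)

context
  fixes c x assumes c: "c \<in> atlas N" and x: "x \<in> fst c"
begin

lemma chart_mem_points: "x \<in> points N"
  using chart_points[OF c] x by blast

lemma chart_at_atlas': "chart_at N x \<in> atlas N" and chart_at_mem': "x \<in> fst (chart_at N x)"
  using chart_at_atlas chart_at_mem chart_mem_points by auto

lemma linear_comp: "linear (comp c x)"
  unfolding comp_eq_trans by (intro linear_trans chart_at_atlas' chart_at_mem' c x)

lemma comp_trans_inverse [simp]:
  "comp c x (trans c (chart_at N x) x v) = v"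
  "trans c (chart_at N x) x (comp c x v) = v"
  by (simp_all add: comp_eq_trans trans_compose trans_self c x chart_at_atlas' chart_at_mem')

lemma bij_comp: "bij (comp c x)"
  using comp_trans_inverse by (metis bijI')

lemma inv_comp: "inv (comp c x) = trans c (chart_at N x) x"
  by (rule inv_unique_comp) (auto simp: fun_eq_iff)

lemma comp_inv [simp]: "comp c x (inv (comp c x) v) = v"
  and inv_comp_comp [simp]: "inv (comp c x) (comp c x v) = v"
  by (simp_all add: inv_comp)

lemma linear_inv_comp: "linear (inv (comp c x))"
  unfolding inv_comp by (intro linear_trans chart_at_atlas' chart_at_mem' c x)

lemma trans_comp: "c' \<in> atlas N \<Longrightarrow> x \<in> fst c' \<Longrightarrow> trans c c' x (comp c x v) = comp c' x v"
  unfolding comp_eq_trans by (simp add: trans_compose c x chart_at_atlas' chart_at_mem')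

lemma comp_inv_trans: "c' \<in> atlas N \<Longrightarrow> x \<in> fst c' \<Longrightarrow> comp c' x (inv (comp c x) v) = trans c c' x v"
  using trans_comp[of c' "inv (comp c x) v"] by simp

lemma differential_chart:
  assumes "((\<lambda>q. f (chart_inv c q)) has_derivative F) (at (snd c x))"
  shows "differential N f x V = F (comp c x V)"
  using frechet_derivative_eqI[OF change_of_chart_derivative[OF c chart_at_atlas' x chart_at_mem' assms]]
  by (simp add: differential_def o_def comp_eq_trans)

end

lemma smooth_map_on_subset: "smooth_map_on N U f \<Longrightarrow> W \<subseteq> U \<Longrightarrow> smooth_map_on N W f"
  unfolding smooth_map_on_def by (meson Int_mono image_mono order_refl smooth_on_subset)

lemma smooth_map_on_cong:
  assumes "open U" "\<And>x. x \<in> U \<Longrightarrow> f x = h x" "smooth_map_on N U f"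
  shows "smooth_map_on N U h"
  unfolding smooth_map_on_def
proof
  fix c assume c: "c \<in> atlas N"
  show "smooth_on (snd c ` (U \<inter> fst c)) (h \<circ> chart_inv c)"
  proof (rule smooth_on_cong)
    show "open (snd c ` (U \<inter> fst c))"
      using c assms(1) by (intro chart_image_open_subset open_Int chart_open) auto
    show "smooth_on (snd c ` (U \<inter> fst c)) (f \<circ> chart_inv c)"
      using assms(3) c by (simp add: smooth_map_on_def)
  qed (use c assms(2) in auto)
qed

text \<open>\<open>smooth_map_on\<close> tests all charts of the atlas. Inside one chart domain that
  chart decides, because every other coordinate expression arises from its own by a smooth
  transition map.\<close>

lemma smooth_map_on_chart:
  assumes c: "c \<in> atlas N" and U: "open U" "U \<subseteq> fst c"
  shows "smooth_map_on N U f \<longleftrightarrow> smooth_on (snd c ` U) (\<lambda>q. f (chart_inv c q))"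
proof
  assume "smooth_map_on N U f"
  then have "smooth_on (snd c ` (U \<inter> fst c)) (f \<circ> chart_inv c)"
    using c unfolding smooth_map_on_def by (rule bspec)
  then show "smooth_on (snd c ` U) (\<lambda>q. f (chart_inv c q))"
    using U(2) by (simp add: o_def Int_absorb2)
next
  assume f: "smooth_on (snd c ` U) (\<lambda>q. f (chart_inv c q))"
  show "smooth_map_on N U f"
    unfolding smooth_map_on_def
  proof
    fix c' assume c': "c' \<in> atlas N"
    have op: "open (snd c' ` (U \<inter> fst c'))"
      using c' U by (intro chart_image_open_subset open_Int chart_open) auto
    have "smooth_on (snd c' ` (U \<inter> fst c')) (\<lambda>q. f (chart_inv c (snd c (chart_inv c' q))))"
    proof (rule smooth_on_compose[OF op _ _ f])
      show "open (snd c ` U)" by (rule chart_image_open_subset[OF c U])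
      show "smooth_on (snd c' ` (U \<inter> fst c')) (\<lambda>q. snd c (chart_inv c' q))"
        by (rule smooth_on_subset[OF transition_smooth[OF c' c]]) (use U in auto)
    qed (use c c' U in auto)
    then show "smooth_on (snd c' ` (U \<inter> fst c')) (f \<circ> chart_inv c')"
      by (rule smooth_on_cong[OF op, rotated]) (use c c' U in auto)
  qed
qed

lemma smooth_map_on_local:
  assumes "\<And>x. x \<in> U \<Longrightarrow> \<exists>W. open W \<and> x \<in> W \<and> W \<subseteq> points N \<and> smooth_map_on N W f"
  shows "smooth_map_on N U f"
proof -
  define \<U> where "\<U> = {W. open W \<and> W \<subseteq> points N \<and> smooth_map_on N W f}"
  have "smooth_map_on N (\<Union>\<U>) f"
    unfolding smooth_map_on_def
  proof
    fix c assume c: "c \<in> atlas N"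
    have "snd c ` (\<Union>\<U> \<inter> fst c) = \<Union>((\<lambda>W. snd c ` (W \<inter> fst c)) ` \<U>)" by auto
    moreover have "smooth_on (\<Union>((\<lambda>W. snd c ` (W \<inter> fst c)) ` \<U>)) (f \<circ> chart_inv c)"
    proof (rule smooth_on_Union; elim imageE; hypsubst)
      fix W assume W: "W \<in> \<U>"
      then show "open (snd c ` (W \<inter> fst c))"
        using c by (intro chart_image_open_subset open_Int chart_open) (auto simp: \<U>_def)
      show "smooth_on (snd c ` (W \<inter> fst c)) (f \<circ> chart_inv c)"
        using W c by (simp add: \<U>_def smooth_map_on_def)
    qed
    ultimately show "smooth_on (snd c ` (\<Union>\<U> \<inter> fst c)) (f \<circ> chart_inv c)" by simp
  qed
  then show ?thesis by (rule smooth_map_on_subset) (use assms \<U>_def in blast)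
qed

lemma smooth_map_onI:
  assumes "open U" "\<And>c. c \<in> atlas N \<Longrightarrow> open (snd c ` (U \<inter> fst c)) \<Longrightarrow> smooth_on (snd c ` (U \<inter> fst c)) (\<lambda>q. f (chart_inv c q))"
  shows "smooth_map_on N U f"
  unfolding smooth_map_on_def o_def
proof
  fix c assume c: "c \<in> atlas N"
  then have "open (snd c ` (U \<inter> fst c))"
    using assms(1) by (intro chart_image_open_subset open_Int chart_open) auto
  with assms(2) c show "smooth_on (snd c ` (U \<inter> fst c)) (\<lambda>q. f (chart_inv c q))" .
qed

lemma smooth_map_onD:
  "smooth_map_on N U f \<Longrightarrow> c \<in> atlas N \<Longrightarrow> smooth_on (snd c ` (U \<inter> fst c)) (\<lambda>q. f (chart_inv c q))"
  unfolding smooth_map_on_def o_def by (rule bspec)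

lemma smooth_map_on_const: "smooth_map_on N U (\<lambda>x. k)"
  by (simp add: smooth_map_on_def o_def smooth_on_const)

lemma smooth_map_on_add:
  "open U \<Longrightarrow> smooth_map_on N U f \<Longrightarrow> smooth_map_on N U h \<Longrightarrow> smooth_map_on N U (\<lambda>x. f x + h x)"
  by (rule smooth_map_onI, assumption, rule smooth_on_add, assumption; rule smooth_map_onD; assumption)

lemma smooth_map_on_sum:
  assumes "open U" "\<And>i. i \<in> I \<Longrightarrow> smooth_map_on N U (f i)"
  shows "smooth_map_on N U (\<lambda>x. \<Sum>i\<in>I. f i x)"
  by (rule smooth_map_onI[OF assms(1)], rule smooth_on_sum, assumption, rule smooth_map_onD[OF assms(2)])

lemma smooth_map_on_bilinear:
  "open U \<Longrightarrow> bounded_bilinear B \<Longrightarrow> smooth_map_on N U f \<Longrightarrow> smooth_map_on N U h \<Longrightarrow>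
    smooth_map_on N U (\<lambda>x. B (f x) (h x))"
  by (rule smooth_map_onI, assumption, rule smooth_on_bilinear[of _ B], assumption, assumption; rule smooth_map_onD; assumption)

lemmas smooth_map_on_mult = smooth_map_on_bilinear[OF _ bounded_bilinear_mult]
  and smooth_map_on_scaleR = smooth_map_on_bilinear[OF _ bounded_bilinear_scaleR]

lemma smooth_map_on_compose:
  fixes f :: "'n \<Rightarrow> 'b::euclidean_space"
  assumes "open U" "open T" "smooth_map_on N U f" "smooth_on T h" "f ` U \<subseteq> T"
  shows "smooth_map_on N U (\<lambda>x. h (f x))"
proof (rule smooth_map_onI[OF assms(1)])
  fix c assume c: "c \<in> atlas N" and op: "open (snd c ` (U \<inter> fst c))"
  show "smooth_on (snd c ` (U \<inter> fst c)) (\<lambda>q. h (f (chart_inv c q)))"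
  proof (rule smooth_on_compose[OF op assms(2) smooth_map_onD[OF assms(3) c] assms(4)])
    show "(\<lambda>q. f (chart_inv c q)) ` snd c ` (U \<inter> fst c) \<subseteq> T"
      using chart_inv_chart[OF c] assms(5) by auto
  qed
qed

lemma smooth_map_on_linear:
  fixes f :: "'n \<Rightarrow> 'b::euclidean_space"
  assumes "open U" "smooth_map_on N U f" "linear L"
  shows "smooth_map_on N U (\<lambda>x. L (f x))"
  using smooth_map_on_compose[OF assms(1) open_UNIV assms(2) smooth_on_bounded_linear] assms(3)
  by (simp add: linear_conv_bounded_linear)

lemma smooth_map_on_inner_const:
  fixes f :: "'n \<Rightarrow> 'b::euclidean_space"
  shows "open U \<Longrightarrow> smooth_map_on N U f \<Longrightarrow> smooth_map_on N U (\<lambda>x. f x \<bullet> b)"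
  by (rule smooth_map_on_linear[where L = "\<lambda>v. v \<bullet> b"]) (auto intro!: linearI simp: inner_add_left)

lemma smooth_map_on_Pair:
  fixes f :: "'n \<Rightarrow> 'b::euclidean_space" and h :: "'n \<Rightarrow> 'c::euclidean_space"
  shows "open U \<Longrightarrow> smooth_map_on N U f \<Longrightarrow> smooth_map_on N U h \<Longrightarrow> smooth_map_on N U (\<lambda>x. (f x, h x))"
  by (rule smooth_map_onI, assumption, rule smooth_on_Pair, assumption; rule smooth_map_onD; assumption)

lemma smooth_map_on_has_derivative:
  assumes "smooth_map_on N U f" "open U" "x \<in> U" "c \<in> atlas N" "x \<in> fst c"
  shows "((\<lambda>q. f (chart_inv c q)) has_derivative frechet_derivative (\<lambda>q. f (chart_inv c q)) (at (snd c x))) (at (snd c x))"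
  by (rule smooth_on_has_derivative[OF smooth_map_onD[OF assms(1,4)]]) (use assms(3,5) in blast)

lemma differential_smooth:
  assumes "smooth_map_on N U f" "open U" "x \<in> U" "c \<in> atlas N" "x \<in> fst c"
  shows "differential N f x V = frechet_derivative (\<lambda>q. f (chart_inv c q)) (at (snd c x)) (comp c x V)"
  by (rule differential_chart[OF assms(4,5) smooth_map_on_has_derivative[OF assms]])

lemma differential_has_derivative:
  assumes "smooth_map_on N U f" "open U" "x \<in> U" "x \<in> points N"
  shows "((\<lambda>q. f (chart_inv (chart_at N x) q)) has_derivative differential N f x) (at (snd (chart_at N x) x))"
  using smooth_map_on_has_derivative[OF assms(1-3) chart_at_atlas chart_at_mem] assms(4)
  by (simp add: differential_def o_def)

lemma differential_cong:
  assumes "open U" "x \<in> U" "x \<in> points N" "\<And>y. y \<in> U \<Longrightarrow> f y = h y"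
  shows "differential N f x = differential N h x"
proof -
  let ?c = "chart_at N x"
  have c: "?c \<in> atlas N" "x \<in> fst ?c" using assms(3) chart_at_atlas chart_at_mem by auto
  have op: "open (snd ?c ` (U \<inter> fst ?c))"
    using c assms(1) by (intro chart_image_open_subset open_Int chart_open) auto
  have mem: "snd ?c x \<in> snd ?c ` (U \<inter> fst ?c)" using assms(2) c(2) by blast
  have eq: "f (chart_inv ?c q) = h (chart_inv ?c q)" if "q \<in> snd ?c ` (U \<inter> fst ?c)" for q
    using that c assms(4) by auto
  \<comment> \<open>\<open>frechet_derivative\<close> is a choice among derivatives. Both functions
    satisfy the same predicate for every \<open>F\<close>, so the choices coincide, whether or not a
    derivative exists.\<close>
  have "((f \<circ> chart_inv ?c) has_derivative F) (at (snd ?c x)) \<longleftrightarrow>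
      ((h \<circ> chart_inv ?c) has_derivative F) (at (snd ?c x))" for F
    using has_derivative_transform_within_open[OF _ op mem, of "f \<circ> chart_inv ?c" F UNIV "h \<circ> chart_inv ?c"]
      has_derivative_transform_within_open[OF _ op mem, of "h \<circ> chart_inv ?c" F UNIV "f \<circ> chart_inv ?c"]
      eq by (auto simp: o_def)
  then show ?thesis by (simp add: differential_def frechet_derivative_def)
qed

end


section \<open>Vector bundles and linear connections\<close>

context smooth_mfd
begin

lemma differential_inner:
  assumes "smooth_map_on N U f" "open U" "x \<in> U" "x \<in> points N"
  shows "differential N (\<lambda>y. f y \<bullet> b) x V = differential N f x V \<bullet> b"
  using has_derivative_inner_left[OF differential_has_derivative[OF assms], of b]
  by (simp add: differential_def[of N "\<lambda>y. f y \<bullet> b"] o_def frechet_derivative_eqI)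

lemma differential_const: "differential N (\<lambda>y. k) x = (\<lambda>V. 0)"
  by (simp add: differential_def o_def)

lemma vector_bundle_tangent: "vector_bundle N (tangent_bundle N)"
proof -
  have "smooth_map_on N (fst c \<inter> fst c') (\<lambda>x. comp c' x (inv (comp c x) v))"
    if c: "c \<in> atlas N" "c' \<in> atlas N" for c c' v
  proof -
    have op: "open (fst c \<inter> fst c')" using c chart_open by blast
    have "smooth_on (snd c ` (fst c \<inter> fst c')) (\<lambda>q. comp c' (chart_inv c q) (inv (comp c (chart_inv c q)) v))"
      by (rule smooth_on_cong[OF overlap_image_open[OF c] _ smooth_on_derivative[OF transition_smooth[OF c]]])
        (use c in \<open>auto simp: comp_inv_trans trans_def\<close>)
    then show ?thesis using c op by (subst smooth_map_on_chart[of c]) auto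
  qed
  then show ?thesis
    unfolding vector_bundle_def tangent_bundle_def
    using chart_open chart_points linear_comp bij_comp chart_at_atlas chart_at_mem by fastforce
qed

end

locale vbundle = smooth_mfd N
  for N :: "('n::{t2_space,second_countable_topology}, 'f::euclidean_space) manifold" +
  fixes E :: "('n, 'v::euclidean_space) vec_bundle"
  assumes vector_bundle: "vector_bundle N E"
begin

context
  fixes U \<tau> assumes triv: "(U, \<tau>) \<in> E"
begin

lemma triv_open: "open U" and triv_points: "U \<subseteq> points N"
  using vector_bundle triv unfolding vector_bundle_def by auto

lemma triv_linear: "x \<in> U \<Longrightarrow> linear (\<tau> x)" and triv_bij: "x \<in> U \<Longrightarrow> bij (\<tau> x)"
  using vector_bundle triv unfolding vector_bundle_def by auto

lemma triv_inv: "x \<in> U \<Longrightarrow> \<tau> x (inv (\<tau> x) v) = v" "x \<in> U \<Longrightarrow> inv (\<tau> x) (\<tau> x v) = v"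
  using triv_bij by (simp_all add: bij_is_surj surj_f_inv_f bij_is_inj)

lemma triv_inv_linear:
  assumes "x \<in> U"
  shows "linear (inv (\<tau> x))"
proof (rule linearI)
  note inj = injD[OF bij_is_inj[OF triv_bij[OF assms]]]
  show "inv (\<tau> x) (a + b) = inv (\<tau> x) a + inv (\<tau> x) b" for a b
    by (rule inj) (simp only: linear_add[OF triv_linear[OF assms]] triv_inv(1)[OF assms])
  show "inv (\<tau> x) (r *\<^sub>R a) = r *\<^sub>R inv (\<tau> x) a" for r a
    by (rule inj) (simp only: linear_scale[OF triv_linear[OF assms]] triv_inv(1)[OF assms])
qed

lemma triv_change: "(W, \<sigma>) \<in> E \<Longrightarrow> smooth_map_on N (U \<inter> W) (\<lambda>x. \<sigma> x (inv (\<tau> x) v))"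
  using vector_bundle triv unfolding vector_bundle_def by blast

lemma triv_expand:
  assumes "x \<in> U"
  shows "s = (\<Sum>b\<in>Basis. (\<tau> x s \<bullet> b) *\<^sub>R inv (\<tau> x) b)"
  using linear_expand[OF triv_inv_linear[OF assms], of "\<tau> x s"] assms by (simp add: triv_inv)

text \<open>One trivialization decides: the components in any other are finite sums of the given
  components times the transition functions applied to basis vectors.\<close>

lemma section_triv:
  assumes "open W" "W \<subseteq> U"
  shows "smooth_section_on N E W s \<longleftrightarrow> smooth_map_on N W (\<lambda>x. \<tau> x (s x))"
proof
  assume "smooth_section_on N E W s"
  then have "smooth_map_on N (W \<inter> U) (\<lambda>x. \<tau> x (s x))"
    using triv unfolding smooth_section_on_def by blast
  then show "smooth_map_on N W (\<lambda>x. \<tau> x (s x))" using assms by (simp add: Int_absorb2)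
next
  assume s: "smooth_map_on N W (\<lambda>x. \<tau> x (s x))"
  have "smooth_map_on N (W \<inter> W') (\<lambda>x. \<sigma> x (s x))" if "(W', \<sigma>) \<in> E" for W' \<sigma>
  proof (rule smooth_map_on_cong)
    have "open W'" and lin: "\<And>x. x \<in> W' \<Longrightarrow> linear (\<sigma> x)"
      using vector_bundle that unfolding vector_bundle_def by auto
    then show op: "open (W \<inter> W')" using assms by auto
    show "smooth_map_on N (W \<inter> W') (\<lambda>x. \<Sum>b\<in>Basis. (\<tau> x (s x) \<bullet> b) *\<^sub>R \<sigma> x (inv (\<tau> x) b))"
      by (intro smooth_map_on_sum[OF op] smooth_map_on_scaleR[OF op] smooth_map_on_inner_const[OF op]
          smooth_map_on_subset[OF s] smooth_map_on_subset[OF triv_change[OF that]])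
        (use assms in auto)
    show "(\<Sum>b\<in>Basis. (\<tau> x (s x) \<bullet> b) *\<^sub>R \<sigma> x (inv (\<tau> x) b)) = \<sigma> x (s x)" if "x \<in> W \<inter> W'" for x
      using arg_cong[OF triv_expand[of x "s x"], of "\<sigma> x"] that assms
      by (auto simp: linear_sum[OF lin] linear_scale[OF lin])
  qed
  then show "smooth_section_on N E W s" unfolding smooth_section_on_def by blast
qed

lemma section_const: "smooth_section_on N E U (\<lambda>x. inv (\<tau> x) v)"
  using smooth_map_on_cong[OF triv_open triv_inv(1)[symmetric] smooth_map_on_const]
  by (subst section_triv) (auto simp: triv_open)

end

lemma section_subset: "smooth_section_on N E U s \<Longrightarrow> W \<subseteq> U \<Longrightarrow> smooth_section_on N E W s"
  unfolding smooth_section_on_def by (auto 0 3 elim!: ballE smooth_map_on_subset[OF _ Int_mono[OF _ order_refl]])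

lemma section_cong:
  assumes "open U" "\<And>x. x \<in> U \<Longrightarrow> s x = s' x" "smooth_section_on N E U s"
  shows "smooth_section_on N E U s'"
  unfolding smooth_section_on_def
proof clarify
  fix W \<tau> assume W: "(W, \<tau>) \<in> E"
  then have "smooth_map_on N (U \<inter> W) (\<lambda>x. \<tau> x (s x))"
    using assms(3) unfolding smooth_section_on_def by blast
  then show "smooth_map_on N (U \<inter> W) (\<lambda>x. \<tau> x (s' x))"
    by (rule smooth_map_on_cong[rotated 2]) (use assms triv_open[OF W] in auto)
qed

lemma section_add:
  assumes "open U" "smooth_section_on N E U s" "smooth_section_on N E U s'"
  shows "smooth_section_on N E U (\<lambda>x. s x + s' x)"
  unfolding smooth_section_on_def
proof clarify
  fix W \<tau> assume W: "(W, \<tau>) \<in> E"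
  have op: "open (U \<inter> W)" using assms triv_open[OF W] by auto
  have "smooth_map_on N (U \<inter> W) (\<lambda>x. \<tau> x (s x) + \<tau> x (s' x))"
    by (rule smooth_map_on_add[OF op]) (use assms(2,3) W in \<open>auto simp: smooth_section_on_def\<close>)
  then show "smooth_map_on N (U \<inter> W) (\<lambda>x. \<tau> x (s x + s' x))"
    by (rule smooth_map_on_cong[OF op, rotated]) (simp add: linear_add[OF triv_linear[OF W]])
qed

lemma section_scale:
  assumes "open U" "smooth_section_on N E U s" "smooth_map_on N U f"
  shows "smooth_section_on N E U (\<lambda>x. f x *\<^sub>R s x)"
  unfolding smooth_section_on_def
proof clarify
  fix W \<tau> assume W: "(W, \<tau>) \<in> E"
  have op: "open (U \<inter> W)" using assms triv_open[OF W] by auto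
  have "smooth_map_on N (U \<inter> W) (\<lambda>x. f x *\<^sub>R \<tau> x (s x))"
    by (rule smooth_map_on_scaleR[OF op smooth_map_on_subset[OF assms(3)]])
      (use assms(2) W in \<open>auto simp: smooth_section_on_def\<close>)
  then show "smooth_map_on N (U \<inter> W) (\<lambda>x. \<tau> x (f x *\<^sub>R s x))"
    by (rule smooth_map_on_cong[OF op, rotated]) (simp add: linear_scale[OF triv_linear[OF W]])
qed

lemma section_zero: "open U \<Longrightarrow> smooth_section_on N E U (\<lambda>x. 0)"
  unfolding smooth_section_on_def
proof clarify
  fix W \<tau> assume "open U" and W: "(W, \<tau>) \<in> E"
  then have op: "open (U \<inter> W)" using triv_open[OF W] by auto
  show "smooth_map_on N (U \<inter> W) (\<lambda>x. \<tau> x 0)"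
    by (rule smooth_map_on_cong[OF op _ smooth_map_on_const[of _ 0]]) (simp add: linear_0[OF triv_linear[OF W]])
qed

lemma section_sum:
  assumes "open U" "\<And>i. i \<in> I \<Longrightarrow> smooth_section_on N E U (s i)"
  shows "smooth_section_on N E U (\<lambda>x. \<Sum>i\<in>I. s i x)"
  using assms(2) by (induction I rule: infinite_finite_induct) (auto intro: section_zero section_add assms(1))

lemma section_local:
  assumes "\<And>x. x \<in> U \<Longrightarrow> \<exists>W. open W \<and> x \<in> W \<and> W \<subseteq> points N \<and> smooth_section_on N E W s"
  shows "smooth_section_on N E U s"
  unfolding smooth_section_on_def
proof clarify
  fix W \<tau> assume W: "(W, \<tau>) \<in> E"
  show "smooth_map_on N (U \<inter> W) (\<lambda>x. \<tau> x (s x))"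
  proof (rule smooth_map_on_local)
    fix x assume x: "x \<in> U \<inter> W"
    then obtain W' where W': "open W'" "x \<in> W'" "W' \<subseteq> points N" "smooth_section_on N E W' s"
      using assms by blast
    then have "smooth_map_on N (W' \<inter> W) (\<lambda>x. \<tau> x (s x))"
      using W unfolding smooth_section_on_def by blast
    then show "\<exists>W'. open W' \<and> x \<in> W' \<and> W' \<subseteq> points N \<and> smooth_map_on N W' (\<lambda>x. \<tau> x (s x))"
      using W' x triv_open[OF W] by (intro exI[of _ "W' \<inter> W"]) auto
  qed
qed

lemma triv_exists: "x \<in> points N \<Longrightarrow> \<exists>U \<tau>. (U, \<tau>) \<in> E \<and> x \<in> U"
proof -
  assume "x \<in> points N"
  moreover have "points N \<subseteq> (\<Union>(U, \<tau>)\<in>E. U)"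
    using vector_bundle by (simp add: vector_bundle_def)
  ultimately obtain p where "p \<in> E" "x \<in> fst p" by (auto simp: case_prod_beta)
  then show ?thesis by (metis prod.collapse)
qed

text \<open>The \<open>SOME\<close> inside \<open>extend_at\<close> depends on the bundle and the
  point only, so a single trivialization serves all fibre elements at once.\<close>

lemma extend_at_triv:
  assumes "x \<in> points N"
  obtains U \<tau> where "(U, \<tau>) \<in> E" "x \<in> U" "\<And>e. extend_at E x e = (\<lambda>y. inv (\<tau> y) (\<tau> x e))"
proof -
  define p where "p = (SOME (U, \<tau>). (U, \<tau>) \<in> E \<and> x \<in> U)"
  obtain U \<tau> where p: "p = (U, \<tau>)" by (cases p)
  have "\<exists>p. case p of (U, \<tau>) \<Rightarrow> (U, \<tau>) \<in> E \<and> x \<in> U"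
    using triv_exists[OF assms] by blast
  then have "case p of (U, \<tau>) \<Rightarrow> (U, \<tau>) \<in> E \<and> x \<in> U"
    unfolding p_def by (rule someI_ex)
  moreover have "extend_at E x e = (let (U, \<tau>) = p in (\<lambda>y. inv (\<tau> y) (\<tau> x e)))" for e
    by (simp add: extend_at_def p_def)
  ultimately show ?thesis by (intro that[of U \<tau>]) (simp_all only: p Let_def case_prod_conv)
qed

end

locale lconnection = vbundle N E
  for N :: "('n::{t2_space,second_countable_topology}, 'f::euclidean_space) manifold"
    and E :: "('n, 'v::euclidean_space) vec_bundle" +
  fixes D :: "('n, 'f, 'v) connection"
  assumes connection: "linear_connection N E D"
begin

context
  fixes U s
  assumes U: "open U" "U \<subseteq> points N" and s: "smooth_section_on N E U s"
begin

lemmas connection_at = connection[unfolded linear_connection_def, THEN spec, THEN spec, THEN mp, OF conjI[OF U(1) conjI[OF U(2) s]]]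

lemma D_linear: "x \<in> U \<Longrightarrow> linear (\<lambda>V. D x V s)"
  by (rule connection_at[THEN conjunct1, THEN bspec])

lemma D_smooth: "smooth_section_on N (tangent_bundle N) U X \<Longrightarrow> smooth_section_on N E U (\<lambda>x. D x (X x) s)"
  by (rule connection_at[THEN conjunct2, THEN conjunct1, THEN spec, THEN mp])

lemma D_add: "smooth_section_on N E U s' \<Longrightarrow> x \<in> U \<Longrightarrow> D x V (\<lambda>y. s y + s' y) = D x V s + D x V s'"
  by (rule connection_at[THEN conjunct2, THEN conjunct2, THEN conjunct1, THEN spec, THEN mp, THEN bspec, THEN spec])

lemma D_scale:
  "smooth_map_on N U f \<Longrightarrow> x \<in> U \<Longrightarrow> D x V (\<lambda>y. f y *\<^sub>R s y) = differential N f x V *\<^sub>R s x + f x *\<^sub>R D x V s"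
  for f :: "'n \<Rightarrow> real"
  by (rule connection_at[THEN conjunct2, THEN conjunct2, THEN conjunct2, THEN spec, THEN mp, THEN bspec, THEN spec])

lemma D_scale_const: "x \<in> U \<Longrightarrow> D x V (\<lambda>y. k *\<^sub>R s y) = k *\<^sub>R D x V s"
  by (subst D_scale[OF smooth_map_on_const]) (simp_all add: differential_const)

end

text \<open>Multiplied by the indicator function \<open>f\<close> of \<open>U\<close>, the two
  sections become the same function everywhere. On \<open>U\<close> the indicator is constantly 1,
  so it is smooth there with zero differential, and the Leibniz rule removes it again.\<close>

lemma D_local:
  assumes U: "open U" "U \<subseteq> points N" and s: "smooth_section_on N E U s"
    and eq: "\<And>y. y \<in> U \<Longrightarrow> s y = s' y" and x: "x \<in> U"
  shows "D x V s = D x V s'"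
proof -
  define f :: "'n \<Rightarrow> real" where "f y = (if y \<in> U then 1 else 0)" for y
  have f: "smooth_map_on N U f"
    by (rule smooth_map_on_cong[OF U(1) _ smooth_map_on_const[of _ 1]]) (simp add: f_def)
  have df: "differential N f x = (\<lambda>V. 0)"
    using differential_cong[OF U(1) x, of f "\<lambda>_. 1"] x U(2) by (auto simp: f_def differential_const)
  have s': "smooth_section_on N E U s'" by (rule section_cong[OF U(1) eq s])
  have "D x V (\<lambda>y. f y *\<^sub>R s y) = D x V s"
    by (subst D_scale[OF U s f x]) (simp add: df f_def x)
  moreover have "D x V (\<lambda>y. f y *\<^sub>R s' y) = D x V s'"
    by (subst D_scale[OF U s' f x]) (simp add: df f_def x)
  moreover have "(\<lambda>y. f y *\<^sub>R s y) = (\<lambda>y. f y *\<^sub>R s' y)"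
    using eq by (auto simp: f_def fun_eq_iff)
  ultimately show ?thesis by simp
qed

lemma D_sum:
  assumes U: "open U" "U \<subseteq> points N" and s: "\<And>i. i \<in> I \<Longrightarrow> smooth_section_on N E U (s i)"
    and x: "x \<in> U"
  shows "D x V (\<lambda>y. \<Sum>i\<in>I. s i y) = (\<Sum>i\<in>I. D x V (s i))"
  using s
proof (induction I rule: infinite_finite_induct)
  case (insert i I)
  have "smooth_section_on N E U (\<lambda>y. \<Sum>i\<in>I. s i y)"
    by (rule section_sum[OF U(1)]) (rule insert.prems, simp)
  from D_add[OF U _ this x, of "s i" V] show ?case
    using insert by simp
qed (simp_all add: D_scale_const[OF U section_zero[OF U(1)] x, of V 0, simplified])

text \<open>The coordinate rule for covariant derivatives in an arbitrary bundle: the second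
  summand, which carries the connection coefficients, differentiates the section whose components
  are frozen at their values at \<open>x\<close>.\<close>

lemma D_triv:
  assumes U: "open U" "U \<subseteq> points N" and s: "smooth_section_on N E U s" and x: "x \<in> U"
    and triv: "(W, \<tau>) \<in> E" "x \<in> W"
  shows "D x V s = inv (\<tau> x) (differential N (\<lambda>y. \<tau> y (s y)) x V) + D x V (\<lambda>y. inv (\<tau> y) (\<tau> x (s x)))"
proof -
  define U' where "U' = U \<inter> W"
  have U': "open U'" "U' \<subseteq> points N" "x \<in> U'" "U' \<subseteq> W"
    using U x triv triv_open[OF triv(1)] by (auto simp: U'_def)
  define F where "F y = \<tau> y (s y)" for y
  define S where "S b y = inv (\<tau> y) b" for b y
  have F: "smooth_map_on N U' F"
    unfolding F_def
    by (rule section_triv[OF triv(1) U'(1,4), THEN iffD1, OF section_subset[OF s]]) (simp add: U'_def)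
  have S: "smooth_section_on N E U' (S b)" for b
    unfolding S_def by (rule section_subset[OF section_const[OF triv(1)] U'(4)])
  have Fb: "smooth_map_on N U' (\<lambda>y. F y \<bullet> b)" for b
    by (rule smooth_map_on_inner_const[OF U'(1) F])
  have FS: "smooth_section_on N E U' (\<lambda>y. (F y \<bullet> b) *\<^sub>R S b y)" for b
    by (rule section_scale[OF U'(1) S Fb])
  have "D x V s = D x V (\<lambda>y. \<Sum>b\<in>Basis. (F y \<bullet> b) *\<^sub>R S b y)"
  proof (rule D_local[OF U'(1,2) section_subset[OF s] _ U'(3)])
    show "s y = (\<Sum>b\<in>Basis. (F y \<bullet> b) *\<^sub>R S b y)" if "y \<in> U'" for y
      unfolding F_def S_def using that U'(4) by (intro triv_expand[OF triv(1)]) blast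
  qed (simp add: U'_def)
  also have "\<dots> = (\<Sum>b\<in>Basis. (differential N F x V \<bullet> b) *\<^sub>R S b x + (F x \<bullet> b) *\<^sub>R D x V (S b))"
    unfolding D_sum[OF U'(1,2) FS U'(3)] D_scale[OF U'(1,2) S Fb U'(3)]
    by (subst differential_inner[OF F U'(1,3)]) (use U'(2,3) in auto)
  also have "\<dots> = inv (\<tau> x) (differential N F x V) + (\<Sum>b\<in>Basis. (F x \<bullet> b) *\<^sub>R D x V (S b))"
    unfolding S_def linear_expand[OF triv_inv_linear[OF triv], of "differential N F x V"]
    by (rule sum.distrib)
  also have "(\<Sum>b\<in>Basis. (F x \<bullet> b) *\<^sub>R D x V (S b)) = (\<Sum>b\<in>Basis. D x V (\<lambda>y. (F x \<bullet> b) *\<^sub>R S b y))"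
    unfolding D_scale_const[OF U'(1,2) S U'(3)] ..
  also have "\<dots> = D x V (\<lambda>y. \<Sum>b\<in>Basis. (F x \<bullet> b) *\<^sub>R S b y)"
    by (rule D_sum[OF U'(1,2) section_scale[OF U'(1) S smooth_map_on_const] U'(3), symmetric])
  also have "\<dots> = D x V (\<lambda>y. inv (\<tau> y) (\<tau> x (s x)))"
  proof (rule D_local[OF U'(1,2) _ _ U'(3), symmetric])
    show "smooth_section_on N E U' (\<lambda>y. inv (\<tau> y) (\<tau> x (s x)))"
      by (rule section_subset[OF section_const[OF triv(1)] U'(4)])
    show "inv (\<tau> y) (\<tau> x (s x)) = (\<Sum>b\<in>Basis. (F x \<bullet> b) *\<^sub>R S b y)" if "y \<in> U'" for y
      using linear_expand[OF triv_inv_linear[OF triv(1)], of y "F x"] that U'(4) by (simp add: F_def S_def subset_iff)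
  qed
  finally show ?thesis by (simp add: F_def)
qed

end


section \<open>Christoffel symbols and curvature in a chart\<close>

context smooth_mfd
begin

lemma tangent_triv: "c \<in> atlas N \<Longrightarrow> (fst c, comp c) \<in> tangent_bundle N"
  unfolding tangent_bundle_def by (rule imageI)

lemma tangent_vbundle: "vbundle N (tangent_bundle N)"
  using smooth_mfd_axioms vector_bundle_tangent by (simp add: vbundle_def vbundle_axioms_def)

lemma field_smooth_chart:
  assumes "smooth_vector_field_on N U X" "c \<in> atlas N"
  shows "smooth_map_on N (U \<inter> fst c) (\<lambda>y. comp c y (X y))"
  using bspec[OF assms(1)[unfolded smooth_section_on_def] tangent_triv[OF assms(2)]] by simp

text \<open>\<open>lie_bracket\<close> is defined through the preferred chart of \<open>x\<close>.
  In another chart the derivative of the components of a field picks up a second derivative of the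
  coordinate change; that term is symmetric in the two fields and cancels in the difference.\<close>

lemma lie_bracket_chart:
  assumes U: "open U" "x \<in> U" "x \<in> points N"
    and X: "smooth_vector_field_on N U X" and Y: "smooth_vector_field_on N U Y"
    and c: "c \<in> atlas N" "x \<in> fst c"
  shows "comp c x (lie_bracket N X Y x)
    = differential N (\<lambda>y. comp c y (Y y)) x (X x) - differential N (\<lambda>y. comp c y (X y)) x (Y x)"
proof -
  define d where "d = chart_at N x"
  have d: "d \<in> atlas N" "x \<in> fst d"
    using U(3) chart_at_atlas chart_at_mem by (auto simp: d_def)
  define A where "A q v = frechet_derivative (\<lambda>q. snd c (chart_inv d q)) (at q) v" for q v
  define A' where "A' v = frechet_derivative (\<lambda>q. A q v) (at (snd d x))" for v
  define O' where "O' = snd d ` (U \<inter> fst d \<inter> fst c)"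
  have op: "open O'" unfolding O'_def
    using U(1) c(1) d(1) by (intro chart_image_open_subset open_Int chart_open) auto
  have mem: "snd d x \<in> O'" unfolding O'_def using U(2) c(2) d(2) by blast
  have tr: "smooth_on O' (\<lambda>q. snd c (chart_inv d q))"
    by (rule smooth_on_subset[OF transition_smooth[OF d(1) c(1)]]) (auto simp: O'_def)
  have lin: "linear (A q)" if "q \<in> O'" for q
    unfolding A_def by (rule has_derivative_linear[OF smooth_on_has_derivative[OF tr that]])
  have der: "((\<lambda>q. A q v) has_derivative A' v) (at (snd d x))" for v
    unfolding A'_def A_def by (rule smooth_on_has_derivative[OF smooth_on_derivative[OF tr] mem])
  have sym: "A' v w = A' w v" for v w
    unfolding A'_def A_def by (rule symmetric_second_derivative[OF op mem tr])
  have A_trans: "A (snd d y) = trans d c y" for y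
    by (simp add: A_def trans_def fun_eq_iff)
  have key: "differential N (\<lambda>y. comp c y (Z y)) x V
      = A' (Z x) V + A (snd d x) (differential N (\<lambda>y. comp d y (Z y)) x V)"
    if Z: "smooth_vector_field_on N U Z" for Z V
  proof -
    have "((\<lambda>q. comp d (chart_inv d q) (Z (chart_inv d q))) has_derivative
        differential N (\<lambda>y. comp d y (Z y)) x) (at (snd d x))"
      using differential_has_derivative[OF field_smooth_chart[OF Z d(1)] _ _ U(3)] U(1,2) d chart_open[OF d(1)]
      by (auto simp: d_def[symmetric])
    from has_derivative_linear_family[OF op mem lin der this]
    have "((\<lambda>q. A q (comp d (chart_inv d q) (Z (chart_inv d q)))) has_derivative
        (\<lambda>h. A' (Z x) h + A (snd d x) (differential N (\<lambda>y. comp d y (Z y)) x h))) (at (snd d x))"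
      using chart_inv_chart[OF d] comp_chart_at[OF U(3)] by (simp add: d_def)
    then have "((\<lambda>q. comp c (chart_inv d q) (Z (chart_inv d q))) has_derivative
        (\<lambda>h. A' (Z x) h + A (snd d x) (differential N (\<lambda>y. comp d y (Z y)) x h))) (at (snd d x))"
    proof (rule has_derivative_transform_within_open[OF _ op mem])
      fix q assume "q \<in> O'"
      then obtain y where y: "q = snd d y" "y \<in> fst d" "y \<in> fst c" unfolding O'_def by blast
      then show "A q (comp d (chart_inv d q) (Z (chart_inv d q))) = comp c (chart_inv d q) (Z (chart_inv d q))"
        using chart_inv_chart[OF d(1) y(2)] trans_comp[OF d(1) y(2) c(1) y(3)] by (simp add: A_trans)
    qed
    from frechet_derivative_eqI[OF this] show ?thesis
      by (simp add: differential_def[of N "\<lambda>y. comp c y (Z y)"] o_def d_def)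
  qed
  have lieb: "lie_bracket N X Y x
      = differential N (\<lambda>y. comp d y (Y y)) x (X x) - differential N (\<lambda>y. comp d y (X y)) x (Y x)"
    by (simp add: lie_bracket_def Let_def d_def)
  have "comp c x (lie_bracket N X Y x) = A (snd d x) (lie_bracket N X Y x)"
    by (simp add: A_trans comp_eq_trans d_def[symmetric])
  also have "\<dots> = A (snd d x) (differential N (\<lambda>y. comp d y (Y y)) x (X x))
      - A (snd d x) (differential N (\<lambda>y. comp d y (X y)) x (Y x))"
    unfolding lieb by (rule linear_diff[OF lin[OF mem]])
  also have "\<dots> = differential N (\<lambda>y. comp c y (Y y)) x (X x) - differential N (\<lambda>y. comp c y (X y)) x (Y x)"
    unfolding key[OF X] key[OF Y] by (simp add: sym)
  finally show ?thesis .
qed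

text \<open>For the tangent bundle, \<open>extend_at\<close> picks fields of this form, so they
  serve both as coordinate frame and as the extensions behind \<open>curvature\<close>.\<close>

definition coord_field where "coord_field c v = (\<lambda>y. inv (comp c y) v)"

lemma coord_field_smooth: "c \<in> atlas N \<Longrightarrow> smooth_vector_field_on N (fst c) (coord_field c v)"
  unfolding coord_field_def by (rule vbundle.section_const[OF tangent_vbundle tangent_triv])

lemma comp_coord_field: "c \<in> atlas N \<Longrightarrow> x \<in> fst c \<Longrightarrow> comp c x (coord_field c v x) = v"
  by (simp add: coord_field_def)

lemma differential_locally_const:
  assumes "open U" "x \<in> U" "x \<in> points N" "\<And>y. y \<in> U \<Longrightarrow> f y = k"
  shows "differential N f x V = 0"
  using differential_cong[OF assms(1-3), of f "\<lambda>_. k"] assms(4) by (simp add: differential_const)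

lemma lie_bracket_coord_field:
  assumes c: "c \<in> atlas N" "x \<in> fst c"
  shows "lie_bracket N (coord_field c v) (coord_field c w) x = 0"
proof -
  have "comp c x (lie_bracket N (coord_field c v) (coord_field c w) x) = 0"
    using chart_mem_points[OF c] c
    by (subst lie_bracket_chart[OF chart_open[OF c(1)] c(2) _ coord_field_smooth coord_field_smooth])
      (simp_all add: differential_locally_const[OF chart_open[OF c(1)] c(2) _ comp_coord_field[OF c(1)]])
  then show ?thesis
    using inv_comp_comp[OF c] linear_0[OF linear_inv_comp[OF c]] by metis
qed

end

text \<open>The Riemann tensor in terms of Christoffel symbols, for an arbitrary map
  \<open>\<Gamma>\<close>, so that it can be studied on a coordinate domain without reference to a
  manifold.\<close>

definition coordinate_curvature ::
  "('a::real_normed_vector \<Rightarrow> 'a \<Rightarrow> 'a \<Rightarrow> 'a) \<Rightarrow> 'a \<Rightarrow> 'a \<Rightarrow> 'a \<Rightarrow> 'a \<Rightarrow> 'a" where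
  "coordinate_curvature \<Gamma> q u v w =
     frechet_derivative (\<lambda>q. \<Gamma> q v w) (at q) u - frechet_derivative (\<lambda>q. \<Gamma> q u w) (at q) v
     + \<Gamma> q u (\<Gamma> q v w) - \<Gamma> q v (\<Gamma> q u w)"

locale affine_connection = smooth_mfd N
  for N :: "('n::{t2_space,second_countable_topology}, 'f::euclidean_space) manifold" +
  fixes D :: "('n, 'f, 'f) connection"
  assumes D_connection: "linear_connection N (tangent_bundle N) D"

sublocale affine_connection \<subseteq> lconnection N "tangent_bundle N" D
  by (intro lconnection.intro tangent_vbundle lconnection_axioms.intro D_connection)

context affine_connection
begin

definition christoffel where
  "christoffel c q u v =
     comp c (chart_inv c q) (D (chart_inv c q) (coord_field c u (chart_inv c q)) (coord_field c v))"

lemma christoffel_smooth: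
  assumes c: "c \<in> atlas N"
  shows "smooth_on (snd c ` fst c) (\<lambda>q. christoffel c q u v)"
proof -
  have "smooth_vector_field_on N (fst c) (\<lambda>x. D x (coord_field c u x) (coord_field c v))"
    by (intro D_smooth chart_open[OF c] chart_points[OF c] coord_field_smooth c)
  from field_smooth_chart[OF this c]
  show ?thesis
    unfolding christoffel_def Int_absorb
    by (rule smooth_map_on_chart[OF c chart_open[OF c] order_refl, THEN iffD1])
qed

context
  fixes c x assumes c: "c \<in> atlas N" and x: "x \<in> fst c"
begin

lemma christoffel_at: "christoffel c (snd c x) u v = comp c x (D x (coord_field c u x) (coord_field c v))"
  by (simp add: christoffel_def chart_inv_chart[OF c x])

lemma linear_coord_field: "linear (\<lambda>u. coord_field c u x)"
  unfolding coord_field_def by (rule linear_inv_comp[OF c x])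

lemma christoffel_bilinear: "bilinear (christoffel c (snd c x))"
  unfolding bilinear_def
proof (intro conjI allI)
  note U = chart_open[OF c] chart_points[OF c]
  note sm = coord_field_smooth[OF c]
  show "linear (\<lambda>u. christoffel c (snd c x) u v)" for v
    unfolding christoffel_at
    using linear_compose[OF linear_compose[OF linear_coord_field D_linear[OF U sm x]] linear_comp[OF c x]]
    by (simp add: o_def)
  show "linear (\<lambda>v. christoffel c (snd c x) u v)" for u
    unfolding christoffel_at
  proof (rule linearI)
    fix v w :: 'f and r :: real
    have "D x V (coord_field c (v + w)) = D x V (\<lambda>y. coord_field c v y + coord_field c w y)" for V
      by (rule D_local[OF U sm _ x])
        (simp add: coord_field_def linear_add[OF linear_inv_comp[OF c]])
    then show "comp c x (D x (coord_field c u x) (coord_field c (v + w)))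
        = comp c x (D x (coord_field c u x) (coord_field c v)) + comp c x (D x (coord_field c u x) (coord_field c w))"
      unfolding D_add[OF U sm sm x] by (simp only: linear_add[OF linear_comp[OF c x]])
    have "D x V (coord_field c (r *\<^sub>R v)) = D x V (\<lambda>y. r *\<^sub>R coord_field c v y)" for V
      by (rule D_local[OF U sm _ x])
        (simp add: coord_field_def linear_scale[OF linear_inv_comp[OF c]])
    then show "comp c x (D x (coord_field c u x) (coord_field c (r *\<^sub>R v)))
        = r *\<^sub>R comp c x (D x (coord_field c u x) (coord_field c v))"
      unfolding D_scale_const[OF U sm x] by (simp only: linear_scale[OF linear_comp[OF c x]])
  qed
qed

lemma D_chart:
  assumes U: "open U" "U \<subseteq> points N" "x \<in> U" and s: "smooth_vector_field_on N U s"
  shows "comp c x (D x V s)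
    = frechet_derivative (\<lambda>q. comp c (chart_inv c q) (s (chart_inv c q))) (at (snd c x)) (comp c x V)
      + christoffel c (snd c x) (comp c x V) (comp c x (s x))"
proof -
  have "differential N (\<lambda>y. comp c y (s y)) x V
      = frechet_derivative (\<lambda>q. comp c (chart_inv c q) (s (chart_inv c q))) (at (snd c x)) (comp c x V)"
    by (rule differential_smooth[OF field_smooth_chart[OF s c] _ _ c x])
      (use U x chart_open[OF c] in auto)
  moreover have "D x V (\<lambda>y. inv (comp c y) (comp c x (s x))) = D x (coord_field c (comp c x V) x) (coord_field c (comp c x (s x)))"
    by (simp add: coord_field_def inv_comp_comp[OF c x])
  ultimately show ?thesis
    by (simp add: D_triv[OF U(1,2) s U(3) tangent_triv[OF c] x] linear_add[OF linear_comp[OF c x]]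
        comp_inv[OF c x] christoffel_at)
qed

end

text \<open>Tensoriality of the curvature. The second derivatives of \<open>Z\<close> cancel by
  symmetry, its first derivatives because they occur symmetrically next to \<open>\<Gamma>\<close>,
  and the derivatives of \<open>X\<close> and \<open>Y\<close> cancel against the bracket term. Only
  values at the point survive, whichever extension \<open>SOME\<close> selects.\<close>

lemma curvature_of_fields_chart:
  assumes U: "open U" "U \<subseteq> points N" "x \<in> U" and c: "c \<in> atlas N" "x \<in> fst c"
    and X: "smooth_vector_field_on N U X" and Y: "smooth_vector_field_on N U Y"
    and Z: "smooth_vector_field_on N U Z"
  shows "comp c x (curvature_of_fields N D X Y Z x)
    = coordinate_curvature (christoffel c) (snd c x) (comp c x (X x)) (comp c x (Y x)) (comp c x (Z x))"
proof -
  define hat where "hat S q = comp c (chart_inv c q) (S (chart_inv c q))" for S q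
  define \<Gamma> where "\<Gamma> = christoffel c"
  define d where "d f q = frechet_derivative f (at q)" for f :: "'f \<Rightarrow> 'f" and q
  define O' where "O' = snd c ` (U \<inter> fst c)"
  let ?q = "snd c x"
  have op: "open O'" unfolding O'_def
    using U(1) c(1) by (intro chart_image_open_subset open_Int chart_open) auto
  have mem: "?q \<in> O'" unfolding O'_def using U(3) c(2) by blast
  have hat_at: "hat S (snd c y) = comp c y (S y)" if "y \<in> fst c" for S y
    by (simp add: hat_def chart_inv_chart[OF c(1) that])
  have hat_smooth: "smooth_on O' (hat S)" if "smooth_vector_field_on N U S" for S
    using smooth_map_onD[OF field_smooth_chart[OF that c(1)] c(1)] by (simp add: hat_def[abs_def] O'_def)
  have D_hat: "hat (\<lambda>y. D y (V y) S) q = d (hat S) q (hat V q) + \<Gamma> q (hat V q) (hat S q)"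
    if q: "q \<in> O'" and S: "smooth_vector_field_on N U S" for S V q
  proof -
    obtain y where y: "q = snd c y" "y \<in> U" "y \<in> fst c" using q unfolding O'_def by blast
    show ?thesis
      unfolding y(1) hat_at[OF y(3)] d_def \<Gamma>_def D_chart[OF c(1) y(3) U(1,2) y(2) S]
      by (simp add: hat_def[abs_def])
  qed
  have \<Gamma>_der: "((\<lambda>q. \<Gamma> q v w) has_derivative d (\<lambda>q. \<Gamma> q v w) ?q) (at ?q)" for v w
    unfolding d_def \<Gamma>_def by (rule smooth_on_has_derivative[OF christoffel_smooth[OF c(1)]]) (use c(2) in blast)
  have \<Gamma>_bil: "bilinear (\<Gamma> q)" if "q \<in> O'" for q
    using that christoffel_bilinear[OF c(1)] unfolding O'_def \<Gamma>_def by blast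
  \<comment> \<open>Arguments evaluated at \<open>?q\<close> under a \<open>\<lambda>q\<close> are
    frozen, so that each summand differentiates one factor only.\<close>
  have second: "comp c x (D x V (\<lambda>y. D y (W y) Z)) =
      d (\<lambda>q. d (hat Z) q (hat W ?q)) ?q (comp c x V) + d (hat Z) ?q (d (hat W) ?q (comp c x V))
      + d (\<lambda>q. \<Gamma> q (hat W ?q) (hat Z ?q)) ?q (comp c x V)
      + \<Gamma> ?q (d (hat W) ?q (comp c x V)) (hat Z ?q) + \<Gamma> ?q (hat W ?q) (d (hat Z) ?q (comp c x V))
      + \<Gamma> ?q (comp c x V) (d (hat Z) ?q (hat W ?q)) + \<Gamma> ?q (comp c x V) (\<Gamma> ?q (hat W ?q) (hat Z ?q))"
    if W: "smooth_vector_field_on N U W" for W V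
  proof -
    have hW: "(hat W has_derivative d (hat W) ?q) (at ?q)" and hZ: "(hat Z has_derivative d (hat Z) ?q) (at ?q)"
      unfolding d_def by (intro smooth_on_has_derivative[OF hat_smooth mem] W Z)+
    have 1: "((\<lambda>q. d (hat Z) q (hat W q)) has_derivative
        (\<lambda>h. d (\<lambda>q. d (hat Z) q (hat W ?q)) ?q h + d (hat Z) ?q (d (hat W) ?q h))) (at ?q)"
    proof (rule has_derivative_linear_family[OF op mem _ _ hW])
      show "linear (d (hat Z) q)" if "q \<in> O'" for q
        unfolding d_def by (rule has_derivative_linear[OF smooth_on_has_derivative[OF hat_smooth[OF Z] that]])
      show "((\<lambda>q. d (hat Z) q v) has_derivative d (\<lambda>q. d (hat Z) q v) ?q) (at ?q)" for v
        unfolding d_def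
        by (rule smooth_on_has_derivative[OF smooth_on_derivative[OF hat_smooth[OF Z]] mem])
    qed
    have 2: "((\<lambda>q. \<Gamma> q (hat W q) (hat Z q)) has_derivative
        (\<lambda>h. d (\<lambda>q. \<Gamma> q (hat W ?q) (hat Z ?q)) ?q h + \<Gamma> ?q (d (hat W) ?q h) (hat Z ?q)
          + \<Gamma> ?q (hat W ?q) (d (hat Z) ?q h))) (at ?q)"
      by (rule has_derivative_bilinear_family[OF op mem \<Gamma>_bil \<Gamma>_der hW hZ])
    have 3: "(hat (\<lambda>y. D y (W y) Z) has_derivative
        (\<lambda>h. d (\<lambda>q. d (hat Z) q (hat W ?q)) ?q h + d (hat Z) ?q (d (hat W) ?q h)
          + (d (\<lambda>q. \<Gamma> q (hat W ?q) (hat Z ?q)) ?q h + \<Gamma> ?q (d (hat W) ?q h) (hat Z ?q)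
          + \<Gamma> ?q (hat W ?q) (d (hat Z) ?q h)))) (at ?q)"
      by (rule has_derivative_transform_within_open[OF has_derivative_add[OF 1 2] op mem])
        (rule D_hat[OF _ Z, symmetric])
    have sm: "smooth_vector_field_on N U (\<lambda>y. D y (W y) Z)"
      by (rule D_smooth[OF U(1,2) Z W])
    have "comp c x (D x V (\<lambda>y. D y (W y) Z))
        = d (hat (\<lambda>y. D y (W y) Z)) ?q (comp c x V) + \<Gamma> ?q (comp c x V) (hat (\<lambda>y. D y (W y) Z) ?q)"
      unfolding D_chart[OF c U sm] hat_at[OF c(2)] d_def \<Gamma>_def by (simp add: hat_def[abs_def])
    then show ?thesis
      unfolding d_def frechet_derivative_eqI[OF 3] D_hat[OF mem Z] bilinear_radd[OF \<Gamma>_bil[OF mem]]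
      by (simp add: d_def)
  qed
  have sym: "d (\<lambda>q. d (hat Z) q v) ?q w = d (\<lambda>q. d (hat Z) q w) ?q v" for v w
    unfolding d_def by (rule symmetric_second_derivative[OF op mem hat_smooth[OF Z]])
  have xp: "x \<in> points N" using U by blast
  have diff: "differential N (\<lambda>y. comp c y (S y)) x V = d (hat S) ?q (comp c x V)"
    if "smooth_vector_field_on N U S" for S V
    unfolding d_def hat_def
    by (rule differential_smooth[OF field_smooth_chart[OF that c(1)] _ _ c])
      (use U c chart_open[OF c(1)] in auto)
  have lieb: "comp c x (lie_bracket N X Y x) = d (hat Y) ?q (hat X ?q) - d (hat X) ?q (hat Y ?q)"
    unfolding lie_bracket_chart[OF U(1,3) xp X Y c] diff[OF X] diff[OF Y] hat_at[OF c(2)] ..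
  have third: "comp c x (D x (lie_bracket N X Y x) Z) =
      d (hat Z) ?q (d (hat Y) ?q (hat X ?q)) - d (hat Z) ?q (d (hat X) ?q (hat Y ?q))
      + (\<Gamma> ?q (d (hat Y) ?q (hat X ?q)) (hat Z ?q) - \<Gamma> ?q (d (hat X) ?q (hat Y ?q)) (hat Z ?q))"
  proof -
    have lin: "linear (d (hat Z) ?q)"
      unfolding d_def by (rule has_derivative_linear[OF smooth_on_has_derivative[OF hat_smooth[OF Z] mem]])
    have "comp c x (D x (lie_bracket N X Y x) Z)
        = d (hat Z) ?q (comp c x (lie_bracket N X Y x)) + \<Gamma> ?q (comp c x (lie_bracket N X Y x)) (hat Z ?q)"
      unfolding D_chart[OF c U Z] hat_at[OF c(2)] d_def \<Gamma>_def by (simp add: hat_def[abs_def])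
    then show ?thesis
      unfolding lieb linear_diff[OF lin] bilinear_lsub[OF \<Gamma>_bil[OF mem]] .
  qed
  have "comp c x (curvature_of_fields N D X Y Z x) = comp c x (D x (X x) (\<lambda>y. D y (Y y) Z))
      - comp c x (D x (Y x) (\<lambda>y. D y (X y) Z)) - comp c x (D x (lie_bracket N X Y x) Z)"
    unfolding curvature_of_fields_def by (simp only: linear_diff[OF linear_comp[OF c]])
  also have "\<dots> = coordinate_curvature \<Gamma> ?q (hat X ?q) (hat Y ?q) (hat Z ?q)"
    unfolding second[OF X] second[OF Y] third coordinate_curvature_def
    using sym[of "hat X ?q" "hat Y ?q"] by (simp add: d_def hat_at[OF c(2)])
  finally show ?thesis unfolding \<Gamma>_def hat_at[OF c(2)] .
qed

lemma curvature_chart: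
  assumes c: "c \<in> atlas N" "x \<in> fst c"
  shows "comp c x (curvature N (tangent_bundle N) D x u v w)
    = coordinate_curvature (christoffel c) (snd c x) (comp c x u) (comp c x v) (comp c x w)"
proof -
  have xp: "x \<in> points N" by (rule chart_mem_points[OF c])
  obtain U \<tau> where U: "(U, \<tau>) \<in> tangent_bundle N" "x \<in> U"
    "\<And>e. extend_at (tangent_bundle N) x e = (\<lambda>y. inv (\<tau> y) (\<tau> x e))"
    by (rule extend_at_triv[OF xp]) metis
  show ?thesis
    unfolding curvature_def U(3)
    by (subst curvature_of_fields_chart[OF triv_open[OF U(1)] triv_points[OF U(1)] U(2) c];
        (intro section_const U)?) (simp only: triv_inv[OF U(1,2)])
qed

text \<open>Coordinate fields commute, so for them vanishing torsion is symmetry of their mutual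
  covariant derivatives.\<close>

lemma christoffel_symmetric:
  assumes "torsion_free N D" and c: "c \<in> atlas N" "x \<in> fst c"
  shows "christoffel c (snd c x) u v = christoffel c (snd c x) v u"
proof -
  have "D x (coord_field c u x) (coord_field c v) - D x (coord_field c v x) (coord_field c u)
      = lie_bracket N (coord_field c u) (coord_field c v) x"
    using assms(1)[unfolded torsion_free_def, rule_format, of "fst c"] c
      chart_open[OF c(1)] chart_points[OF c(1)] coord_field_smooth[OF c(1)] by blast
  then show ?thesis by (simp add: lie_bracket_coord_field[OF c] christoffel_at[OF c])
qed

lemma christoffel_metric:
  assumes h: "metric_connection N (tangent_bundle N) h D" and c: "c \<in> atlas N" "x \<in> fst c"
    and smooth: "\<And>v w. smooth_map_on N (fst c) (\<lambda>x. h x (coord_field c v x) (coord_field c w x))"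
  defines "H \<equiv> \<lambda>q v w. h (chart_inv c q) (coord_field c v (chart_inv c q)) (coord_field c w (chart_inv c q))"
  shows "((\<lambda>q. H q v w) has_derivative
      (\<lambda>u. H (snd c x) (christoffel c (snd c x) u v) w + H (snd c x) v (christoffel c (snd c x) u w))) (at (snd c x))"
proof -
  have der: "((\<lambda>q. H q v w) has_derivative frechet_derivative (\<lambda>q. H q v w) (at (snd c x))) (at (snd c x))"
    unfolding H_def by (rule smooth_map_on_has_derivative[OF smooth chart_open[OF c(1)] c(2) c])
  have frame: "coord_field c (comp c x e) x = e" for e
    by (simp add: coord_field_def inv_comp_comp[OF c])
  have "frechet_derivative (\<lambda>q. H q v w) (at (snd c x)) u
      = H (snd c x) (christoffel c (snd c x) u v) w + H (snd c x) v (christoffel c (snd c x) u w)" for u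
  proof -
    have "differential N (\<lambda>x. h x (coord_field c v x) (coord_field c w x)) x (coord_field c u x)
        = h x (D x (coord_field c u x) (coord_field c v)) (coord_field c w x)
        + h x (coord_field c v x) (D x (coord_field c u x) (coord_field c w))"
      using h[unfolded metric_connection_def, rule_format, of "fst c"] c
        chart_open[OF c(1)] chart_points[OF c(1)] coord_field_smooth[OF c(1)] by blast
    moreover have "differential N (\<lambda>x. h x (coord_field c v x) (coord_field c w x)) x (coord_field c u x)
        = frechet_derivative (\<lambda>q. H q v w) (at (snd c x)) u"
      unfolding H_def
      by (subst differential_smooth[OF smooth chart_open[OF c(1)] c(2) c]) (simp add: comp_coord_field[OF c])
    ultimately show ?thesis
      by (simp add: H_def chart_inv_chart[OF c] christoffel_at[OF c] frame)
  qed
  then have "frechet_derivative (\<lambda>q. H q v w) (at (snd c x)) = (\<lambda>u.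
      H (snd c x) (christoffel c (snd c x) u v) w + H (snd c x) v (christoffel c (snd c x) u w))"
    by (rule ext)
  with der show ?thesis by (simp only:)
qed

end


section \<open>The ambient metric in a chart\<close>

text \<open>Points of the coordinate domain and tangent vectors share one type; the projections read
  off coordinates of the former and components of the latter.\<close>

abbreviation dt :: "real \<times> real \<times> 'a \<Rightarrow> real" where "dt \<equiv> fst"
abbreviation dr :: "real \<times> real \<times> 'a \<Rightarrow> real" where "dr u \<equiv> fst (snd u)"
abbreviation base :: "real \<times> real \<times> 'a \<Rightarrow> 'a" where "base u \<equiv> snd (snd u)"

text \<open>A dilation is linear in the coordinates and hence its own differential, so this map acts
  on points as well as on tangent vectors.\<close>

definition dilate :: "real \<Rightarrow> real \<times> real \<times> 'a \<Rightarrow> real \<times> real \<times> 'a" where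
  "dilate k u = (k * dt u, dr u, base u)"

lemma dilate_simps [simp]: "dt (dilate k u) = k * dt u" "dr (dilate k u) = dr u" "base (dilate k u) = base u"
  by (simp_all add: dilate_def)

lemma dilate_linear: "linear (dilate k)" for k :: real
  by (rule linearI) (simp_all add: prod_eq_iff algebra_simps)

lemma sum_Basis_prod:
  fixes f :: "'a::euclidean_space \<times> 'b::euclidean_space \<Rightarrow> 'c::comm_monoid_add"
  shows "sum f Basis = (\<Sum>i\<in>Basis. f (i, 0)) + (\<Sum>i\<in>Basis. f (0, i))"
  unfolding Basis_prod_def
  by (subst sum.union_disjoint) (auto simp: sum.reindex inj_on_def)

definition ambient_form where
  "ambient_form H q v w = (dr q * dt v + dt q * dr v) * dt w + dt v * (dr q * dt w + dt q * dr w)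
     + (dt q)\<^sup>2 * H (dr q) (base q) (base v) (base w)"
  for H :: "real \<Rightarrow> 'e \<Rightarrow> 'e \<Rightarrow> 'e \<Rightarrow> real"

text \<open>
  The Levi-Civita connection of the ambient metric in a chart: \<open>Q\<close> is the coordinate domain,
  \<open>\<Gamma>\<close> are the Christoffel symbols, and \<open>H r\<close> is the coordinate expression of the metric
  associated with the parameter \<open>r\<close>.
\<close>

locale ambient_chart =
  fixes Q :: "(real \<times> real \<times> 'e::euclidean_space) set"
    and H :: "real \<Rightarrow> 'e \<Rightarrow> 'e \<Rightarrow> 'e \<Rightarrow> real"
    and \<Gamma> :: "real \<times> real \<times> 'e \<Rightarrow> real \<times> real \<times> 'e \<Rightarrow> real \<times> real \<times> 'e \<Rightarrow> real \<times> real \<times> 'e"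
  assumes open_Q: "open Q"
    and Q_pos: "q \<in> Q \<Longrightarrow> dt q > 0"
    and Q_dilate: "q \<in> Q \<Longrightarrow> k > 0 \<Longrightarrow> dilate k q \<in> Q"
    and H_bilinear: "q \<in> Q \<Longrightarrow> bilinear (H (dr q) (base q))"
    and H_sym: "q \<in> Q \<Longrightarrow> H (dr q) (base q) x y = H (dr q) (base q) y x"
    and H_nondegenerate: "q \<in> Q \<Longrightarrow> (\<And>y. H (dr q) (base q) x y = 0) \<Longrightarrow> x = 0"
    and \<Gamma>_bilinear: "q \<in> Q \<Longrightarrow> bilinear (\<Gamma> q)"
    and \<Gamma>_sym: "q \<in> Q \<Longrightarrow> \<Gamma> q v w = \<Gamma> q w v"
    and \<Gamma>_smooth: "smooth_on Q (\<lambda>q. \<Gamma> q v w)"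
    and \<Gamma>_metric: "q \<in> Q \<Longrightarrow>
      ((\<lambda>q. ambient_form H q v w) has_derivative
        (\<lambda>u. ambient_form H q (\<Gamma> q u v) w + ambient_form H q v (\<Gamma> q u w))) (at q)"
begin

abbreviation h where "h \<equiv> ambient_form H"

lemmas h_def = ambient_form_def[of H]

abbreviation e0 :: "real \<times> real \<times> 'e" where "e0 \<equiv> (1, 0, 0)"

definition proj :: "real \<times> real \<times> 'e \<Rightarrow> real \<times> real \<times> 'e" where "proj u = (0, dr u, base u)"

lemma proj_eq: "proj u = u - dt u *\<^sub>R e0"
  by (simp add: proj_def prod_eq_iff)

definition dh where "dh q u v w = h q (\<Gamma> q u v) w + h q v (\<Gamma> q u w)"

lemma h_has_derivative: "q \<in> Q \<Longrightarrow> ((\<lambda>q. h q v w) has_derivative (\<lambda>u. dh q u v w)) (at q)"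
  using \<Gamma>_metric by (simp add: dh_def)

lemma h_bilinear:
  assumes "q \<in> Q"
  shows "bilinear (h q)"
  unfolding bilinear_def h_def
  by (intro conjI allI linearI)
    (simp_all add: bilinear_ladd[OF H_bilinear[OF assms]] bilinear_radd[OF H_bilinear[OF assms]]
      bilinear_lmul[OF H_bilinear[OF assms]] bilinear_rmul[OF H_bilinear[OF assms]] algebra_simps)

lemma h_sym: "q \<in> Q \<Longrightarrow> h q v w = h q w v"
  by (simp add: h_def H_sym[of q "base v"] algebra_simps)

lemma h_eqI:
  assumes q: "q \<in> Q" and eq: "\<And>w. h q v w = h q v' w"
  shows "v = v'"
proof -
  define x where "x = v - v'"
  have x: "h q x w = 0" for w
    unfolding x_def bilinear_lsub[OF h_bilinear[OF q]] by (simp add: eq)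
  note t = Q_pos[OF q]
  note H0 = bilinear_rzero[OF H_bilinear[OF q]]
  \<comment> \<open>The order of the tests matters: pairing with \<open>\<partial>\<^sub>r\<close>
    sees only \<open>dt x\<close>, and once that is zero, pairing with
    \<open>\<partial>\<^sub>t\<close> isolates \<open>dr x\<close>.\<close>
  have "dt x = 0" using x[of "(0, 1, 0)"] t by (simp add: h_def H0)
  moreover from this have "dr x = 0" using x[of "(1, 0, 0)"] t by (simp add: h_def H0)
  moreover have "base x = 0"
    by (rule H_nondegenerate[OF q]) (use x[of "(0, 0, w)" for w] t in \<open>simp add: h_def\<close>)
  ultimately have "x = 0" by (simp add: prod_eq_iff)
  then show ?thesis by (simp add: x_def)
qed

text \<open>Koszul's formula for coordinate fields, whose brackets vanish. The right-hand side
  consists of six products, four of which cancel by symmetry of \<open>\<Gamma>\<close>.\<close>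

lemma koszul:
  assumes "q \<in> Q"
  shows "2 * h q (\<Gamma> q u v) w = dh q u v w + dh q v u w - dh q w u v"
  using assms by (simp add: dh_def h_sym[of q _ "\<Gamma> q _ _"] \<Gamma>_sym[of q v u] \<Gamma>_sym[of q w])

text \<open>Pairing with \<open>e0\<close> eliminates \<open>H\<close>: the function
  \<open>h q v e0\<close> is linear in the coordinates of \<open>q\<close>, so its derivative is
  explicit.\<close>

lemma dh_e0:
  assumes "q \<in> Q"
  shows "dh q u v e0 = 2 * dr u * dt v + dt u * dr v"
proof -
  have *: "h q v e0 = 2 * dr q * dt v + dt q * dr v" if "q \<in> Q" for q
    by (simp add: h_def bilinear_rzero[OF H_bilinear[OF that]] algebra_simps)
  have "((\<lambda>q :: real \<times> real \<times> 'e. 2 * dr q * dt v + dt q * dr v) has_derivative (\<lambda>u. 2 * dr u * dt v + dt u * dr v)) (at q)"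
    by (auto intro!: derivative_eq_intros)
  then have "((\<lambda>q. h q v e0) has_derivative (\<lambda>u. 2 * dr u * dt v + dt u * dr v)) (at q)"
    by (rule has_derivative_transform_within_open[OF _ open_Q assms]) (simp add: *)
  from has_derivative_unique[OF h_has_derivative[OF assms] this] show ?thesis by (rule fun_cong)
qed

lemma line_has_derivative:
  assumes "(f has_derivative f') (at q)"
  shows "((\<lambda>s. f (q + s *\<^sub>R u)) has_derivative (\<lambda>s. s *\<^sub>R f' u)) (at 0)"
proof -
  have "((\<lambda>s. f (q + s *\<^sub>R u)) has_derivative (\<lambda>s. f' (s *\<^sub>R u))) (at 0)"
    by (rule has_derivative_compose[where f = "\<lambda>s. q + s *\<^sub>R u" and g = f])
      (use assms in \<open>auto intro!: derivative_eq_intros\<close>)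
  then show ?thesis by (simp add: linear_scale[OF has_derivative_linear[OF assms]])
qed

text \<open>\<open>H\<close> is constant along the \<open>t\<close>-lines, so only the visible
  factors \<open>t\<close> contribute. Restricting to such a line keeps derivatives of
  \<open>H\<close> out of the computation.\<close>

lemma dh_e0_direction:
  assumes "q \<in> Q"
  shows "dh q e0 v w = dr v * dt w + dt v * dr w + 2 * dt q * H (dr q) (base q) (base v) (base w)"
proof -
  have "((\<lambda>s. h (q + s *\<^sub>R e0) v w) has_derivative
      (\<lambda>s. s *\<^sub>R (dr v * dt w + dt v * dr w + 2 * dt q * H (dr q) (base q) (base v) (base w)))) (at 0)"
    unfolding h_def by (auto intro!: derivative_eq_intros simp: algebra_simps)
  from has_derivative_unique[OF line_has_derivative[OF h_has_derivative[OF assms]] this]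
  show ?thesis by (auto dest: fun_cong[of _ _ 1])
qed

text \<open>With \<open>e0\<close> as second argument, Koszul's formula contains only the explicit
  derivatives from \<open>dh_e0\<close> and \<open>dh_e0_direction\<close>. Multiplied by
  \<open>t\<close> and completed by the derivative \<open>dt u\<close> of that factor, the result
  says that the covariant derivative of \<open>t\<partial>\<^sub>t\<close> along \<open>u\<close> is
  \<open>u\<close>.\<close>

lemma \<Gamma>_e0:
  assumes "q \<in> Q"
  shows "\<Gamma> q u e0 = (1 / dt q) *\<^sub>R proj u" "\<Gamma> q e0 u = (1 / dt q) *\<^sub>R proj u"
proof -
  show 1: "\<Gamma> q u e0 = (1 / dt q) *\<^sub>R proj u"
  proof (rule h_eqI[OF assms])
    fix w
    have sym: "dh q u e0 w = dh q u w e0"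
      by (simp add: dh_def h_sym[OF assms, of e0] h_sym[OF assms, of _ w])
    have "2 * h q (\<Gamma> q u e0) w = 2 * dr u * dt w + 2 * dt q * H (dr q) (base q) (base u) (base w)"
      unfolding koszul[OF assms] sym dh_e0[OF assms] dh_e0_direction[OF assms] by simp
    also have "\<dots> = 2 * h q ((1 / dt q) *\<^sub>R proj u) w"
      using Q_pos[OF assms]
      by (simp add: h_def proj_def bilinear_lmul[OF H_bilinear[OF assms]] field_simps power2_eq_square)
    finally show "h q (\<Gamma> q u e0) w = h q ((1 / dt q) *\<^sub>R proj u) w" by simp
  qed
  then show "\<Gamma> q e0 u = (1 / dt q) *\<^sub>R proj u" using \<Gamma>_sym[OF assms] by simp
qed

section \<open>Dilations as homotheties\<close>

lemma h_dilate: "h (dilate k q) (dilate k v) (dilate k w) = k\<^sup>2 * h q v w"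
  by (simp add: h_def algebra_simps power2_eq_square)

lemma has_derivative_dilate: "(dilate k has_derivative dilate k) (at q)" for q :: "real \<times> real \<times> 'e"
  by (rule bounded_linear_imp_has_derivative) (use dilate_linear linear_conv_bounded_linear in blast)

lemma dh_dilate:
  assumes q: "q \<in> Q" and k: "k > 0"
  shows "dh (dilate k q) (dilate k u) (dilate k v) (dilate k w) = k\<^sup>2 * dh q u v w"
proof -
  have "((\<lambda>q. h (dilate k q) (dilate k v) (dilate k w)) has_derivative
      (\<lambda>u. dh (dilate k q) (dilate k u) (dilate k v) (dilate k w))) (at q)"
    by (rule has_derivative_compose[OF has_derivative_dilate h_has_derivative[OF Q_dilate[OF q k]]])
  moreover have "((\<lambda>q. h (dilate k q) (dilate k v) (dilate k w)) has_derivative (\<lambda>u. k\<^sup>2 * dh q u v w)) (at q)"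
    unfolding h_dilate by (rule has_derivative_mult_right[OF h_has_derivative[OF q]])
  ultimately show ?thesis using has_derivative_unique by (metis (no_types, lifting))
qed

text \<open>A dilation multiplies the metric by the constant \<open>k\<^sup>2\<close>; both sides of
  Koszul's formula scale by it, so it drops out of the connection.\<close>

lemma \<Gamma>_dilate:
  assumes q: "q \<in> Q" and k: "k > 0"
  shows "\<Gamma> (dilate k q) (dilate k u) (dilate k v) = dilate k (\<Gamma> q u v)"
proof (rule h_eqI[OF Q_dilate[OF q k]])
  fix w :: "real \<times> real \<times> 'e"
  define w' where "w' = dilate (1 / k) w"
  have w: "w = dilate k w'" using k by (simp add: w'_def dilate_def)
  have "2 * h (dilate k q) (\<Gamma> (dilate k q) (dilate k u) (dilate k v)) w = k\<^sup>2 * (2 * h q (\<Gamma> q u v) w')"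
    unfolding koszul[OF Q_dilate[OF q k]] koszul[OF q] w dh_dilate[OF q k] by (simp add: algebra_simps)
  then show "h (dilate k q) (\<Gamma> (dilate k q) (dilate k u) (dilate k v)) w = h (dilate k q) (dilate k (\<Gamma> q u v)) w"
    unfolding w h_dilate by simp
qed

section \<open>Curvature and the direction of the dilations\<close>

definition d\<Gamma> where "d\<Gamma> q u v w = frechet_derivative (\<lambda>q. \<Gamma> q v w) (at q) u"

lemma \<Gamma>_has_derivative: "q \<in> Q \<Longrightarrow> ((\<lambda>q. \<Gamma> q v w) has_derivative (\<lambda>u. d\<Gamma> q u v w)) (at q)"
  unfolding d\<Gamma>_def using smooth_on_has_derivative[OF \<Gamma>_smooth] by simp

abbreviation K where "K \<equiv> coordinate_curvature \<Gamma>"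

lemma K_eq: "K q u v w = d\<Gamma> q u v w - d\<Gamma> q v u w + \<Gamma> q u (\<Gamma> q v w) - \<Gamma> q v (\<Gamma> q u w)"
  by (simp add: coordinate_curvature_def d\<Gamma>_def)

lemma d\<Gamma>_e0:
  assumes "q \<in> Q"
  shows "d\<Gamma> q u v e0 = - (dt u / (dt q)\<^sup>2) *\<^sub>R proj v" "d\<Gamma> q u e0 v = - (dt u / (dt q)\<^sup>2) *\<^sub>R proj v"
proof -
  have *: "((\<lambda>q :: real \<times> real \<times> 'e. (1 / dt q) *\<^sub>R proj v) has_derivative (\<lambda>u. - (dt u / (dt q)\<^sup>2) *\<^sub>R proj v)) (at q)"
    using Q_pos[OF assms] by (auto intro!: derivative_eq_intros simp: power2_eq_square field_simps)
  have "((\<lambda>q. \<Gamma> q v e0) has_derivative (\<lambda>u. - (dt u / (dt q)\<^sup>2) *\<^sub>R proj v)) (at q)"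
    by (rule has_derivative_transform_within_open[OF * open_Q assms]) (simp add: \<Gamma>_e0)
  from has_derivative_unique[OF \<Gamma>_has_derivative[OF assms] this]
  show "d\<Gamma> q u v e0 = - (dt u / (dt q)\<^sup>2) *\<^sub>R proj v" by (rule fun_cong)
  have "((\<lambda>q. \<Gamma> q e0 v) has_derivative (\<lambda>u. - (dt u / (dt q)\<^sup>2) *\<^sub>R proj v)) (at q)"
    by (rule has_derivative_transform_within_open[OF * open_Q assms]) (simp add: \<Gamma>_e0)
  from has_derivative_unique[OF \<Gamma>_has_derivative[OF assms] this]
  show "d\<Gamma> q u e0 v = - (dt u / (dt q)\<^sup>2) *\<^sub>R proj v" by (rule fun_cong)
qed

lemma \<Gamma>_proj:
  assumes "q \<in> Q"
  shows "\<Gamma> q u (proj v) = \<Gamma> q u v - (dt v / dt q) *\<^sub>R proj u"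
  unfolding proj_eq[of v] bilinear_rsub[OF \<Gamma>_bilinear[OF assms]] bilinear_rmul[OF \<Gamma>_bilinear[OF assms]] \<Gamma>_e0[OF assms]
  by simp

text \<open>As the covariant derivative of \<open>t\<partial>\<^sub>t\<close> is the identity, the
  curvature applied to it is the torsion. In coordinates, the derivatives of the factor
  \<open>1 / dt q\<close> cancel the \<open>dt\<close> terms of \<open>\<Gamma>_proj\<close>, and
  symmetry of \<open>\<Gamma>\<close> removes the rest.\<close>

lemma K_e0_right:
  assumes "q \<in> Q"
  shows "K q u v e0 = 0"
  unfolding K_eq d\<Gamma>_e0[OF assms] \<Gamma>_e0[OF assms] bilinear_rmul[OF \<Gamma>_bilinear[OF assms]] \<Gamma>_proj[OF assms]
    \<Gamma>_sym[OF assms, of v u]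
  by (simp add: algebra_simps power2_eq_square)

text \<open>Differentiates the dilation equivariance of \<open>\<Gamma>\<close> with respect to the dilation factor.\<close>

lemma d\<Gamma>_e0_direction:
  assumes q: "q \<in> Q"
  shows "d\<Gamma> q e0 v w = (1 / dt q) *\<^sub>R
    (dt (\<Gamma> q v w) *\<^sub>R e0 - (1 / dt q) *\<^sub>R (dt v *\<^sub>R proj w + dt w *\<^sub>R proj v))"
proof -
  note t = Q_pos[OF q]
  define S where "S = {- dt q<..}"
  \<comment> \<open>A dilation by \<open>k = 1 + s / dt q\<close> stretches the \<open>dt\<close>
    component of vectors; \<open>c s = 1 / k - 1\<close> is the correction along \<open>e0\<close>
    after which the dilated vector is the given one.\<close>
  define c where "c s = 1 / (1 + s / dt q) - 1" for s
  have dilation: "\<Gamma> (q + s *\<^sub>R e0) v w = \<Gamma> q v w + (s / dt q * dt (\<Gamma> q v w)) *\<^sub>R e0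
      + (c s / dt q) *\<^sub>R (dt v *\<^sub>R proj w + dt w *\<^sub>R proj v)" if "s \<in> S" for s
  proof -
    define k where "k = 1 + s / dt q"
    have k: "k > 0" using that t by (simp add: k_def S_def field_simps)
    have qs: "q + s *\<^sub>R e0 = dilate k q" using t by (simp add: dilate_def k_def prod_eq_iff field_simps)
    have v: "v = dilate k (v + (c s * dt v) *\<^sub>R e0)" for v
      using k by (simp add: dilate_def c_def k_def[symmetric] prod_eq_iff field_simps)
    have p0: "proj e0 = 0" "proj (v + k *\<^sub>R e0) = proj v" for v k
      by (simp_all add: proj_def prod_eq_iff)
    have "\<Gamma> (q + s *\<^sub>R e0) v w = dilate k (\<Gamma> q (v + (c s * dt v) *\<^sub>R e0) (w + (c s * dt w) *\<^sub>R e0))"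
      unfolding qs by (subst v, subst (2) v, rule \<Gamma>_dilate[OF q k])
    also have "\<Gamma> q (v + (c s * dt v) *\<^sub>R e0) (w + (c s * dt w) *\<^sub>R e0)
        = \<Gamma> q v w + (c s / dt q) *\<^sub>R (dt v *\<^sub>R proj w + dt w *\<^sub>R proj v)"
      unfolding bilinear_ladd[OF \<Gamma>_bilinear[OF q]] bilinear_radd[OF \<Gamma>_bilinear[OF q]]
        bilinear_lmul[OF \<Gamma>_bilinear[OF q]] bilinear_rmul[OF \<Gamma>_bilinear[OF q]] \<Gamma>_e0[OF q] p0
      by (simp add: algebra_simps)
    also have "dilate k \<dots> = \<Gamma> q v w + (s / dt q * dt (\<Gamma> q v w)) *\<^sub>R e0
      + (c s / dt q) *\<^sub>R (dt v *\<^sub>R proj w + dt w *\<^sub>R proj v)"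
      by (simp add: dilate_def prod_eq_iff proj_def k_def algebra_simps)
    finally show ?thesis .
  qed
  have c: "(c has_derivative (\<lambda>s. - s / dt q)) (at 0)"
    unfolding c_def[abs_def] using t by (auto intro!: derivative_eq_intros simp: field_simps)
  have "((\<lambda>s. (s / dt q * dt (\<Gamma> q v w)) *\<^sub>R e0) has_derivative (\<lambda>s. (s / dt q * dt (\<Gamma> q v w)) *\<^sub>R e0)) (at 0)"
    by (rule has_derivative_scaleR_left[OF has_derivative_mult_left[OF
          bounded_linear_imp_has_derivative[OF bounded_linear_divide]]])
  from has_derivative_add[OF has_derivative_add[OF has_derivative_const this]
      has_derivative_scaleR_left[OF bounded_linear.has_derivative[OF bounded_linear_divide c]]]
  have "((\<lambda>s. \<Gamma> q v w + (s / dt q * dt (\<Gamma> q v w)) *\<^sub>R e0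
      + (c s / dt q) *\<^sub>R (dt v *\<^sub>R proj w + dt w *\<^sub>R proj v)) has_derivative
      (\<lambda>s. 0 + (s / dt q * dt (\<Gamma> q v w)) *\<^sub>R e0 + (- s / dt q / dt q) *\<^sub>R (dt v *\<^sub>R proj w + dt w *\<^sub>R proj v))) (at 0)" .
  then have "((\<lambda>s. \<Gamma> (q + s *\<^sub>R e0) v w) has_derivative
      (\<lambda>s. 0 + (s / dt q * dt (\<Gamma> q v w)) *\<^sub>R e0 + (- s / dt q / dt q) *\<^sub>R (dt v *\<^sub>R proj w + dt w *\<^sub>R proj v))) (at 0)"
    by (rule has_derivative_transform_within_open[of _ _ _ _ S]) (use t dilation in \<open>auto simp: S_def\<close>)
  from fun_cong[OF has_derivative_unique[OF line_has_derivative[OF \<Gamma>_has_derivative[OF q]] this], of 1]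
  show ?thesis by (simp add: algebra_simps)
qed

text \<open>Infinitesimally, a field X whose flow preserves the connection satisfies: second
  covariant derivative of X plus R(X, .) equals zero. For X = \<open>t\<partial>\<^sub>t\<close> the
  first covariant derivative is the identity, so the second one vanishes.
  \<open>d\<Gamma>_e0_direction\<close> supplies the invariance under the flow,
  \<open>\<Gamma>_e0\<close> and \<open>d\<Gamma>_e0\<close> the covariant derivatives.\<close>

lemma K_e0_left:
  assumes "q \<in> Q"
  shows "K q e0 v w = 0"
  unfolding K_eq d\<Gamma>_e0_direction[OF assms] d\<Gamma>_e0[OF assms] \<Gamma>_e0[OF assms]
    bilinear_rmul[OF \<Gamma>_bilinear[OF assms]] \<Gamma>_proj[OF assms] proj_eq[of "\<Gamma> q v w"]
  by (simp add: algebra_simps power2_eq_square)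

text \<open>
  \<open>\<theta>\<close> is the differential of \<open>r t\<^sup>2\<close>, whose Hessian is the ambient metric itself; the Ricci
  identity for \<open>\<theta>\<close> then says that \<open>\<theta>\<close> annihilates the curvature.
\<close>

definition \<theta> where "\<theta> q v = 2 * dr q * dt q * dt v + (dt q)\<^sup>2 * dr v" for q v :: "real \<times> real \<times> 'e"

definition d\<theta> where
  "d\<theta> q v w = 2 * (dr v * dt q + dr q * dt v) * dt w + 2 * dt q * dt v * dr w" for q v w :: "real \<times> real \<times> 'e"

text \<open>\<open>\<theta>\<close> is the metric dual of \<open>t\<partial>\<^sub>t\<close>, that
  is, \<open>\<theta> q x = dt q * h q x e0\<close>. Metric compatibility therefore moves
  \<open>\<Gamma>\<close> from \<open>w\<close> onto \<open>e0\<close>, where it is known.\<close>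

lemma hessian:
  assumes "q \<in> Q"
  shows "\<theta> q (\<Gamma> q v w) = d\<theta> q v w - h q v w"
proof -
  note bil = h_bilinear[OF assms]
  have he: "h q x e0 = 2 * dr q * dt x + dt q * dr x" for x
    by (simp add: h_def bilinear_rzero[OF H_bilinear[OF assms]] algebra_simps)
  have "\<theta> q (\<Gamma> q v w) = dt q * h q (\<Gamma> q v w) e0"
    by (simp add: he \<theta>_def algebra_simps power2_eq_square)
  also have "h q (\<Gamma> q v w) e0 = dh q v w e0 - h q w (\<Gamma> q v e0)" by (simp add: dh_def)
  also have "dt q * \<dots> = dt q * dh q v w e0 - h q w (proj v)"
    unfolding \<Gamma>_e0[OF assms] bilinear_rmul[OF bil] using Q_pos[OF assms] by (simp add: algebra_simps)
  also have "h q w (proj v) = h q v w - dt v * (2 * dr q * dt w + dt q * dr w)"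
    unfolding proj_eq bilinear_rsub[OF bil] bilinear_rmul[OF bil] he h_sym[OF assms, of w v] by simp
  finally show ?thesis unfolding dh_e0[OF assms] by (simp add: d\<theta>_def algebra_simps)
qed

text \<open>Both sides are the derivative along \<open>u\<close> of the Hessian identity. The
  explicit terms on the right are the third partial derivatives of \<open>r t\<^sup>2\<close> and
  hence symmetric in \<open>u\<close> and \<open>v\<close>.\<close>

lemma ricci_identity:
  assumes q: "q \<in> Q"
  shows "d\<theta> q u (\<Gamma> q v w) + \<theta> q (d\<Gamma> q u v w)
    = 2 * (dr v * dt u + dr u * dt v) * dt w + 2 * dt u * dt v * dr w - dh q u v w"
proof -
  have lin: "linear (\<theta> q)" for q by (rule linearI) (simp_all add: \<theta>_def algebra_simps)
  have der: "((\<lambda>q. \<theta> q v) has_derivative (\<lambda>u. d\<theta> q u v)) (at q)" for v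
    unfolding \<theta>_def d\<theta>_def by (auto intro!: derivative_eq_intros simp: algebra_simps power2_eq_square)
  have 1: "((\<lambda>q. \<theta> q (\<Gamma> q v w)) has_derivative (\<lambda>u. d\<theta> q u (\<Gamma> q v w) + \<theta> q (d\<Gamma> q u v w))) (at q)"
    by (rule has_derivative_linear_family[OF open_Q q lin der \<Gamma>_has_derivative[OF q]])
  have "((\<lambda>q. d\<theta> q v w) has_derivative
      (\<lambda>u. 2 * (dr v * dt u + dr u * dt v) * dt w + 2 * dt u * dt v * dr w)) (at q)"
    unfolding d\<theta>_def by (auto intro!: derivative_eq_intros simp: algebra_simps)
  from has_derivative_diff[OF this h_has_derivative[OF q]]
  have "((\<lambda>q. \<theta> q (\<Gamma> q v w)) has_derivative
      (\<lambda>u. 2 * (dr v * dt u + dr u * dt v) * dt w + 2 * dt u * dt v * dr w - dh q u v w)) (at q)"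
    by (rule has_derivative_transform_within_open[OF _ open_Q q]) (simp add: hessian)
  from fun_cong[OF has_derivative_unique[OF 1 this]] show ?thesis .
qed

text \<open>Antisymmetrizing in \<open>u\<close> and \<open>v\<close> removes the third derivatives
  of \<open>r t\<^sup>2\<close>. Since the Hessian is the metric, derivatives of \<open>h\<close>
  and products of \<open>h\<close> with \<open>\<Gamma>\<close> remain, and these cancel by
  compatibility.\<close>

lemma \<theta>_K:
  assumes q: "q \<in> Q"
  shows "\<theta> q (K q u v w) = 0"
proof -
  have lin: "linear (\<theta> q)" by (rule linearI) (simp_all add: \<theta>_def algebra_simps)
  have "\<theta> q (K q u v w) = (\<theta> q (d\<Gamma> q u v w) + \<theta> q (\<Gamma> q u (\<Gamma> q v w))) - (\<theta> q (d\<Gamma> q v u w) + \<theta> q (\<Gamma> q v (\<Gamma> q u w)))"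
    unfolding K_eq linear_diff[OF lin] linear_add[OF lin] by simp
  also have "\<dots> = dh q v u w - dh q u v w - h q u (\<Gamma> q v w) + h q v (\<Gamma> q u w)"
    using ricci_identity[OF q, of u v w] ricci_identity[OF q, of v u w]
    unfolding hessian[OF q] by (simp add: algebra_simps)
  also have "\<dots> = 0" by (simp add: dh_def \<Gamma>_sym[OF q, of v u])
  finally show ?thesis .
qed

lemma dr_K:
  assumes q: "q \<in> Q" and "dr q = 0"
  shows "dr (K q u v w) = 0"
  using \<theta>_K[OF q, of u v w] Q_pos[OF q] assms(2) by (simp add: \<theta>_def)

lemma K_dilate:
  assumes q: "q \<in> Q" and k: "k > 0"
  shows "K (dilate k q) (dilate k u) (dilate k v) (dilate k w) = dilate k (K q u v w)"
proof -
  have d: "d\<Gamma> (dilate k q) (dilate k u) (dilate k v) (dilate k w) = dilate k (d\<Gamma> q u v w)" for u v w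
  proof -
    have 1: "((\<lambda>q. \<Gamma> (dilate k q) (dilate k v) (dilate k w)) has_derivative
        (\<lambda>u. d\<Gamma> (dilate k q) (dilate k u) (dilate k v) (dilate k w))) (at q)"
      by (rule has_derivative_compose[OF has_derivative_dilate \<Gamma>_has_derivative[OF Q_dilate[OF q k]]])
    have "((\<lambda>q. dilate k (\<Gamma> q v w)) has_derivative (\<lambda>u. dilate k (d\<Gamma> q u v w))) (at q)"
      by (rule has_derivative_compose[OF \<Gamma>_has_derivative[OF q] has_derivative_dilate])
    then have "((\<lambda>q. \<Gamma> (dilate k q) (dilate k v) (dilate k w)) has_derivative (\<lambda>u. dilate k (d\<Gamma> q u v w))) (at q)"
      by (rule has_derivative_transform_within_open[OF _ open_Q q]) (simp add: \<Gamma>_dilate k)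
    from fun_cong[OF has_derivative_unique[OF 1 this]] show ?thesis .
  qed
  show ?thesis
    unfolding K_eq d \<Gamma>_dilate[OF q k] linear_diff[OF dilate_linear] linear_add[OF dilate_linear] ..
qed

section \<open>Multilinearity and trace of the curvature\<close>

lemma d\<Gamma>_linear:
  assumes q: "q \<in> Q"
  shows "linear (\<lambda>u. d\<Gamma> q u v w)" "linear (\<lambda>v. d\<Gamma> q u v w)" "linear (\<lambda>w. d\<Gamma> q u v w)"
proof -
  note bil = \<Gamma>_bilinear
  show "linear (\<lambda>u. d\<Gamma> q u v w)" by (rule has_derivative_linear[OF \<Gamma>_has_derivative[OF q]])
  have eq: "d\<Gamma> q u v w = d u" if "((\<lambda>q. \<Gamma> q v w) has_derivative d) (at q)" for v w d
    using fun_cong[OF has_derivative_unique[OF \<Gamma>_has_derivative[OF q] that]] .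
  note trafo = has_derivative_transform_within_open[OF _ open_Q q]
  note der = \<Gamma>_has_derivative[OF q]
  show "linear (\<lambda>v. d\<Gamma> q u v w)"
  proof (rule linearI)
    fix v v' and r :: real
    show "d\<Gamma> q u (v + v') w = d\<Gamma> q u v w + d\<Gamma> q u v' w"
      by (rule eq[OF trafo[OF has_derivative_add[OF der der]]]) (simp add: bilinear_ladd[OF bil])
    show "d\<Gamma> q u (r *\<^sub>R v) w = r *\<^sub>R d\<Gamma> q u v w"
      by (rule eq[OF trafo[OF has_derivative_scaleR_right[OF der]]]) (simp add: bilinear_lmul[OF bil])
  qed
  show "linear (\<lambda>w. d\<Gamma> q u v w)"
  proof (rule linearI)
    fix w w' and r :: real
    show "d\<Gamma> q u v (w + w') = d\<Gamma> q u v w + d\<Gamma> q u v w'"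
      by (rule eq[OF trafo[OF has_derivative_add[OF der der]]]) (simp add: bilinear_radd[OF bil])
    show "d\<Gamma> q u v (r *\<^sub>R w) = r *\<^sub>R d\<Gamma> q u v w"
      by (rule eq[OF trafo[OF has_derivative_scaleR_right[OF der]]]) (simp add: bilinear_rmul[OF bil])
  qed
qed

lemma K_linear:
  assumes q: "q \<in> Q"
  shows "linear (\<lambda>u. K q u v w)" "linear (\<lambda>v. K q u v w)" "linear (\<lambda>w. K q u v w)"
  unfolding K_eq
  by (rule linearI;
      simp add: linear_add[OF d\<Gamma>_linear(1)[OF q]] linear_add[OF d\<Gamma>_linear(2)[OF q]] linear_add[OF d\<Gamma>_linear(3)[OF q]]
        linear_scale[OF d\<Gamma>_linear(1)[OF q]] linear_scale[OF d\<Gamma>_linear(2)[OF q]] linear_scale[OF d\<Gamma>_linear(3)[OF q]]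
        bilinear_ladd[OF \<Gamma>_bilinear[OF q]] bilinear_radd[OF \<Gamma>_bilinear[OF q]]
        bilinear_lmul[OF \<Gamma>_bilinear[OF q]] bilinear_rmul[OF \<Gamma>_bilinear[OF q]] algebra_simps)+

lemma K_anti: "K q u v w = - K q v u w"
  by (simp add: K_eq)

text \<open>The image of a tangent vector under the differential of the immersion differs from the
  lift \<open>(0, 0, V)\<close> by a multiple of \<open>e0\<close>. Discarding such multiples
  removes the differential of the function defining the immersion from the tractor
  curvature.\<close>

lemma K_cong:
  assumes q: "q \<in> Q" and eq: "dr u = dr u'" "base u = base u'" "dr v = dr v'" "base v = base v'"
    "dr w = dr w'" "base w = base w'"
  shows "K q u v w = K q u' v' w'"
proof -
  have shift: "\<exists>k. x = y + k *\<^sub>R e0" if "dr x = dr y" "base x = base y" for x y :: "real \<times> real \<times> 'e"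
    using that by (intro exI[of _ "dt x - dt y"]) (simp add: prod_eq_iff)
  obtain k l m where s: "u = u' + k *\<^sub>R e0" "v = v' + l *\<^sub>R e0" "w = w' + m *\<^sub>R e0"
    using shift eq by metis
  have e0v: "K q u e0 w = 0" for u w using K_anti[of q u e0 w] K_e0_left[OF q] by simp
  show ?thesis
    unfolding s linear_add[OF K_linear(1)[OF q]] linear_add[OF K_linear(2)[OF q]] linear_add[OF K_linear(3)[OF q]]
      linear_scale[OF K_linear(1)[OF q]] linear_scale[OF K_linear(2)[OF q]] linear_scale[OF K_linear(3)[OF q]]
      K_e0_left[OF q] K_e0_right[OF q] e0v by simp
qed

text \<open>Dilations fix vectors of the form \<open>(0, 0, v)\<close> and leave base components
  alone, so equivariance becomes invariance here.\<close>

lemma base_K_dilate: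
  assumes q: "q \<in> Q" and k: "k > 0"
  shows "base (K (dilate k q) (0, 0, u) (0, 0, v) (0, 0, w)) = base (K q (0, 0, u) (0, 0, v) (0, 0, w))"
  using K_dilate[OF q k, of "(0, 0, u)" "(0, 0, v)" "(0, 0, w)"] by (simp add: dilate_def)

text \<open>
  The \<open>\<partial>\<^sub>t\<close> contribution vanishes by the degeneracy of the curvature in this direction, the
  \<open>\<partial>\<^sub>r\<close> contribution since the curvature has no \<open>\<partial>\<^sub>r\<close> component.
\<close>

lemma trace_K:
  assumes q: "q \<in> Q" and "dr q = 0"
  shows "lin_trace (\<lambda>u. K q u (0, 0, v) (0, 0, w)) = lin_trace (\<lambda>u. base (K q (0, 0, u) (0, 0, v) (0, 0, w)))"
proof -
  have "lin_trace (\<lambda>u. K q u (0, 0, v) (0, 0, w))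
      = K q (1, 0, 0) (0, 0, v) (0, 0, w) \<bullet> (1, 0, 0)
        + (K q (0, 1, 0) (0, 0, v) (0, 0, w) \<bullet> (0, 1, 0)
        + (\<Sum>b\<in>Basis. K q (0, 0, b) (0, 0, v) (0, 0, w) \<bullet> (0, 0, b)))"
    unfolding lin_trace_def sum_Basis_prod by (simp add: zero_prod_def)
  also have "K q (0, 1, 0) (0, 0, v) (0, 0, w) \<bullet> (0, 1, 0) = 0"
    using dr_K[OF assms, of "(0, 1, 0)" "(0, 0, v)" "(0, 0, w)"]
    by (simp add: inner_prod_def)
  also have "K q (1, 0, 0) (0, 0, v) (0, 0, w) = 0" by (rule K_e0_left[OF q])
  finally show ?thesis by (simp add: lin_trace_def inner_prod_def)
qed

end


section \<open>Product manifolds and the ambient manifold\<close>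

lemma chart_inv_product_chart:
  assumes "inj_on (snd c) (fst c)" "inj_on (snd d) (fst d)" "p \<in> snd c ` fst c" "q \<in> snd d ` fst d"
  shows "chart_inv (product_chart c d) (p, q) = (chart_inv c p, chart_inv d q)"
proof (rule inv_into_f_eq)
  show "inj_on (snd (product_chart c d)) (fst (product_chart c d))"
    using assms(1,2) by (auto simp: inj_on_def product_chart_def)
  show "(chart_inv c p, chart_inv d q) \<in> fst (product_chart c d)"
    using assms(3,4) by (simp add: product_chart_def inv_into_into)
  show "snd (product_chart c d) (chart_inv c p, chart_inv d q) = (p, q)"
    using assms(3,4) by (simp add: product_chart_def f_inv_into_f)
qed

lemma smooth_manifold_line:
  assumes "open I"
  shows "smooth_manifold (line_manifold I)"
proof -
  have inv: "inv_into I (\<lambda>s. s) s = s" if "s \<in> I" for s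
    using that by (intro inv_into_f_eq) (auto simp: inj_on_def)
  have img: "inv_into I (\<lambda>s. s) ` I = I" using inv by (auto simp: image_iff)
  have cont: "continuous_on I (inv_into I (\<lambda>s. s))"
    by (rule continuous_on_cong[THEN iffD1, OF refl _ continuous_on_id]) (simp add: inv)
  have smooth: "smooth_on I (inv_into I (\<lambda>s. s))"
    by (rule smooth_on_cong[OF assms _ smooth_on_bounded_linear[OF bounded_linear_ident]]) (simp add: inv)
  show ?thesis
    unfolding smooth_manifold_def line_manifold_def
    using assms smooth by (auto simp: homeomorphism_def inv img cont o_def)
qed

lemma (in smooth_mfd) chart_inj: "c \<in> atlas N \<Longrightarrow> inj_on (snd c) (fst c)"
  by (rule inj_on_inverseI[where g = "chart_inv c"]) (rule chart_inv_chart)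

lemma smooth_manifold_product:
  fixes M :: "('m::{t2_space,second_countable_topology}, 'e::euclidean_space) manifold"
    and N :: "('n::{t2_space,second_countable_topology}, 'f::euclidean_space) manifold"
  assumes "smooth_manifold M" "smooth_manifold N"
  shows "smooth_manifold (product_manifold M N)"
proof -
  interpret M: smooth_mfd M by unfold_locales fact
  interpret N: smooth_mfd N by unfold_locales fact
  have img: "snd (product_chart c d) ` (A \<times> B) = snd c ` A \<times> snd d ` B"
    for c :: "('m, 'e) chart" and d :: "('n, 'f) chart" and A B
    by (auto simp: product_chart_def image_iff)
  have inv: "chart_inv (product_chart c d) z = (chart_inv c (fst z), chart_inv d (snd z))"
    if "c \<in> atlas M" "d \<in> atlas N" "z \<in> snd c ` fst c \<times> snd d ` fst d" for c d z
    using chart_inv_product_chart[OF M.chart_inj N.chart_inj, of c d "fst z" "snd z"] that by auto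
  have dom: "fst (product_chart c d) = fst c \<times> fst d" for c :: "('m, 'e) chart" and d :: "('n, 'f) chart"
    by (simp add: product_chart_def)
  have chart: "open (fst e) \<and> fst e \<subseteq> points M \<times> points N \<and> open (snd e ` fst e) \<and>
      homeomorphism (fst e) (snd e ` fst e) (snd e) (chart_inv e)"
    if e: "e = product_chart c d" and cd: "c \<in> atlas M" "d \<in> atlas N" for e c d
  proof (intro conjI)
    show "open (fst e)" "fst e \<subseteq> points M \<times> points N" "open (snd e ` fst e)"
      using M.chart_open[OF cd(1)] N.chart_open[OF cd(2)] M.chart_points[OF cd(1)] N.chart_points[OF cd(2)]
        M.chart_image_open[OF cd(1)] N.chart_image_open[OF cd(2)]
      by (auto simp: e dom img open_Times)
    note hc = M.chart_homeo[OF cd(1)] and hd = N.chart_homeo[OF cd(2)]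
    show "homeomorphism (fst e) (snd e ` fst e) (snd e) (chart_inv e)"
      unfolding homeomorphism_def
    proof (intro conjI)
      show "\<forall>x\<in>fst e. chart_inv e (snd e x) = x"
        using M.chart_inj[OF cd(1)] N.chart_inj[OF cd(2)]
        by (intro ballI inv_into_f_f) (auto simp: e product_chart_def inj_on_def)
      show "\<forall>y\<in>snd e ` fst e. snd e (chart_inv e y) = y" by (simp add: f_inv_into_f)
      show "chart_inv e ` snd e ` fst e = fst e"
        using \<open>\<forall>x\<in>fst e. chart_inv e (snd e x) = x\<close> by (force simp: image_iff)
      show "continuous_on (fst e) (snd e)"
        using homeomorphism_cont1[OF hc] homeomorphism_cont1[OF hd]
        by (auto simp: e dom product_chart_def case_prod_beta
            intro!: continuous_on_Pair continuous_on_compose2[OF _ continuous_on_fst[OF continuous_on_id]]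
              continuous_on_compose2[OF _ continuous_on_snd[OF continuous_on_id]])
      have "continuous_on (snd e ` fst e) (\<lambda>z. (chart_inv c (fst z), chart_inv d (snd z)))"
        using homeomorphism_cont2[OF hc] homeomorphism_cont2[OF hd]
        by (auto simp: e dom img
            intro!: continuous_on_Pair continuous_on_compose2[OF _ continuous_on_fst[OF continuous_on_id]]
              continuous_on_compose2[OF _ continuous_on_snd[OF continuous_on_id]])
      then show "continuous_on (snd e ` fst e) (chart_inv e)"
      proof (rule continuous_on_cong[THEN iffD1, OF refl, rotated])
        fix z assume "z \<in> snd e ` fst e"
        then have "z \<in> snd c ` fst c \<times> snd d ` fst d" by (simp only: e dom img)
        from inv[OF cd this] show "(chart_inv c (fst z), chart_inv d (snd z)) = chart_inv e z"
          by (simp only: e)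
      qed
    qed simp
  qed
  have trans: "smooth_on (snd e ` (fst e \<inter> fst e')) (snd e' \<circ> chart_inv e)"
    if e: "e = product_chart c d" "e' = product_chart c' d'"
      and cd: "c \<in> atlas M" "d \<in> atlas N" "c' \<in> atlas M" "d' \<in> atlas N" for e e' c d c' d'
  proof (rule smooth_on_cong)
    let ?A = "snd c ` (fst c \<inter> fst c')" and ?B = "snd d ` (fst d \<inter> fst d')"
    have S: "snd e ` (fst e \<inter> fst e') = ?A \<times> ?B"
      unfolding e dom Times_Int_Times img ..
    have opA: "open ?A" by (rule M.overlap_image_open[OF cd(1,3)])
    have opB: "open ?B" by (rule N.overlap_image_open[OF cd(2,4)])
    show op: "open (snd e ` (fst e \<inter> fst e'))" unfolding S by (rule open_Times[OF opA opB])
    show "smooth_on (snd e ` (fst e \<inter> fst e')) (\<lambda>z. (snd c' (chart_inv c (fst z)), snd d' (chart_inv d (snd z))))"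
      unfolding S
    proof (rule smooth_on_Pair[OF open_Times[OF opA opB]])
      show "smooth_on (?A \<times> ?B) (\<lambda>z. snd c' (chart_inv c (fst z)))"
        by (rule smooth_on_compose[OF open_Times[OF opA opB] opA
              smooth_on_bounded_linear[OF bounded_linear_fst] M.transition_smooth[OF cd(1,3)]]) auto
      show "smooth_on (?A \<times> ?B) (\<lambda>z. snd d' (chart_inv d (snd z)))"
        by (rule smooth_on_compose[OF open_Times[OF opA opB] opB
              smooth_on_bounded_linear[OF bounded_linear_snd] N.transition_smooth[OF cd(2,4)]]) auto
    qed
    show "(snd c' (chart_inv c (fst z)), snd d' (chart_inv d (snd z))) = (snd e' \<circ> chart_inv e) z"
      if "z \<in> snd e ` (fst e \<inter> fst e')" for z
    proof -
      have "z \<in> snd c ` fst c \<times> snd d ` fst d" using that unfolding S by auto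
      from inv[OF cd(1,2) this] show ?thesis unfolding o_def e by (simp add: product_chart_def)
    qed
  qed
  show ?thesis
    unfolding smooth_manifold_def
  proof (intro conjI ballI)
    show "open (points (product_manifold M N))"
      by (simp add: product_manifold_def open_Times M.open_points N.open_points)
  next
    fix e assume "e \<in> atlas (product_manifold M N)"
    then obtain c d where e: "e = product_chart c d" "c \<in> atlas M" "d \<in> atlas N"
      by (auto simp: product_manifold_def)
    show "open (fst e)" "fst e \<subseteq> points (product_manifold M N)" "open (snd e ` fst e)"
      "homeomorphism (fst e) (snd e ` fst e) (snd e) (chart_inv e)"
      using chart[OF e] by (simp_all add: product_manifold_def)
    fix e' assume "e' \<in> atlas (product_manifold M N)"
    then obtain c' d' where e': "e' = product_chart c' d'" "c' \<in> atlas M" "d' \<in> atlas N"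
      by (auto simp: product_manifold_def)
    show "smooth_on (snd e ` (fst e \<inter> fst e')) (snd e' \<circ> chart_inv e)"
      by (rule trans[OF e(1) e'(1) e(2,3) e'(2,3)])
  next
    fix z assume "z \<in> points (product_manifold M N)"
    then obtain x y where z: "z = (x, y)" "x \<in> points M" "y \<in> points N"
      by (auto simp: product_manifold_def)
    then show "chart_at (product_manifold M N) z \<in> atlas (product_manifold M N)"
      using M.chart_at_atlas[OF z(2)] N.chart_at_atlas[OF z(3)]
      unfolding product_manifold_def z(1) manifold.simps case_prod_conv by blast
    show "z \<in> fst (chart_at (product_manifold M N) z)"
      using z M.chart_at_mem N.chart_at_mem by (auto simp: product_manifold_def dom)
  qed
qed

locale ambient = smooth_mfd M
  for M :: "('m::{t2_space,second_countable_topology}, 'e::euclidean_space) manifold" +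
  fixes \<delta> :: real
  assumes \<delta>_pos: "\<delta> > 0"
begin

abbreviation "amb \<equiv> ambient_manifold M \<delta>"

lemma smooth_manifold_amb: "smooth_manifold amb"
  unfolding ambient_manifold_def
  by (intro smooth_manifold_product smooth_manifold_line smooth_N open_greaterThan open_greaterThanLessThan)

sublocale A: smooth_mfd amb
  by unfold_locales (rule smooth_manifold_amb)

definition amb_chart :: "('m, 'e) chart \<Rightarrow> (real \<times> real \<times> 'm, real \<times> real \<times> 'e) chart" where
  "amb_chart c = product_chart ({0<..}, \<lambda>s. s) (product_chart ({-\<delta><..<\<delta>}, \<lambda>s. s) c)"

definition amb_domain :: "('m, 'e) chart \<Rightarrow> (real \<times> real \<times> 'e) set" where
  "amb_domain c = {0<..} \<times> {-\<delta><..<\<delta>} \<times> snd c ` fst c"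

lemma points_amb: "points amb = {0<..} \<times> {-\<delta><..<\<delta>} \<times> points M"
  by (simp add: ambient_manifold_def product_manifold_def line_manifold_def)

text \<open>Each interval factor carries a single chart, so ambient charts correspond to charts of
  \<open>M\<close>.\<close>

lemma atlas_amb: "atlas amb = amb_chart ` atlas M"
  unfolding ambient_manifold_def product_manifold_def line_manifold_def amb_chart_def manifold.simps
  by blast

lemma chart_at_amb: "chart_at amb (t, r, x) = amb_chart (chart_at M x)"
  by (simp add: ambient_manifold_def product_manifold_def line_manifold_def amb_chart_def)

lemma amb_chart_atlas: "c \<in> atlas M \<Longrightarrow> amb_chart c \<in> atlas amb"
  by (simp add: atlas_amb)

lemma fst_amb_chart: "fst (amb_chart c) = {0<..} \<times> {-\<delta><..<\<delta>} \<times> fst c"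
  by (simp add: amb_chart_def product_chart_def)

lemma snd_amb_chart: "snd (amb_chart c) = (\<lambda>(t, r, x). (t, r, snd c x))"
  by (auto simp: amb_chart_def product_chart_def)

lemma image_amb_chart: "snd (amb_chart c) ` fst (amb_chart c) = amb_domain c"
  by (force simp: fst_amb_chart snd_amb_chart amb_domain_def image_iff)

lemma open_amb_domain: "c \<in> atlas M \<Longrightarrow> open (amb_domain c)"
  using A.chart_image_open[OF amb_chart_atlas] by (simp add: image_amb_chart)

lemma amb_chart_inv:
  assumes "c \<in> atlas M" "q \<in> amb_domain c"
  shows "chart_inv (amb_chart c) q = (dt q, dr q, chart_inv c (base q))"
proof (rule inv_into_f_eq[OF A.chart_inj[OF amb_chart_atlas[OF assms(1)]]])
  show "(dt q, dr q, chart_inv c (base q)) \<in> fst (amb_chart c)"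
    using assms chart_inv_mem[OF assms(1)] by (auto simp: amb_domain_def fst_amb_chart)
  show "snd (amb_chart c) (dt q, dr q, chart_inv c (base q)) = q"
    using assms chart_chart_inv[OF assms(1)] by (auto simp: amb_domain_def snd_amb_chart)
qed

text \<open>The preferred chart at \<open>(t, r, x)\<close> extends the preferred chart at
  \<open>x\<close> by the identity, as \<open>amb_chart c\<close> extends \<open>c\<close>; the
  Jacobian between them is block diagonal with identity entries for \<open>t\<close> and
  \<open>r\<close>.\<close>

lemma comp_amb:
  assumes c: "c \<in> atlas M" "x \<in> fst c" and tr: "t > 0" "\<bar>r\<bar> < \<delta>"
  shows "A.comp (amb_chart c) (t, r, x) w = (dt w, dr w, comp c x (base w))"
proof -
  let ?d = "chart_at M x" and ?z = "(t, r, x)"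
  let ?q = "(t, r, snd ?d x)"
  have d: "?d \<in> atlas M" "x \<in> fst ?d"
    using chart_at_atlas'[OF c] chart_at_mem'[OF c] .
  define O' :: "(real \<times> real \<times> 'e) set" where "O' = {0<..} \<times> {-\<delta><..<\<delta>} \<times> snd ?d ` (fst ?d \<inter> fst c)"
  have op: "open O'" unfolding O'_def
    by (intro open_Times open_greaterThan open_greaterThanLessThan overlap_image_open d c)
  have mem: "?q \<in> O'" unfolding O'_def using tr c(2) d(2) by (auto simp: abs_less_iff)
  have bd: "(snd \<circ> snd has_derivative snd \<circ> snd) (at ?q)"
    by (auto intro!: derivative_eq_intros simp: o_def)
  have "((\<lambda>q :: real \<times> real \<times> 'e. snd c (chart_inv ?d ((snd \<circ> snd) q))) has_derivative
      (\<lambda>w. trans ?d c x ((snd \<circ> snd) w))) (at ?q)"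
    by (rule has_derivative_compose[OF bd]) (use trans_has_derivative[OF d(1) c(1) d(2) c(2)] in simp)
  then have "((\<lambda>q :: real \<times> real \<times> 'e. (dt q, dr q, snd c (chart_inv ?d (base q)))) has_derivative
      (\<lambda>w. (dt w, dr w, trans ?d c x (base w)))) (at ?q)"
    by (intro has_derivative_Pair) (auto intro!: derivative_eq_intros simp: o_def)
  then have "((\<lambda>q. snd (amb_chart c) (chart_inv (amb_chart ?d) q)) has_derivative
      (\<lambda>w. (dt w, dr w, trans ?d c x (base w)))) (at ?q)"
  proof (rule has_derivative_transform_within_open[OF _ op mem])
    fix q assume "q \<in> O'"
    then have "q \<in> amb_domain ?d" unfolding O'_def amb_domain_def by blast
    from amb_chart_inv[OF d(1) this]
    show "(dt q, dr q, snd c (chart_inv ?d (base q))) = snd (amb_chart c) (chart_inv (amb_chart ?d) q)"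
      by (simp add: snd_amb_chart)
  qed
  from frechet_derivative_eqI[OF this]
  have "frechet_derivative (\<lambda>q. snd (amb_chart c) (chart_inv (amb_chart ?d) q)) (at ?q) w
      = (dt w, dr w, comp c x (base w))"
    by (simp only: comp_eq_trans)
  moreover have "?q = snd (amb_chart ?d) ?z" by (simp add: snd_amb_chart)
  ultimately show ?thesis
    by (simp only: chart_components_def[of amb] chart_at_amb o_def)
qed

lemma inv_comp_amb:
  assumes c: "c \<in> atlas M" "x \<in> fst c" and tr: "t > 0" "\<bar>r\<bar> < \<delta>"
  shows "inv (A.comp (amb_chart c) (t, r, x)) w = (dt w, dr w, inv (comp c x) (base w))"
proof -
  have "(t, r, x) \<in> fst (amb_chart c)" using assms by (simp add: fst_amb_chart abs_less_iff)
  from A.inv_comp_comp[OF amb_chart_atlas[OF c(1)] this, of "(dt w, dr w, inv (comp c x) (base w))"]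
  show ?thesis by (simp add: comp_amb[OF assms] comp_inv[OF c])
qed

lemma coord_field_amb:
  assumes "c \<in> atlas M" "x \<in> fst c" "t > 0" "\<bar>r\<bar> < \<delta>"
  shows "A.coord_field (amb_chart c) w (t, r, x) = (dt w, dr w, coord_field c (base w) x)"
  by (simp add: A.coord_field_def coord_field_def inv_comp_amb[OF assms])

end

text \<open>Positive exactly on the open ball about \<open>a\<close> whose squared radius is
  \<open>e\<close>, which is why a radius enters squared where the function is used.\<close>

definition bump :: "real \<Rightarrow> 'f::euclidean_space \<Rightarrow> 'f \<Rightarrow> real" where
  "bump e a q = (let s = e - (q - a) \<bullet> (q - a) in if s > 0 then exp (- inverse s) else 0)"

lemma smooth_on_bump: "smooth_on UNIV (bump e a)"
proof -
  have flat: "smooth_on UNIV (\<lambda>s::real. if s > 0 then exp (- inverse s) else 0)"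
    unfolding smooth_on_def using Ck_on_flat[of _ 0, unfolded power_0 mult_1] by (rule allI)
  have id: "smooth_on UNIV (\<lambda>q. q + - a)"
    by (intro smooth_on_add smooth_on_const smooth_on_bounded_linear[OF bounded_linear_ident]) simp
  have "smooth_on UNIV (\<lambda>q. e + (- 1) * ((q + - a) \<bullet> (q + - a)))"
    by (intro smooth_on_add smooth_on_mult smooth_on_const smooth_on_bilinear[OF _ bounded_bilinear_inner id id]) simp_all
  then have "smooth_on UNIV (\<lambda>q. e - (q - a) \<bullet> (q - a))" by simp
  from smooth_on_compose[OF open_UNIV open_UNIV this flat subset_UNIV]
  show ?thesis unfolding bump_def[abs_def] Let_def .
qed

text \<open>Natural lifts come from fields on the whole manifold, while the trace condition concerns
  vectors at one point. A coordinate field cut off by a bump function and extended by zero connects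
  the two.\<close>

lemma (in smooth_mfd) global_field_exists:
  assumes "x \<in> points N"
  obtains X where "smooth_vector_field_on N (points N) X" "X x = v"
proof -
  interpret TN: vbundle N "tangent_bundle N" by (rule tangent_vbundle)
  define c where "c = chart_at N x"
  have c: "c \<in> atlas N" "x \<in> fst c" using assms chart_at_atlas chart_at_mem by (auto simp: c_def)
  obtain e where e: "e > 0" "cball (snd c x) e \<subseteq> snd c ` fst c"
    using open_contains_cball chart_image_open[OF c(1)] c(2) by (metis imageI)
  \<comment> \<open>Divided by the value at \<open>x\<close>, so that the cut-off leaves the vector
    at \<open>x\<close> unchanged.\<close>
  define \<eta> where "\<eta> y = bump (e\<^sup>2) (snd c x) (snd c y) / bump (e\<^sup>2) (snd c x) (snd c x)" for y
  define X where "X y = (if y \<in> fst c then \<eta> y *\<^sub>R coord_field c v y else 0)" for y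
  \<comment> \<open>Compact, hence closed because the space is Hausdorff. Its complement is an open
    set on which \<open>X\<close> is zero, and together with the chart domain it covers the
    manifold.\<close>
  define C where "C = chart_inv c ` cball (snd c x) e"
  have "compact C" unfolding C_def
    using homeomorphism_cont2[OF chart_homeo[OF c(1)]] e(2)
    by (intro compact_continuous_image compact_cball) (rule continuous_on_subset)
  then have op: "open (points N - C)" using open_points compact_imp_closed open_Diff by blast
  have C_sub: "C \<subseteq> fst c" unfolding C_def using chart_inv_mem[OF c(1)] e(2) by blast
  have "smooth_on (snd c ` fst c) (\<lambda>q. bump (e\<^sup>2) (snd c x) q * (1 / bump (e\<^sup>2) (snd c x) (snd c x)))"
    by (intro smooth_on_mult chart_image_open[OF c(1)] smooth_on_const smooth_on_subset[OF smooth_on_bump]) simp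
  then have "smooth_on (snd c ` fst c) (\<lambda>q. \<eta> (chart_inv c q))"
    by (rule smooth_on_cong[OF chart_image_open[OF c(1)], rotated]) (simp add: \<eta>_def f_inv_into_f)
  then have \<eta>: "smooth_map_on N (fst c) \<eta>"
    using smooth_map_on_chart[OF c(1) chart_open[OF c(1)] order_refl] by blast
  have "smooth_vector_field_on N (points N) X"
  proof (rule TN.section_local)
    fix y assume y: "y \<in> points N"
    show "\<exists>W. open W \<and> y \<in> W \<and> W \<subseteq> points N \<and> smooth_vector_field_on N W X"
    proof (cases "y \<in> fst c")
      case True
      have "smooth_vector_field_on N (fst c) X"
        by (rule TN.section_cong[OF chart_open[OF c(1)] _
              TN.section_scale[OF chart_open[OF c(1)] coord_field_smooth[OF c(1), of v] \<eta>]]) (simp add: X_def)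
      then show ?thesis using True chart_open[OF c(1)] chart_points[OF c(1)] by blast
    next
      case False
      have "X z = 0" if "z \<in> points N - C" for z
      proof (cases "z \<in> fst c")
        case True
        have "snd c z \<notin> cball (snd c x) e"
          using that True chart_inv_chart[OF c(1) True] unfolding C_def by (metis DiffD2 imageI)
        then have "e < norm (snd c z - snd c x)" by (simp add: dist_norm norm_minus_commute)
        then have "e\<^sup>2 < (norm (snd c z - snd c x))\<^sup>2" using e(1) by (intro power_strict_mono) auto
        then show ?thesis by (simp add: X_def \<eta>_def bump_def power2_norm_eq_inner)
      qed (simp add: X_def)
      then have "smooth_vector_field_on N (points N - C) X"
        by (intro TN.section_cong[OF op _ TN.section_zero[OF op]]) simp
      then show ?thesis using op y False C_sub by blast
    qed
  qed
  moreover have "X x = v"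
    using c e(1) comp_chart_at[OF assms] inv_comp_comp[OF c, of v]
    by (simp add: X_def \<eta>_def bump_def coord_field_def c_def)
  ultimately show ?thesis by (rule that)
qed


section \<open>The ambient curvature on the hypersurface\<close>

locale ambient_family = smooth_mfd M
  for M :: "('m::{t2_space,second_countable_topology}, 'e::euclidean_space) manifold" +
  fixes cs :: "('m \<Rightarrow> 'e \<Rightarrow> 'e \<Rightarrow> real) set"
    and g :: "'m \<Rightarrow> 'e \<Rightarrow> 'e \<Rightarrow> real"
    and \<gamma> :: "real \<Rightarrow> 'm \<Rightarrow> 'e \<Rightarrow> 'e"
    and \<delta> :: real
    and D :: "(real \<times> real \<times> 'm, real \<times> real \<times> 'e, real \<times> real \<times> 'e) connection"
  assumes conformal: "conformal_structure M cs" and g_cs: "g \<in> cs"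
    and admissible: "admissible_family M cs \<gamma>" and nonsingular: "nonsingular_within M \<gamma> \<delta>"
    and levi_civita: "levi_civita_connection (ambient_manifold M \<delta>) (ambient_metric g \<gamma>) D"

sublocale ambient_family \<subseteq> ambient M \<delta>
  using nonsingular by unfold_locales (simp add: nonsingular_within_def)

sublocale ambient_family \<subseteq> B: affine_connection "ambient_manifold M \<delta>" D
  using levi_civita by unfold_locales (simp add: levi_civita_connection_def)

context ambient_family
begin

abbreviation "amb_g \<equiv> ambient_metric g \<gamma>"

lemma riemannian_cs: "k \<in> cs \<Longrightarrow> riemannian_metric M k"
  using conformal unfolding conformal_structure_def by blast

lemma g_form: "smooth_symmetric_form M (tangent_bundle M) g"
  using riemannian_cs[OF g_cs] by (simp add: riemannian_metric_def)

lemma g_bilinear: "x \<in> points M \<Longrightarrow> bilinear (g x)"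
  and g_sym: "x \<in> points M \<Longrightarrow> g x v w = g x w v"
  using g_form unfolding smooth_symmetric_form_def by blast+

lemma g_pos: "x \<in> points M \<Longrightarrow> v \<noteq> 0 \<Longrightarrow> g x v v > 0"
  using riemannian_cs[OF g_cs] by (simp add: riemannian_metric_def)

lemma g_smooth:
  assumes "c \<in> atlas M"
  shows "smooth_map_on M (fst c) (\<lambda>x. g x (coord_field c v x) (coord_field c w x))"
  using bspec[OF conjunct2[OF g_form[unfolded smooth_symmetric_form_def]] tangent_triv[OF assms]]
  by (simp add: coord_field_def)

lemma \<gamma>_linear: "x \<in> points M \<Longrightarrow> linear (\<gamma> r x)"
  using admissible unfolding admissible_family_def by blast

lemma \<gamma>_selfadjoint: "x \<in> points M \<Longrightarrow> g x (\<gamma> r x v) w = g x v (\<gamma> r x w)"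
  using admissible g_cs unfolding admissible_family_def by blast

lemma \<gamma>_0: "x \<in> points M \<Longrightarrow> \<gamma> 0 x = id"
  using admissible unfolding admissible_family_def by blast

lemma \<gamma>_bij: "x \<in> points M \<Longrightarrow> \<bar>r\<bar> < \<delta> \<Longrightarrow> bij (\<gamma> r x)"
  using nonsingular unfolding nonsingular_within_def by blast

lemma \<gamma>_smooth:
  assumes c: "c \<in> atlas M"
  shows "smooth_on (UNIV \<times> snd c ` fst c)
    (\<lambda>q. comp c (chart_inv c (snd q)) (\<gamma> (fst q) (chart_inv c (snd q)) (coord_field c v (chart_inv c (snd q)))))"
proof -
  let ?L = "(UNIV, \<lambda>s. s) :: (real, real) chart"
  let ?d = "product_chart ?L c"
  let ?F = "\<lambda>(r, x). comp c x (\<gamma> r x (inv (comp c x) v))"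
  have op: "open (UNIV \<times> snd c ` fst c :: (real \<times> 'e) set)"
    by (intro open_Times open_UNIV chart_image_open[OF c])
  have "\<forall>(U, \<tau>)\<in>tangent_bundle M. \<forall>v. smooth_map_on (product_manifold (line_manifold UNIV) M) (UNIV \<times> U)
          (\<lambda>(r, x). \<tau> x (\<gamma> r x (inv (\<tau> x) v)))"
    using admissible unfolding admissible_family_def by blast
  from bspec[OF this tangent_triv[OF c]]
  have "smooth_map_on (product_manifold (line_manifold UNIV) M) (UNIV \<times> fst c) ?F" by simp
  moreover have "?d \<in> atlas (product_manifold (line_manifold UNIV) M)"
    using c unfolding product_manifold_def line_manifold_def manifold.simps by blast
  ultimately have "smooth_on (snd ?d ` ((UNIV \<times> fst c) \<inter> fst ?d)) (?F \<circ> chart_inv ?d)"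
    unfolding smooth_map_on_def by (rule bspec)
  moreover have "snd ?d ` ((UNIV \<times> fst c) \<inter> fst ?d) = UNIV \<times> snd c ` fst c"
    by (auto simp: product_chart_def image_iff)
  ultimately have "smooth_on (UNIV \<times> snd c ` fst c) (?F \<circ> chart_inv ?d)" by simp
  then show ?thesis
  proof (rule smooth_on_cong[OF op, rotated])
    fix q :: "real \<times> 'e" assume "q \<in> UNIV \<times> snd c ` fst c"
    then have q: "snd q \<in> snd c ` fst c" by auto
    have "chart_inv ?d (fst q, snd q) = (chart_inv ?L (fst q), chart_inv c (snd q))"
      by (rule chart_inv_product_chart[OF _ chart_inj[OF c] _ q]) (simp_all add: inj_on_def)
    then show "(?F \<circ> chart_inv ?d) q = comp c (chart_inv c (snd q))
        (\<gamma> (fst q) (chart_inv c (snd q)) (coord_field c v (chart_inv c (snd q))))"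
      by (simp add: coord_field_def inv_into_f_eq)
  qed
qed

definition H where
  "H c r p v w = g (chart_inv c p) (\<gamma> r (chart_inv c p) (coord_field c v (chart_inv c p))) (coord_field c w (chart_inv c p))"

text \<open>Smoothness is given separately for the components of \<open>\<gamma>\<close> and for the
  matrix of \<open>g\<close> in the coordinate frame; expanding the image under
  \<open>\<gamma>\<close> in this frame combines them into a sum of products.\<close>

lemma H_smooth:
  assumes c: "c \<in> atlas M"
  shows "smooth_on (amb_domain c) (\<lambda>q. H c (dr q) (base q) v w)"
proof -
  let ?I = "snd c ` fst c"
  note op = open_amb_domain[OF c]
  have 1: "smooth_on (amb_domain c) (\<lambda>q. comp c (chart_inv c (base q))
      (\<gamma> (dr q) (chart_inv c (base q)) (coord_field c v (chart_inv c (base q)))))"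
    by (rule smooth_on_compose[OF op _ smooth_on_bounded_linear[OF bounded_linear_snd] \<gamma>_smooth[OF c]])
      (auto simp: amb_domain_def intro!: open_Times chart_image_open[OF c])
  have 2: "smooth_on (amb_domain c) (\<lambda>q. g (chart_inv c (base q)) (coord_field c b (chart_inv c (base q)))
      (coord_field c w (chart_inv c (base q))))" for b
  proof (rule smooth_on_compose[OF op chart_image_open[OF c] smooth_on_bounded_linear])
    show "bounded_linear (\<lambda>q :: real \<times> real \<times> 'e. base q)"
      by (rule bounded_linear_compose[OF bounded_linear_snd bounded_linear_snd])
    show "smooth_on ?I (\<lambda>p. g (chart_inv c p) (coord_field c b (chart_inv c p)) (coord_field c w (chart_inv c p)))"
      using g_smooth[OF c, of b w] unfolding smooth_map_on_chart[OF c chart_open[OF c] order_refl] .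
  qed (auto simp: amb_domain_def)
  have "smooth_on (amb_domain c) (\<lambda>q. \<Sum>b\<in>Basis. (comp c (chart_inv c (base q))
      (\<gamma> (dr q) (chart_inv c (base q)) (coord_field c v (chart_inv c (base q)))) \<bullet> b) *
      g (chart_inv c (base q)) (coord_field c b (chart_inv c (base q))) (coord_field c w (chart_inv c (base q))))"
    by (intro smooth_on_sum[OF op] smooth_on_mult[OF op] smooth_on_inner_const[OF op] 1 2)
  then show ?thesis
  proof (rule smooth_on_cong[OF op, rotated])
    fix q assume "q \<in> amb_domain c"
    then have y: "chart_inv c (base q) \<in> fst c" (is "?y \<in> _")
      using chart_inv_mem[OF c] by (auto simp: amb_domain_def)
    let ?u = "\<gamma> (dr q) ?y (coord_field c v ?y)"
    have yp: "?y \<in> points M" by (rule chart_mem_points[OF c y])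
    have lin: "linear (\<lambda>x. g ?y (coord_field c x ?y) (coord_field c w ?y))"
      unfolding coord_field_def
      using linear_compose[OF linear_inv_comp[OF c y]] g_bilinear[OF yp]
      unfolding bilinear_def o_def by blast
    show "(\<Sum>b\<in>Basis. (comp c ?y ?u \<bullet> b) * g ?y (coord_field c b ?y) (coord_field c w ?y))
        = H c (dr q) (base q) v w"
      using linear_expand[OF lin, of "comp c ?y ?u"]
      by (simp add: H_def coord_field_def inv_comp_comp[OF c y])
  qed
qed

lemma amb_g_eq:
  "amb_g z v w = (fst (snd z) * dt v + fst z * dr v) * dt w + dt v * (fst (snd z) * dt w + fst z * dr w)
    + (fst z)\<^sup>2 * g (snd (snd z)) (\<gamma> (fst (snd z)) (snd (snd z)) (base v)) (base w)"
  by (simp add: ambient_metric_def case_prod_beta)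

lemma amb_g_chart:
  assumes c: "c \<in> atlas M" and q: "q \<in> amb_domain c"
  shows "amb_g (chart_inv (amb_chart c) q) (A.coord_field (amb_chart c) v (chart_inv (amb_chart c) q))
      (A.coord_field (amb_chart c) w (chart_inv (amb_chart c) q)) = ambient_form (H c) q v w"
proof -
  have "chart_inv c (base q) \<in> fst c" "dt q > 0" "\<bar>dr q\<bar> < \<delta>"
    using chart_inv_mem[OF c] q by (auto simp: amb_domain_def)
  then show ?thesis
    unfolding amb_chart_inv[OF c q]
    by (simp add: coord_field_amb[OF c] amb_g_eq ambient_form_def H_def)
qed

lemma amb_g_smooth:
  assumes c: "c \<in> atlas M"
  shows "smooth_map_on amb (fst (amb_chart c))
    (\<lambda>z. amb_g z (A.coord_field (amb_chart c) v z) (A.coord_field (amb_chart c) w z))"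
proof -
  note op = open_amb_domain[OF c]
  have t: "smooth_on (amb_domain c) dt" by (rule smooth_on_bounded_linear[OF bounded_linear_fst])
  have r: "smooth_on (amb_domain c) (\<lambda>q. dr q)"
    by (intro smooth_on_bounded_linear bounded_linear_compose[OF bounded_linear_fst bounded_linear_snd])
  have "smooth_on (amb_domain c) (\<lambda>q. ambient_form (H c) q v w)"
    unfolding ambient_form_def power2_eq_square
    by (intro smooth_on_add[OF op] smooth_on_mult[OF op] smooth_on_const t r H_smooth[OF c])
  then have "smooth_on (amb_domain c) (\<lambda>q. amb_g (chart_inv (amb_chart c) q)
      (A.coord_field (amb_chart c) v (chart_inv (amb_chart c) q))
      (A.coord_field (amb_chart c) w (chart_inv (amb_chart c) q)))"
    by (rule smooth_on_cong[OF op, rotated]) (simp add: amb_g_chart[OF c])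
  then show ?thesis
    unfolding A.smooth_map_on_chart[OF amb_chart_atlas[OF c] A.chart_open[OF amb_chart_atlas[OF c]] order_refl]
      image_amb_chart .
qed

lemma amb_chart_mem: "q \<in> amb_domain c \<Longrightarrow> \<exists>z\<in>fst (amb_chart c). q = snd (amb_chart c) z"
  using image_amb_chart[of c] by blast

text \<open>Makes the coordinate computations available for the Levi-Civita connection. The domain
  is stable under dilations because its \<open>t\<close> factor is the whole half-line.\<close>

lemma ambient_chart_christoffel:
  assumes c: "c \<in> atlas M"
  shows "ambient_chart (amb_domain c) (H c) (B.christoffel (amb_chart c))"
proof
  note ac = amb_chart_atlas[OF c]
  show "open (amb_domain c)" by (rule open_amb_domain[OF c])
  fix q assume q: "q \<in> amb_domain c"
  then show "dt q > 0" by (auto simp: amb_domain_def)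
  show "dilate k q \<in> amb_domain c" if "k > 0" for k
    using q that by (auto simp: amb_domain_def dilate_def)
  define y where "y = chart_inv c (base q)"
  have y: "y \<in> fst c" and r: "\<bar>dr q\<bar> < \<delta>"
    using chart_inv_mem[OF c] q by (auto simp: amb_domain_def y_def)
  note yp = chart_mem_points[OF c y]
  note cf = linear_inv_comp[OF c y]
  show "bilinear (H c (dr q) (base q))"
    unfolding bilinear_def H_def y_def[symmetric] coord_field_def
    by (intro conjI allI linearI)
      (simp_all add: linear_add[OF cf] linear_scale[OF cf] linear_add[OF \<gamma>_linear[OF yp]] linear_scale[OF \<gamma>_linear[OF yp]]
        bilinear_ladd[OF g_bilinear[OF yp]] bilinear_radd[OF g_bilinear[OF yp]]
        bilinear_lmul[OF g_bilinear[OF yp]] bilinear_rmul[OF g_bilinear[OF yp]])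
  show "H c (dr q) (base q) v w = H c (dr q) (base q) w v" for v w
    unfolding H_def y_def[symmetric] by (subst \<gamma>_selfadjoint[OF yp]) (rule g_sym[OF yp])
  obtain z where z: "z \<in> fst (amb_chart c)" "q = snd (amb_chart c) z"
    using amb_chart_mem[OF q] by blast
  show "bilinear (B.christoffel (amb_chart c) q)"
    unfolding z(2) by (rule B.christoffel_bilinear[OF ac z(1)])
  have "torsion_free amb D" using levi_civita by (simp add: levi_civita_connection_def)
  from B.christoffel_symmetric[OF this ac z(1)]
  show "B.christoffel (amb_chart c) q v w = B.christoffel (amb_chart c) q w v" for v w
    unfolding z(2) .
  have metric: "metric_connection amb (tangent_bundle amb) amb_g D"
    using levi_civita by (simp add: levi_civita_connection_def)
  note compat = B.christoffel_metric[OF metric ac z(1) amb_g_smooth[OF c], folded z(2), unfolded amb_g_chart[OF c q]]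
  show "((\<lambda>q. ambient_form (H c) q v w) has_derivative
      (\<lambda>u. ambient_form (H c) q (B.christoffel (amb_chart c) q u v) w
        + ambient_form (H c) q v (B.christoffel (amb_chart c) q u w))) (at q)" for v w
    by (rule has_derivative_transform_within_open[OF compat open_amb_domain[OF c] q]) (rule amb_g_chart[OF c])
next
  fix q x assume q: "q \<in> amb_domain c" and x: "\<And>y. H c (dr q) (base q) x y = 0"
  define y where "y = chart_inv c (base q)"
  have y: "y \<in> fst c" and r: "\<bar>dr q\<bar> < \<delta>"
    using chart_inv_mem[OF c] q by (auto simp: amb_domain_def y_def)
  note yp = chart_mem_points[OF c y]
  let ?u = "\<gamma> (dr q) y (coord_field c x y)"
  \<comment> \<open>The test vector is the image under \<open>\<gamma>\<close> itself: definiteness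
    of \<open>g\<close> then kills this image, and bijectivity of \<open>\<gamma>\<close> for
    \<open>\<bar>r\<bar> < \<delta>\<close> kills the vector.\<close>
  have "g y ?u ?u = 0"
    using x[of "comp c y ?u"] by (simp add: H_def y_def[symmetric] coord_field_def inv_comp_comp[OF c y])
  then have "?u = 0" using g_pos[OF yp, of ?u] by force
  then have "coord_field c x y = 0"
    using injD[OF bij_is_inj[OF \<gamma>_bij[OF yp r]], of "coord_field c x y" 0] linear_0[OF \<gamma>_linear[OF yp]] by simp
  then show "x = 0"
    using comp_coord_field[OF c y, of x] linear_0[OF linear_comp[OF c y]] by simp
next
  show "smooth_on (amb_domain c) (\<lambda>q. B.christoffel (amb_chart c) q v w)" for v w
    using B.christoffel_smooth[OF amb_chart_atlas[OF c]] unfolding image_amb_chart .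
qed

text \<open>
  The part of the ambient curvature at \<open>r = 0\<close> that is tangent to the base; by the dilation
  invariance of the curvature it may be evaluated at \<open>t = 1\<close>.
\<close>

definition base_curvature :: "'m \<Rightarrow> 'e \<Rightarrow> 'e \<Rightarrow> 'e \<Rightarrow> 'e" where
  "base_curvature x u v w = base (coordinate_curvature (B.christoffel (amb_chart (chart_at M x)))
     (1, 0, snd (chart_at M x) x) (0, 0, u) (0, 0, v) (0, 0, w))"

context
  fixes x :: 'm and t :: real assumes x: "x \<in> points M" and t: "t > 0"
begin

interpretation K: ambient_chart "amb_domain (chart_at M x)" "H (chart_at M x)" "B.christoffel (amb_chart (chart_at M x))"
  by (rule ambient_chart_christoffel[OF chart_at_atlas[OF x]])

text \<open>In the ambient chart built on the preferred chart at \<open>x\<close>, the components of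
  a vector at \<open>(t, 0, x)\<close> are the vector itself, so no Jacobian appears.\<close>

lemma amb_curvature_coordinates:
  "curvature amb (tangent_bundle amb) D (t, 0, x) u v w
    = K.K (t, 0, snd (chart_at M x) x) u v w"
proof -
  let ?c = "chart_at M x"
  have z: "(t, 0, x) \<in> fst (amb_chart ?c)" "(t, 0, x) \<in> points amb"
    using t x \<delta>_pos chart_at_mem by (auto simp: fst_amb_chart points_amb)
  have comp: "A.comp (amb_chart ?c) (t, 0, x) v = v" for v
    using A.comp_chart_at[OF z(2)] by (simp add: chart_at_amb)
  show ?thesis
    using B.curvature_chart[OF amb_chart_atlas[OF chart_at_atlas[OF x]] z(1), of u v w]
    by (simp add: comp snd_amb_chart)
qed

lemma base_coordinates: "(t, 0, snd (chart_at M x) x) \<in> amb_domain (chart_at M x)"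
  using t x \<delta>_pos chart_at_mem by (auto simp: amb_domain_def)

lemma base_curvature_eq:
  "base (K.K (t, 0, snd (chart_at M x) x)
      (0, 0, u) (0, 0, v) (0, 0, w)) = base_curvature x u v w"
proof -
  have "dilate (1 / t) (t, 0, snd (chart_at M x) x) = (1, 0, snd (chart_at M x) x)"
    using t by (simp add: dilate_def)
  then show ?thesis
    using K.base_K_dilate[OF base_coordinates, of "1 / t"] t by (simp add: base_curvature_def)
qed

lemma amb_curvature_base:
  assumes "dr u = 0" "dr v = 0" "dr w = 0"
  shows "dr (curvature amb (tangent_bundle amb) D (t, 0, x) u v w) = 0"
    "base (curvature amb (tangent_bundle amb) D (t, 0, x) u v w) = base_curvature x (base u) (base v) (base w)"
proof -
  show "dr (curvature amb (tangent_bundle amb) D (t, 0, x) u v w) = 0"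
    unfolding amb_curvature_coordinates by (rule K.dr_K[OF base_coordinates]) simp
  have "K.K (t, 0, snd (chart_at M x) x) u v w
      = K.K (t, 0, snd (chart_at M x) x)
          (0, 0, base u) (0, 0, base v) (0, 0, base w)"
    by (rule K.K_cong[OF base_coordinates]) (simp_all add: assms)
  then show "base (curvature amb (tangent_bundle amb) D (t, 0, x) u v w) = base_curvature x (base u) (base v) (base w)"
    unfolding amb_curvature_coordinates by (simp add: base_curvature_eq)
qed

lemma amb_curvature_e0: "curvature amb (tangent_bundle amb) D (t, 0, x) u v (k, 0, 0) = 0"
proof -
  have "(k, 0, 0) = k *\<^sub>R K.e0" by simp
  then show ?thesis
    unfolding amb_curvature_coordinates
    using linear_scale[OF K.K_linear(3)[OF base_coordinates], of u v k K.e0] K.K_e0_right[OF base_coordinates]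
    by simp
qed

lemma amb_curvature_linear: "linear (\<lambda>w. curvature amb (tangent_bundle amb) D (t, 0, x) u v w)"
  unfolding amb_curvature_coordinates by (rule K.K_linear(3)[OF base_coordinates])

lemma ricci_base: "ricci amb D (t, 0, x) (0, 0, v) (0, 0, w) = lin_trace (\<lambda>u. base_curvature x u v w)"
  unfolding ricci_def amb_curvature_coordinates
  by (subst K.trace_K[OF base_coordinates]) (simp_all add: base_curvature_eq)

end

text \<open>The right-hand side of \<open>ricci_base\<close> does not contain \<open>t\<close>:
  testing at \<open>t = 1\<close> suffices in one direction, and every \<open>t\<close> is reached
  in the other.\<close>

lemma ricci_natural_lifts:
  "(\<forall>V\<in>natural_lifts M. \<forall>W\<in>natural_lifts M. \<forall>(t, r, x)\<in>points amb.
      r = 0 \<longrightarrow> ricci amb D (t, r, x) (V (t, r, x)) (W (t, r, x)) = 0)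
    \<longleftrightarrow> (\<forall>x\<in>points M. \<forall>v w. lin_trace (\<lambda>u. base_curvature x u v w) = 0)" (is "?L \<longleftrightarrow> ?R")
proof
  assume L: ?L
  show ?R
  proof (intro ballI allI)
    fix x v w assume x: "x \<in> points M"
    obtain X where X: "smooth_vector_field_on M (points M) X" "X x = v" by (rule global_field_exists[OF x])
    obtain Y where Y: "smooth_vector_field_on M (points M) Y" "Y x = w" by (rule global_field_exists[OF x])
    define V :: "real \<times> real \<times> 'm \<Rightarrow> real \<times> real \<times> 'e" where "V = (\<lambda>(t, r, x). (0, 0, X x))"
    define W :: "real \<times> real \<times> 'm \<Rightarrow> real \<times> real \<times> 'e" where "W = (\<lambda>(t, r, x). (0, 0, Y x))"
    have VW: "V \<in> natural_lifts M" "W \<in> natural_lifts M"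
      unfolding natural_lifts_def V_def W_def using X Y by blast+
    have "(1, 0, x) \<in> points amb" using x \<delta>_pos by (simp add: points_amb)
    from bspec[OF bspec[OF bspec[OF L VW(1)] VW(2)] this]
    have "ricci amb D (1, 0, x) (V (1, 0, x)) (W (1, 0, x)) = 0" by simp
    then show "lin_trace (\<lambda>u. base_curvature x u v w) = 0"
      using ricci_base[OF x, of 1 v w] X(2) Y(2) by (simp add: V_def W_def)
  qed
next
  assume R: ?R
  show ?L
  proof (intro ballI, clarify)
    fix V W t x assume "V \<in> natural_lifts M" "W \<in> natural_lifts M" and z: "(t, 0 :: real, x) \<in> points amb"
    then obtain X Y where "V (t, 0, x) = (0, 0, X x)" "W (t, 0, x) = (0, 0, Y x)"
      unfolding natural_lifts_def by auto
    moreover have "x \<in> points M" "t > 0" using z by (auto simp: points_amb)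
    ultimately show "ricci amb D (t, 0, x) (V (t, 0, x)) (W (t, 0, x)) = 0"
      using R by (simp add: ricci_base)
  qed
qed

end


section \<open>The pullback bundle\<close>

locale ambient_tractor = ambient_family M cs g \<gamma> \<delta> D
  for M :: "('m::{t2_space,second_countable_topology}, 'e::euclidean_space) manifold"
    and cs g \<gamma> \<delta> D +
  fixes u :: "'m \<Rightarrow> real" and Du :: "('m, 'e, real \<times> real \<times> 'e) connection"
  assumes u_smooth: "smooth_map_on M (points M) u"
    and pullback: "pullback_connection M (ambient_manifold M \<delta>) (ambient_immersion u)
      (tangent_bundle (ambient_manifold M \<delta>)) D Du"
begin

abbreviation "\<Psi> \<equiv> ambient_immersion u"
abbreviation "E \<equiv> pullback_bundle M \<Psi> (tangent_bundle amb)"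
abbreviation \<xi> :: "'m \<Rightarrow> real \<times> real \<times> 'e" where "\<xi> \<equiv> ambient_normal u"

lemma \<Psi>_eq: "\<Psi> x = (exp (u x), 0, x)" by (rule ambient_immersion_def)
lemma \<xi>_eq: "\<xi> x = (exp (u x), 0, 0)" by (simp add: ambient_normal_def)

lemma \<Psi>_mem_points: "x \<in> points M \<Longrightarrow> \<Psi> x \<in> points amb"
  using \<delta>_pos by (simp add: \<Psi>_eq points_amb)

lemma \<Psi>_mem: "\<Psi> x \<in> fst (amb_chart c) \<longleftrightarrow> x \<in> fst c"
  using \<delta>_pos by (simp add: \<Psi>_eq fst_amb_chart)

lemma comp_\<Psi>: "c \<in> atlas M \<Longrightarrow> x \<in> fst c \<Longrightarrow> A.comp (amb_chart c) (\<Psi> x) w = (dt w, dr w, comp c x (base w))"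
  using \<delta>_pos by (simp add: \<Psi>_eq comp_amb)

lemma inv_comp_\<Psi>:
  "c \<in> atlas M \<Longrightarrow> x \<in> fst c \<Longrightarrow> inv (A.comp (amb_chart c) (\<Psi> x)) w = (dt w, dr w, inv (comp c x) (base w))"
  using \<delta>_pos by (simp add: \<Psi>_eq inv_comp_amb)

lemma E_eq: "E = (\<lambda>c. (fst c, \<lambda>x. A.comp (amb_chart c) (\<Psi> x))) ` atlas M"
proof -
  have "{x \<in> points M. \<Psi> x \<in> fst (amb_chart c)} = fst c" if "c \<in> atlas M" for c
    using chart_points[OF that] by (auto simp: \<Psi>_mem)
  then show ?thesis
    by (simp add: pullback_bundle_def tangent_bundle_def atlas_amb image_image cong: image_cong)
qed

lemma E_triv: "c \<in> atlas M \<Longrightarrow> (fst c, \<lambda>x. A.comp (amb_chart c) (\<Psi> x)) \<in> E"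
  unfolding E_eq by (rule imageI)

lemma E_cases:
  assumes "(U, \<tau>) \<in> E"
  obtains c where "c \<in> atlas M" "U = fst c" "\<tau> = (\<lambda>x. A.comp (amb_chart c) (\<Psi> x))"
  using assms unfolding E_eq by blast

lemma vector_bundle_E: "vector_bundle M E"
  unfolding vector_bundle_def
proof (intro conjI)
  show "\<forall>(U, \<tau>)\<in>E. open U \<and> U \<subseteq> points M \<and> (\<forall>x\<in>U. linear (\<tau> x) \<and> bij (\<tau> x))"
  proof clarify
    fix U \<tau> assume "(U, \<tau>) \<in> E"
    then obtain c where c: "c \<in> atlas M" "U = fst c" "\<tau> = (\<lambda>x. A.comp (amb_chart c) (\<Psi> x))" by (rule E_cases)
    show "open U \<and> U \<subseteq> points M \<and> (\<forall>x\<in>U. linear (\<tau> x) \<and> bij (\<tau> x))"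
      unfolding c(2,3) using chart_open[OF c(1)] chart_points[OF c(1)] amb_chart_atlas[OF c(1)]
      by (simp add: A.linear_comp A.bij_comp \<Psi>_mem)
  qed
  show "points M \<subseteq> (\<Union>(U, \<tau>)\<in>E. U)"
    unfolding E_eq using chart_at_atlas chart_at_mem by auto
  show "\<forall>(U, \<tau>)\<in>E. \<forall>(W, \<sigma>)\<in>E. \<forall>v. smooth_map_on M (U \<inter> W) (\<lambda>x. \<sigma> x (inv (\<tau> x) v))"
  proof clarify
    fix U \<tau> W \<sigma> and v :: "real \<times> real \<times> 'e"
    assume "(U, \<tau>) \<in> E" "(W, \<sigma>) \<in> E"
    then obtain c d where c: "c \<in> atlas M" "U = fst c" "\<tau> = (\<lambda>x. A.comp (amb_chart c) (\<Psi> x))"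
      and d: "d \<in> atlas M" "W = fst d" "\<sigma> = (\<lambda>x. A.comp (amb_chart d) (\<Psi> x))" by (metis E_cases)
    have op: "open (fst c \<inter> fst d)" using chart_open c(1) d(1) by blast
    have "smooth_map_on M (fst c \<inter> fst d) (\<lambda>x. (dt v, dr v, comp d x (inv (comp c x) (base v))))"
      by (intro smooth_map_on_Pair[OF op] smooth_map_on_const
          vbundle.triv_change[OF tangent_vbundle tangent_triv[OF c(1)] tangent_triv[OF d(1)]])
    then show "smooth_map_on M (U \<inter> W) (\<lambda>x. \<sigma> x (inv (\<tau> x) v))"
      unfolding c(2,3) d(2,3)
      by (rule smooth_map_on_cong[OF op, rotated]) (simp add: comp_\<Psi>[OF d(1)] inv_comp_\<Psi>[OF c(1)])
  qed
qed

sublocale P: lconnection M E Du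
  using smooth_mfd_axioms vector_bundle_E pullback
  by (simp add: lconnection_def vbundle_def vbundle_axioms_def lconnection_axioms_def pullback_connection_def)

lemma section_chart:
  assumes "smooth_section_on M E U s" "c \<in> atlas M"
  shows "smooth_map_on M (U \<inter> fst c) (\<lambda>x. A.comp (amb_chart c) (\<Psi> x) (s x))"
  using bspec[OF assms(1)[unfolded smooth_section_on_def] E_triv[OF assms(2)]] by simp

lemma exp_u_smooth: "smooth_map_on M (points M) (\<lambda>x. exp (k * u x))"
  by (rule smooth_map_on_compose[OF open_points open_UNIV _ smooth_on_exp])
    (auto intro!: smooth_map_on_mult open_points u_smooth smooth_map_on_const)

lemma \<xi>_smooth: "smooth_section_on M E (points M) \<xi>"
  unfolding smooth_section_on_def
proof clarify
  fix U \<tau> assume "(U, \<tau>) \<in> E"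
  then obtain c where c: "c \<in> atlas M" "U = fst c" "\<tau> = (\<lambda>x. A.comp (amb_chart c) (\<Psi> x))" by (rule E_cases)
  have op: "open (points M \<inter> fst c)" using open_points chart_open[OF c(1)] by blast
  have "smooth_map_on M (points M \<inter> fst c) (\<lambda>x. (exp (1 * u x), 0 :: real, 0 :: 'e))"
    by (intro smooth_map_on_Pair[OF op] smooth_map_on_const smooth_map_on_subset[OF exp_u_smooth]) simp
  then show "smooth_map_on M (points M \<inter> U) (\<lambda>x. \<tau> x (\<xi> x))"
    unfolding c(2,3)
    by (rule smooth_map_on_cong[OF op, rotated]) (simp add: comp_\<Psi>[OF c(1)] \<xi>_eq linear_0[OF linear_comp[OF c(1)]])
qed

definition d\<Psi> :: "'m \<Rightarrow> 'e \<Rightarrow> real \<times> real \<times> 'e" where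
  "d\<Psi> x V = (exp (u x) * differential M u x V, 0, V)"

lemma u_derivative:
  assumes "x \<in> points M"
  shows "((\<lambda>q. u (chart_inv (chart_at M x) q)) has_derivative differential M u x) (at (snd (chart_at M x) x))"
  by (rule differential_has_derivative[OF u_smooth open_points assms assms])

lemma \<Psi>_derivative:
  assumes x: "x \<in> points M"
  shows "((\<lambda>q. snd (amb_chart (chart_at M x)) (\<Psi> (chart_inv (chart_at M x) q))) has_derivative d\<Psi> x)
    (at (snd (chart_at M x) x))"
proof -
  let ?c = "chart_at M x"
  have c: "?c \<in> atlas M" "x \<in> fst ?c" using x chart_at_atlas chart_at_mem by auto
  have mem: "snd ?c x \<in> snd ?c ` fst ?c" using c by blast
  have "((\<lambda>q. exp (u (chart_inv ?c q))) has_derivative (\<lambda>v. exp (u x) * differential M u x v)) (at (snd ?c x))"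
    using has_derivative_exp[OF u_derivative[OF x]] by (simp add: chart_inv_chart[OF c] mult.commute)
  then have "((\<lambda>q. (exp (u (chart_inv ?c q)), 0 :: real, q)) has_derivative d\<Psi> x) (at (snd ?c x))"
    unfolding d\<Psi>_def by (intro has_derivative_Pair has_derivative_const has_derivative_ident)
  then show ?thesis
    by (rule has_derivative_transform_within_open[OF _ chart_image_open[OF c(1)] mem])
      (auto simp: \<Psi>_eq snd_amb_chart chart_inv_chart[OF c(1)])
qed

lemma tangent_map_\<Psi>:
  assumes x: "x \<in> points M"
  shows "tangent_map M amb \<Psi> x V = d\<Psi> x V"
  using frechet_derivative_eqI[OF \<Psi>_derivative[OF x]]
  by (simp add: tangent_map_def differential_def o_def \<Psi>_eq[of x] chart_at_amb)

lemma chain_\<Psi>: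
  assumes x: "x \<in> points M" and F: "smooth_map_on amb W F" "open W" "\<Psi> x \<in> W"
  shows "differential M (\<lambda>y. F (\<Psi> y)) x V = differential amb F (\<Psi> x) (d\<Psi> x V)"
proof -
  let ?c = "chart_at M x"
  have c: "?c \<in> atlas M" "x \<in> fst ?c" using x chart_at_atlas chart_at_mem by auto
  have mem: "snd ?c x \<in> snd ?c ` fst ?c" using c by blast
  have "((\<lambda>q. F (chart_inv (amb_chart ?c) q)) has_derivative differential amb F (\<Psi> x)) (at (snd (amb_chart ?c) (\<Psi> x)))"
    using A.differential_has_derivative[OF F \<Psi>_mem_points[OF x]] by (simp add: \<Psi>_eq[of x] chart_at_amb)
  then have "((\<lambda>q. F (chart_inv (amb_chart ?c) (snd (amb_chart ?c) (\<Psi> (chart_inv ?c q))))) has_derivative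
      (\<lambda>V. differential amb F (\<Psi> x) (d\<Psi> x V))) (at (snd ?c x))"
    by (intro has_derivative_compose[OF \<Psi>_derivative[OF x]]) (simp add: chart_inv_chart[OF c])
  then have "((\<lambda>q. F (\<Psi> (chart_inv ?c q))) has_derivative (\<lambda>V. differential amb F (\<Psi> x) (d\<Psi> x V))) (at (snd ?c x))"
    by (rule has_derivative_transform_within_open[OF _ chart_image_open[OF c(1)] mem])
      (auto simp: chart_inv_chart[OF c(1)] A.chart_inv_chart[OF amb_chart_atlas[OF c(1)]] \<Psi>_mem)
  from frechet_derivative_eqI[OF this] show ?thesis by (simp add: differential_def o_def)
qed

lemma Du_pullback:
  assumes x: "x \<in> points M" and S: "open W" "W \<subseteq> points amb" "smooth_vector_field_on amb W S" "\<Psi> x \<in> W"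
  shows "Du x V (\<lambda>y. S (\<Psi> y)) = D (\<Psi> x) (d\<Psi> x V) S"
  using conjunct2[OF pullback[unfolded pullback_connection_def], THEN spec, THEN spec, THEN mp,
      OF conjI[OF S(1) conjI[OF S(2,3)]], THEN bspec, OF x, THEN mp, OF S(4), THEN spec]
  by (simp add: o_def tangent_map_\<Psi>[OF x])

definition position :: "real \<times> real \<times> 'm \<Rightarrow> real \<times> real \<times> 'e" where
  "position z = (fst z, 0, 0)"

lemma comp_position:
  assumes c: "c \<in> atlas M" and q: "q \<in> amb_domain c"
  shows "A.comp (amb_chart c) (chart_inv (amb_chart c) q) (position (chart_inv (amb_chart c) q)) = (dt q, 0, 0)"
proof -
  have "chart_inv c (base q) \<in> fst c" "dt q > 0" "\<bar>dr q\<bar> < \<delta>"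
    using chart_inv_mem[OF c] q by (auto simp: amb_domain_def)
  then show ?thesis
    unfolding amb_chart_inv[OF c q] by (simp add: position_def comp_amb[OF c] linear_0[OF linear_comp[OF c]])
qed

lemma position_smooth: "smooth_vector_field_on amb (points amb) position"
  unfolding smooth_section_on_def
proof clarify
  fix U \<tau> assume "(U, \<tau>) \<in> tangent_bundle amb"
  then obtain c where c: "c \<in> atlas M" "U = fst (amb_chart c)" "\<tau> = A.comp (amb_chart c)"
    unfolding tangent_bundle_def atlas_amb by blast
  note ac = amb_chart_atlas[OF c(1)] and op = open_amb_domain[OF c(1)]
  have U: "points amb \<inter> U = fst (amb_chart c)" using A.chart_points[OF ac] c(2) by blast
  have "smooth_on (amb_domain c) (\<lambda>q. (dt q, 0 :: real, 0 :: 'e))"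
    by (intro smooth_on_Pair op smooth_on_const smooth_on_bounded_linear[OF bounded_linear_fst])
  from smooth_on_cong[OF op comp_position[OF c(1), symmetric] this]
  show "smooth_map_on amb (points amb \<inter> U) (\<lambda>z. \<tau> z (position z))"
    unfolding U c(3) A.smooth_map_on_chart[OF ac A.chart_open[OF ac] order_refl] image_amb_chart .
qed

lemma D_position:
  assumes x: "x \<in> points M" and t: "t > 0"
  shows "D (t, 0, x) V position = V"
proof -
  let ?c = "chart_at M x" and ?z = "(t, 0, x)"
  have c: "?c \<in> atlas M" "x \<in> fst ?c" using x chart_at_atlas chart_at_mem by auto
  note ac = amb_chart_atlas[OF c(1)]
  interpret K: ambient_chart "amb_domain ?c" "H ?c" "B.christoffel (amb_chart ?c)"
    by (rule ambient_chart_christoffel[OF c(1)])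
  let ?q = "(t, 0, snd ?c x)"
  note q = base_coordinates[OF x t]
  have z: "?z \<in> fst (amb_chart ?c)" "?z \<in> points amb"
    using t x c \<delta>_pos by (auto simp: fst_amb_chart points_amb)
  have comp: "A.comp (amb_chart ?c) ?z v = v" for v
    using A.comp_chart_at[OF z(2)] by (simp add: chart_at_amb)
  have "((\<lambda>q. (dt q, 0 :: real, 0 :: 'e)) has_derivative (\<lambda>v. (dt v, 0, 0))) (at ?q)"
    by (intro has_derivative_Pair has_derivative_const has_derivative_fst has_derivative_ident)
  then have "((\<lambda>q. A.comp (amb_chart ?c) (chart_inv (amb_chart ?c) q) (position (chart_inv (amb_chart ?c) q)))
      has_derivative (\<lambda>v. (dt v, 0, 0))) (at ?q)"
    by (rule has_derivative_transform_within_open[OF _ open_amb_domain[OF c(1)] q]) (simp add: comp_position[OF c(1)])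
  from frechet_derivative_eqI[OF this]
  \<comment> \<open>The derivative of the components contributes the \<open>dt\<close> part of
    \<open>V\<close>, the Christoffel term the remaining part.\<close>
  have "D ?z V position = (dt V, 0, 0) + B.christoffel (amb_chart ?c) ?q V (t, 0, 0)"
    using B.D_chart[OF ac z(1) A.open_points order_refl z(2) position_smooth, of V]
    by (simp add: comp snd_amb_chart position_def)
  also have "(t, 0, 0) = t *\<^sub>R K.e0" by simp
  also have "B.christoffel (amb_chart ?c) ?q V (t *\<^sub>R K.e0) = K.proj V"
    unfolding bilinear_rmul[OF K.\<Gamma>_bilinear[OF q]] K.\<Gamma>_e0[OF q] using t by simp
  finally show ?thesis by (simp add: K.proj_def prod_eq_iff)
qed

text \<open>The derivative has no normal part, so \<open>\<xi>\<close> is parallel for the normal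
  connection; its tangential part is the identity, so the Weingarten endomorphism is -Id.\<close>

lemma Du_\<xi>:
  assumes "x \<in> points M"
  shows "Du x V \<xi> = d\<Psi> x V"
proof -
  have "\<xi> = (\<lambda>y. position (\<Psi> y))" by (simp add: fun_eq_iff \<xi>_eq \<Psi>_eq position_def)
  then show ?thesis
    using Du_pullback[OF assms A.open_points order_refl position_smooth \<Psi>_mem_points[OF assms], of V]
    by (simp add: \<Psi>_eq[of x] D_position[OF assms])
qed

abbreviation h\<Psi> where "h\<Psi> x \<equiv> amb_g (\<Psi> x)"

lemma h\<Psi>_eq:
  "x \<in> points M \<Longrightarrow> h\<Psi> x v w = exp (u x) * (dr v * dt w + dt v * dr w) + exp (2 * u x) * g x (base v) (base w)"
  by (simp add: amb_g_eq \<Psi>_eq \<gamma>_0 algebra_simps power2_eq_square flip: exp_add)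

lemma h\<Psi>_frame:
  assumes "c \<in> atlas M" "x \<in> fst c"
  shows "h\<Psi> x (inv (A.comp (amb_chart c) (\<Psi> x)) v) (inv (A.comp (amb_chart c) (\<Psi> x)) w)
    = exp (u x) * (dr v * dt w + dt v * dr w) + exp (2 * u x) * g x (coord_field c (base v) x) (coord_field c (base w) x)"
  by (simp add: h\<Psi>_eq[OF chart_mem_points[OF assms]] inv_comp_\<Psi>[OF assms] coord_field_def)

lemma h\<Psi>_bilinear: "x \<in> points M \<Longrightarrow> bilinear (h\<Psi> x)"
  unfolding bilinear_def
  by (intro conjI allI linearI)
    (simp_all add: h\<Psi>_eq bilinear_ladd[OF g_bilinear] bilinear_radd[OF g_bilinear]
      bilinear_lmul[OF g_bilinear] bilinear_rmul[OF g_bilinear] algebra_simps)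

lemma h\<Psi>_smooth:
  assumes c: "c \<in> atlas M"
  shows "smooth_map_on M (fst c) (\<lambda>x. h\<Psi> x (inv (A.comp (amb_chart c) (\<Psi> x)) v) (inv (A.comp (amb_chart c) (\<Psi> x)) w))"
proof -
  note op = chart_open[OF c] and sub = chart_points[OF c]
  have "smooth_map_on M (fst c) (\<lambda>x. exp (1 * u x) * (dr v * dt w + dt v * dr w)
      + exp (2 * u x) * g x (coord_field c (base v) x) (coord_field c (base w) x))"
    by (intro smooth_map_on_add[OF op] smooth_map_on_mult[OF op] smooth_map_on_const g_smooth[OF c]
        smooth_map_on_subset[OF exp_u_smooth sub])
  then show ?thesis
    by (rule smooth_map_on_cong[OF op, rotated]) (simp add: h\<Psi>_frame[OF c])
qed

lemma h\<Psi>_form: "smooth_symmetric_form M E h\<Psi>"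
  unfolding smooth_symmetric_form_def
proof (intro conjI ballI)
  fix x assume x: "x \<in> points M"
  show "bilinear (h\<Psi> x)" by (rule h\<Psi>_bilinear[OF x])
  show "\<forall>v w. h\<Psi> x v w = h\<Psi> x w v" using x by (simp add: h\<Psi>_eq g_sym[OF x] algebra_simps)
next
  fix p assume "p \<in> E"
  then show "case p of (U, \<tau>) \<Rightarrow> \<forall>v w. smooth_map_on M U (\<lambda>x. h\<Psi> x (inv (\<tau> x) v) (inv (\<tau> x) w))"
    using h\<Psi>_smooth unfolding E_eq by auto
qed

lemma h\<Psi>_lorentzian:
  assumes x: "x \<in> points M"
  shows "lorentzian_form (h\<Psi> x)"
  unfolding lorentzian_form_def
\<comment> \<open>Along the immersion \<open>\<partial>\<^sub>t\<close> and
  \<open>\<partial>\<^sub>r\<close> are lightlike with positive product, so their difference is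
  timelike. Its orthogonal complement is given by \<open>dt v = dr v\<close>, where the form is a
  sum of nonnegative terms.\<close>
proof (intro exI[of _ "(1, -1, 0)"] conjI allI impI)
  note g0 = bilinear_rzero[OF g_bilinear[OF x]] bilinear_lzero[OF g_bilinear[OF x]]
  show "h\<Psi> x (1, -1, 0) (1, -1, 0) < 0" by (simp add: h\<Psi>_eq[OF x] g0)
  fix v :: "real \<times> real \<times> 'e" assume v: "h\<Psi> x (1, -1, 0) v = 0 \<and> v \<noteq> 0"
  then have eq: "dr v = dt v" by (simp add: h\<Psi>_eq[OF x] g0)
  have g: "g x (base v) (base v) \<ge> 0" "base v \<noteq> 0 \<Longrightarrow> g x (base v) (base v) > 0"
    using g_pos[OF x, of "base v"] g0 by (cases "base v = 0"; force)+
  have "dt v \<noteq> 0 \<or> base v \<noteq> 0" using v eq by (auto simp: prod_eq_iff)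
  then have "exp (u x) * (2 * (dt v)\<^sup>2) > 0 \<or> exp (2 * u x) * g x (base v) (base v) > 0"
    using g(2) by auto
  moreover have "exp (u x) * (2 * (dt v)\<^sup>2) \<ge> 0" "exp (2 * u x) * g x (base v) (base v) \<ge> 0"
    using g(1) by auto
  ultimately have "exp (u x) * (2 * (dt v)\<^sup>2) + exp (2 * u x) * g x (base v) (base v) > 0" by linarith
  then show "h\<Psi> x v v > 0" by (simp add: h\<Psi>_eq[OF x] eq power2_eq_square)
qed

text \<open>The pullback rule yields compatibility only for restrictions of ambient fields. A
  general section has variable components in the frame of restricted coordinate fields;
  \<open>P.D_triv\<close> and the product rule for bilinear families carry the identity
  over.\<close>

lemma metric_connection_Du: "metric_connection M E h\<Psi> Du"
  unfolding metric_connection_def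
proof (intro allI impI ballI)
  fix U s s' x V
  assume H: "open U \<and> U \<subseteq> points M \<and> smooth_section_on M E U s \<and> smooth_section_on M E U s'" and x: "x \<in> U"
  then have U: "open U" "U \<subseteq> points M" and s: "smooth_section_on M E U s" and s': "smooth_section_on M E U s'"
    by auto
  have xp: "x \<in> points M" using U x by blast
  define c where "c = chart_at M x"
  have c: "c \<in> atlas M" "x \<in> fst c" using xp chart_at_atlas chart_at_mem by (auto simp: c_def)
  note ac = amb_chart_atlas[OF c(1)]
  let ?q = "snd c x"
  define \<tau> where "\<tau> y = A.comp (amb_chart c) (\<Psi> y)" for y
  have triv: "(fst c, \<tau>) \<in> E" unfolding \<tau>_def by (rule E_triv[OF c(1)])
  define S where "S v = A.coord_field (amb_chart c) v" for v
  have S_eq: "inv (\<tau> y) v = S v (\<Psi> y)" for y v by (simp add: \<tau>_def S_def A.coord_field_def)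
  have S_smooth: "smooth_vector_field_on amb (fst (amb_chart c)) (S v)" for v
    unfolding S_def by (rule A.coord_field_smooth[OF ac])
  define \<beta> where "\<beta> y v w = h\<Psi> y (S v (\<Psi> y)) (S w (\<Psi> y))" for y v w
  have Du_S: "Du x V (\<lambda>y. S v (\<Psi> y)) = D (\<Psi> x) (d\<Psi> x V) (S v)" for v
    by (rule Du_pullback[OF xp A.chart_open[OF ac] A.chart_points[OF ac] S_smooth])
      (simp add: \<Psi>_mem c(2))
  have op: "open (snd c ` (U \<inter> fst c))"
    using U(1) c(1) by (intro chart_image_open_subset open_Int chart_open) auto
  have mem: "?q \<in> snd c ` (U \<inter> fst c)" using x c(2) by blast
  have UI: "open (U \<inter> fst c)" "x \<in> U \<inter> fst c" using U(1) chart_open[OF c(1)] x c(2) by auto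
  have S_linear: "linear (\<lambda>v. S v (\<Psi> y))" if "y \<in> fst c" for y
    unfolding S_def A.coord_field_def using that by (intro A.linear_inv_comp ac) (simp add: \<Psi>_mem)
  have \<beta>_bilinear: "bilinear (\<beta> y)" if y: "y \<in> fst c" for y
    unfolding bilinear_def \<beta>_def
  proof (intro conjI allI)
    note bil = h\<Psi>_bilinear[OF chart_mem_points[OF c(1) y], unfolded bilinear_def]
    show "linear (\<lambda>w. h\<Psi> y (S v (\<Psi> y)) (S w (\<Psi> y)))" for v
      using linear_compose[OF S_linear[OF y] bil[THEN conjunct1, THEN spec]] unfolding o_def .
    show "linear (\<lambda>v. h\<Psi> y (S v (\<Psi> y)) (S w (\<Psi> y)))" for w
      using linear_compose[OF S_linear[OF y] bil[THEN conjunct2, THEN spec]] unfolding o_def .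
  qed
  \<comment> \<open>The derivative of the Gram matrix \<open>\<beta>\<close> of the restricted
    frame, as ambient compatibility predicts it.\<close>
  define d where "d v w V = h\<Psi> x (D (\<Psi> x) (d\<Psi> x V) (S v)) (S w (\<Psi> x))
    + h\<Psi> x (S v (\<Psi> x)) (D (\<Psi> x) (d\<Psi> x V) (S w))" for v w V
  have \<beta>_deriv: "((\<lambda>q. \<beta> (chart_inv c q) v w) has_derivative d v w) (at ?q)" for v w
  proof -
    have "smooth_map_on M (fst c) (\<lambda>y. \<beta> y v w)"
      using h\<Psi>_smooth[OF c(1), of v w] by (simp add: \<beta>_def S_eq[symmetric] \<tau>_def)
    from differential_has_derivative[OF this chart_open[OF c(1)] c(2) xp]
    have 1: "((\<lambda>q. \<beta> (chart_inv c q) v w) has_derivative differential M (\<lambda>y. \<beta> y v w) x) (at ?q)"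
      by (simp add: c_def)
    have 2: "differential M (\<lambda>y. \<beta> y v w) x V = d v w V" for V
    proof -
      have "differential M (\<lambda>y. \<beta> y v w) x V = differential amb (\<lambda>z. amb_g z (S v z) (S w z)) (\<Psi> x) (d\<Psi> x V)"
        unfolding \<beta>_def
        by (rule chain_\<Psi>[OF xp _ A.chart_open[OF ac]]) (simp_all add: S_def amb_g_smooth[OF c(1)] \<Psi>_mem c(2))
      moreover have "metric_connection amb (tangent_bundle amb) amb_g D"
        using levi_civita by (simp add: levi_civita_connection_def)
      note this[unfolded metric_connection_def, THEN spec, THEN spec, THEN spec, THEN mp, OF conjI[OF A.chart_open[OF ac]
            conjI[OF A.chart_points[OF ac] conjI[OF S_smooth S_smooth]]], THEN bspec, THEN spec]
      ultimately show ?thesis by (simp add: d_def \<Psi>_mem c(2))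
    qed
    show ?thesis by (rule has_derivative_eq_rhs[OF 1 ext[OF 2]])
  qed
  have sm: "smooth_map_on M (U \<inter> fst c) (\<lambda>y. \<tau> y (a y))" if "smooth_section_on M E U a" for a
    unfolding \<tau>_def by (rule section_chart[OF that c(1)])
  have der: "((\<lambda>q. \<tau> (chart_inv c q) (a (chart_inv c q))) has_derivative differential M (\<lambda>y. \<tau> y (a y)) x) (at ?q)"
    if "smooth_section_on M E U a" for a
    using differential_has_derivative[OF sm[OF that] UI xp] by (simp add: c_def)
  have Du_a: "Du x V a = S (differential M (\<lambda>y. \<tau> y (a y)) x V) (\<Psi> x) + D (\<Psi> x) (d\<Psi> x V) (S (\<tau> x (a x)))"
    if "smooth_section_on M E U a" for a
    using P.D_triv[OF U that x triv c(2), of V] unfolding S_eq Du_S .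
  have a_eq: "S (\<tau> y (a y)) (\<Psi> y) = a y" if "y \<in> fst c" for a y
    using P.triv_inv(2)[OF triv that] by (simp add: S_eq)
  have bil: "bilinear (\<beta> (chart_inv c q))" if "q \<in> snd c ` (U \<inter> fst c)" for q
    using that by (intro \<beta>_bilinear) (auto simp: chart_inv_chart[OF c(1)])
  have "((\<lambda>q. h\<Psi> (chart_inv c q) (s (chart_inv c q)) (s' (chart_inv c q))) has_derivative
      (\<lambda>V. d (\<tau> x (s x)) (\<tau> x (s' x)) V + \<beta> x (differential M (\<lambda>y. \<tau> y (s y)) x V) (\<tau> x (s' x))
        + \<beta> x (\<tau> x (s x)) (differential M (\<lambda>y. \<tau> y (s' y)) x V))) (at ?q)"
    by (rule has_derivative_transform_within_open[OF has_derivative_bilinear_family[OF op mem bil \<beta>_deriv der[OF s] der[OF s'],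
            unfolded chart_inv_chart[OF c]] op mem])
      (auto simp: chart_inv_chart[OF c(1)] \<beta>_def a_eq)
  from frechet_derivative_eqI[OF this]
  have "differential M (\<lambda>y. h\<Psi> y (s y) (s' y)) x V =
      d (\<tau> x (s x)) (\<tau> x (s' x)) V + h\<Psi> x (S (differential M (\<lambda>y. \<tau> y (s y)) x V) (\<Psi> x)) (s' x)
        + h\<Psi> x (s x) (S (differential M (\<lambda>y. \<tau> y (s' y)) x V) (\<Psi> x))"
    by (simp add: differential_def o_def c_def[symmetric] \<beta>_def a_eq[OF c(2)])
  also have "\<dots> = h\<Psi> x (Du x V s) (s' x) + h\<Psi> x (s x) (Du x V s')"
    unfolding d_def a_eq[OF c(2)] Du_a[OF s] Du_a[OF s'] bilinear_ladd[OF h\<Psi>_bilinear[OF xp]] bilinear_radd[OF h\<Psi>_bilinear[OF xp]]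
    by simp
  finally show "differential M (\<lambda>y. h\<Psi> y (s y) (s' y)) x V = h\<Psi> x (Du x V s) (s' x) + h\<Psi> x (s x) (Du x V s')" .
qed

end


section \<open>The tractor bundle\<close>

context ambient_tractor
begin

text \<open>The extension of \<open>d\<Psi>(X)\<close> to the ambient manifold that is homogeneous in \<open>t\<close>.\<close>

definition lift :: "('m \<Rightarrow> 'e) \<Rightarrow> real \<times> real \<times> 'm \<Rightarrow> real \<times> real \<times> 'e" where
  "lift X z = (fst z * differential M u (snd (snd z)) (X (snd (snd z))), 0, X (snd (snd z)))"

lemma lift_\<Psi>: "lift X (\<Psi> x) = d\<Psi> x (X x)"
  by (simp add: lift_def \<Psi>_eq d\<Psi>_def)

context
  fixes c assumes c: "c \<in> atlas M"
begin

definition u_hat where "u_hat v p = frechet_derivative (\<lambda>p. u (chart_inv c p)) (at p) v"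

lemma u_chart_smooth: "smooth_on (snd c ` fst c) (\<lambda>p. u (chart_inv c p))"
  using smooth_map_on_subset[OF u_smooth chart_points[OF c]]
  unfolding smooth_map_on_chart[OF c chart_open[OF c] order_refl] .

lemma comp_lift:
  assumes q: "q \<in> amb_domain c"
  shows "A.comp (amb_chart c) (chart_inv (amb_chart c) q) (lift (coord_field c v) (chart_inv (amb_chart c) q))
    = (dt q * u_hat v (base q), 0, v)"
proof -
  have y: "chart_inv c (base q) \<in> fst c" and tr: "dt q > 0" "\<bar>dr q\<bar> < \<delta>" and p: "base q \<in> snd c ` fst c"
    using chart_inv_mem[OF c] q by (auto simp: amb_domain_def)
  have "differential M u (chart_inv c (base q)) (coord_field c v (chart_inv c (base q))) = u_hat v (base q)"
    using differential_smooth[OF u_smooth open_points chart_mem_points[OF c y] c y]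
    by (simp add: comp_coord_field[OF c y] u_hat_def chart_chart_inv[OF c p])
  then show ?thesis
    unfolding amb_chart_inv[OF c q]
    by (simp add: comp_amb[OF c y tr] lift_def comp_coord_field[OF c y])
qed

lemma lift_smooth: "smooth_vector_field_on amb (fst (amb_chart c)) (lift (coord_field c v))"
proof -
  note ac = amb_chart_atlas[OF c] and op = open_amb_domain[OF c]
  have "smooth_on (amb_domain c) (\<lambda>q. u_hat v (base q))"
    unfolding u_hat_def
    by (rule smooth_on_compose[OF op chart_image_open[OF c]
          smooth_on_bounded_linear[OF bounded_linear_compose[OF bounded_linear_snd bounded_linear_snd]]
          smooth_on_derivative[OF u_chart_smooth]]) (auto simp: amb_domain_def)
  then have "smooth_on (amb_domain c) (\<lambda>q. (dt q * u_hat v (base q), 0 :: real, v))"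
    by (intro smooth_on_Pair[OF op] smooth_on_mult[OF op] smooth_on_const smooth_on_bounded_linear[OF bounded_linear_fst])
  then have "smooth_on (amb_domain c) (\<lambda>q. A.comp (amb_chart c) (chart_inv (amb_chart c) q)
      (lift (coord_field c v) (chart_inv (amb_chart c) q)))"
    by (rule smooth_on_cong[OF op, rotated]) (simp add: comp_lift)
  then have "smooth_map_on amb (fst (amb_chart c)) (\<lambda>z. A.comp (amb_chart c) z (lift (coord_field c v) z))"
    unfolding A.smooth_map_on_chart[OF ac A.chart_open[OF ac] order_refl] image_amb_chart .
  then show ?thesis
    unfolding B.section_triv[OF A.tangent_triv[OF ac] A.chart_open[OF ac] order_refl] .
qed

text \<open>Only the \<open>dt\<close> component could fail to vanish. Differentiating the one of
  the second lift along the first gives \<open>t (u_v u_w + u_vw)\<close>, with subscripts for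
  partial derivatives of \<open>u\<close> in the chart, which is symmetric in \<open>v\<close> and
  \<open>w\<close>.\<close>

lemma lie_bracket_lift:
  assumes x: "x \<in> fst c"
  shows "lie_bracket amb (lift (coord_field c v)) (lift (coord_field c w)) (\<Psi> x) = 0"
proof -
  note ac = amb_chart_atlas[OF c] and op = open_amb_domain[OF c]
  have z: "\<Psi> x \<in> fst (amb_chart c)" "\<Psi> x \<in> points amb"
    using x \<Psi>_mem_points[OF chart_mem_points[OF c x]] by (simp_all add: \<Psi>_mem)
  let ?q = "snd (amb_chart c) (\<Psi> x)"
  let ?p = "snd c x"
  have q: "?q = (exp (u x), 0, ?p)" by (simp add: snd_amb_chart \<Psi>_eq)
  have qm: "?q \<in> amb_domain c" using z(1) unfolding image_amb_chart[symmetric] by (rule imageI)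
  have pm: "?p \<in> snd c ` fst c" using x by (rule imageI)
  have comp_at: "A.comp (amb_chart c) (\<Psi> x) (lift (coord_field c v) (\<Psi> x)) = (exp (u x) * u_hat v ?p, 0, v)" for v
    using comp_lift[OF qm, of v, unfolded A.chart_inv_chart[OF ac z(1)]] by (simp add: q)
  have der: "differential amb (\<lambda>z. A.comp (amb_chart c) z (lift (coord_field c w) z)) (\<Psi> x) V
      = (dt V' * u_hat w ?p + exp (u x) * frechet_derivative (u_hat w) (at ?p) (base V'), 0, 0)"
    if V': "V' = A.comp (amb_chart c) (\<Psi> x) V" for V V' w
  proof -
    have "(u_hat w has_derivative frechet_derivative (u_hat w) (at ?p)) (at (base ?q))"
      unfolding q u_hat_def
      using smooth_on_has_derivative[OF smooth_on_derivative[OF u_chart_smooth] pm] by simp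
    then have u: "((\<lambda>q. u_hat w (base q)) has_derivative (\<lambda>h. frechet_derivative (u_hat w) (at ?p) (base h))) (at ?q)"
      by (rule has_derivative_compose[OF has_derivative_snd[OF has_derivative_snd[OF has_derivative_ident]]])
    have "((\<lambda>q. (dt q * u_hat w (base q), 0 :: real, w)) has_derivative
        (\<lambda>h. (dt ?q * frechet_derivative (u_hat w) (at ?p) (base h) + dt h * u_hat w (base ?q), 0, 0))) (at ?q)"
      by (intro has_derivative_Pair has_derivative_const has_derivative_mult[OF has_derivative_fst[OF has_derivative_ident] u])
    then have "((\<lambda>q. A.comp (amb_chart c) (chart_inv (amb_chart c) q) (lift (coord_field c w) (chart_inv (amb_chart c) q)))
        has_derivative (\<lambda>h. (dt ?q * frechet_derivative (u_hat w) (at ?p) (base h) + dt h * u_hat w (base ?q), 0, 0))) (at ?q)"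
      by (rule has_derivative_transform_within_open[OF _ op qm]) (simp add: comp_lift)
    from A.differential_chart[OF ac z(1) this, of V] show ?thesis by (simp add: V' q)
  qed
  have "A.comp (amb_chart c) (\<Psi> x) (lie_bracket amb (lift (coord_field c v)) (lift (coord_field c w)) (\<Psi> x)) = 0"
    unfolding A.lie_bracket_chart[OF A.chart_open[OF ac] z lift_smooth lift_smooth ac z(1)] der[OF refl] comp_at
    using symmetric_second_derivative[OF chart_image_open[OF c] pm u_chart_smooth, of v w]
    by (simp add: u_hat_def[abs_def] zero_prod_def)
  then show ?thesis
    using A.inv_comp_comp[OF ac z(1)] linear_0[OF A.linear_inv_comp[OF ac z(1)]] by metis
qed

end

text \<open>On the overlap of the two charts that \<open>extend_at\<close> selects, one for
  \<open>M\<close> and one for the bundle, every ingredient is the restriction of an ambient field;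
  \<open>lift\<close> extends the images of the coordinate fields. The brackets vanish on both
  sides, so the iterated derivatives can be matched one by one.\<close>

lemma curvature_Du:
  assumes x: "x \<in> points M"
  shows "curvature M E Du x V W e = curvature amb (tangent_bundle amb) D (\<Psi> x) (d\<Psi> x V) (d\<Psi> x W) e"
proof -
  interpret TM: vbundle M "tangent_bundle M" by (rule tangent_vbundle)
  obtain U\<^sub>1 \<tau>\<^sub>1 where 1: "(U\<^sub>1, \<tau>\<^sub>1) \<in> tangent_bundle M" "x \<in> U\<^sub>1"
    "\<And>v. extend_at (tangent_bundle M) x v = (\<lambda>y. inv (\<tau>\<^sub>1 y) (\<tau>\<^sub>1 x v))"
    by (rule TM.extend_at_triv[OF x]) metis
  then obtain c where c: "c \<in> atlas M" "x \<in> fst c"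
    and ext: "\<And>v. extend_at (tangent_bundle M) x v = coord_field c (comp c x v)"
    unfolding tangent_bundle_def coord_field_def by blast
  obtain U\<^sub>2 \<tau>\<^sub>2 where 2: "(U\<^sub>2, \<tau>\<^sub>2) \<in> E" "x \<in> U\<^sub>2" "\<And>v. extend_at E x v = (\<lambda>y. inv (\<tau>\<^sub>2 y) (\<tau>\<^sub>2 x v))"
    by (rule P.extend_at_triv[OF x]) metis
  from 2(1) obtain d where d: "d \<in> atlas M" "U\<^sub>2 = fst d" "\<tau>\<^sub>2 = (\<lambda>x. A.comp (amb_chart d) (\<Psi> x))" by (rule E_cases)
  have xd: "x \<in> fst d" using 2(2) d(2) by simp
  note ac = amb_chart_atlas[OF c(1)] and ad = amb_chart_atlas[OF d(1)]
  define X where "X = coord_field c (comp c x V)"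
  define Y where "Y = coord_field c (comp c x W)"
  define S where "S = A.coord_field (amb_chart d) (A.comp (amb_chart d) (\<Psi> x) e)"
  define s where "s = (\<lambda>y. S (\<Psi> y))"
  have extE: "extend_at E x e = s"
    unfolding 2(3) d(3) s_def S_def A.coord_field_def ..
  have at_x: "X x = V" "Y x = W"
    by (simp_all add: X_def Y_def coord_field_def inv_comp_comp[OF c])
  have zd: "\<Psi> x \<in> fst (amb_chart d)" and zc: "\<Psi> x \<in> fst (amb_chart c)"
    using xd c(2) by (simp_all add: \<Psi>_mem)
  have S_at: "S (\<Psi> x) = e"
    by (simp add: S_def A.coord_field_def A.inv_comp_comp[OF ad zd])
  define U where "U = fst c \<inter> fst d"
  define O' where "O' = fst (amb_chart c) \<inter> fst (amb_chart d)"
  have U: "open U" "U \<subseteq> points M" "x \<in> U"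
    using chart_open c d chart_points xd unfolding U_def by blast+
  have O': "open O'" "O' \<subseteq> points amb"
    using A.chart_open ac ad A.chart_points unfolding O'_def by blast+
  have \<Psi>U: "\<Psi> y \<in> O'" if "y \<in> U" for y using that by (simp add: O'_def U_def \<Psi>_mem)
  have S: "smooth_vector_field_on amb O' S"
    unfolding S_def by (rule B.section_subset[OF A.coord_field_smooth[OF ad]]) (simp add: O'_def)
  have s: "smooth_section_on M E U s"
  proof -
    have "smooth_section_on M E U\<^sub>2 (extend_at E x e)"
      unfolding 2(3) by (rule P.section_const[OF 2(1)])
    then show ?thesis unfolding extE by (rule P.section_subset) (simp add: U_def d(2))
  qed
  \<comment> \<open>The pullback rule is used twice. The inner derivative must be recognized as the
    restriction of a smooth ambient field on a whole neighbourhood before the outer one can be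
    taken; this is why the image vectors are extended off the image of the immersion.\<close>
  have cov: "Du x (Z x) (\<lambda>y. Du y (Z' y) s) = D (\<Psi> x) (lift Z (\<Psi> x)) (\<lambda>z. D z (lift Z' z) S)"
    if Z: "Z' = coord_field c v" for Z Z' v
  proof -
    have lift: "smooth_vector_field_on amb O' (lift Z')"
      unfolding Z by (rule B.section_subset[OF lift_smooth[OF c(1)]]) (simp add: O'_def)
    have Z': "smooth_vector_field_on M U Z'"
      unfolding Z by (rule TM.section_subset[OF coord_field_smooth[OF c(1)]]) (simp add: U_def)
    have "Du x (Z x) (\<lambda>y. Du y (Z' y) s) = Du x (Z x) (\<lambda>y. D (\<Psi> y) (lift Z' (\<Psi> y)) S)"
    proof (rule P.D_local[OF U(1,2) P.D_smooth[OF U(1,2) s Z'] _ U(3)])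
      fix y assume y: "y \<in> U"
      then have "y \<in> points M" using U(2) by blast
      then show "Du y (Z' y) s = D (\<Psi> y) (lift Z' (\<Psi> y)) S"
        unfolding s_def lift_\<Psi> by (rule Du_pullback[OF _ O' S \<Psi>U[OF y]])
    qed
    also have "\<dots> = D (\<Psi> x) (d\<Psi> x (Z x)) (\<lambda>z. D z (lift Z' z) S)"
      by (rule Du_pullback[OF x O' B.D_smooth[OF O' S lift] \<Psi>U[OF U(3)]])
    finally show ?thesis by (simp add: lift_\<Psi>)
  qed
  have "lie_bracket M X Y x = 0" unfolding X_def Y_def by (rule lie_bracket_coord_field[OF c])
  moreover have "lie_bracket amb (lift X) (lift Y) (\<Psi> x) = 0"
    unfolding X_def Y_def by (rule lie_bracket_lift[OF c])
  ultimately have "curvature_of_fields M Du X Y s x = curvature_of_fields amb D (lift X) (lift Y) S (\<Psi> x)"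
    unfolding curvature_of_fields_def cov[OF X_def] cov[OF Y_def]
    using linear_0[OF P.D_linear[OF U(1,2) s U(3)]] linear_0[OF B.D_linear[OF O' S \<Psi>U[OF U(3)]]] by simp
  then have "A.comp (amb_chart c) (\<Psi> x) (curvature M E Du x V W e)
      = A.comp (amb_chart c) (\<Psi> x) (curvature_of_fields amb D (lift X) (lift Y) S (\<Psi> x))"
    unfolding curvature_def ext extE X_def Y_def by simp
  also have "\<dots> = A.comp (amb_chart c) (\<Psi> x) (curvature amb (tangent_bundle amb) D (\<Psi> x) (d\<Psi> x V) (d\<Psi> x W) e)"
  proof -
    have "smooth_vector_field_on amb O' (lift X)" "smooth_vector_field_on amb O' (lift Y)"
      unfolding X_def Y_def by (rule B.section_subset[OF lift_smooth[OF c(1)]], simp add: O'_def)+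
    from B.curvature_of_fields_chart[OF O' \<Psi>U[OF U(3)] ac zc this S]
    show ?thesis unfolding B.curvature_chart[OF ac zc] lift_\<Psi> at_x S_at .
  qed
  finally show ?thesis using A.inv_comp_comp[OF ac zc] by metis
qed

section \<open>The line bundle, its quotient and the map beta\<close>

abbreviation T where "T \<equiv> associated_tractor_bundle M amb amb_g \<Psi> \<xi> Du"

lemma T_simps [simp]:
  "tbundle T = E" "line T x = span {\<xi> x}" "positive T x = {a *\<^sub>R \<xi> x | a. a > 0}"
  "metric T = (\<lambda>x. h\<Psi> x)" "connection T = Du"
  by (simp_all add: associated_tractor_bundle_def)

lemma line_iff: "l \<in> span {\<xi> x} \<longleftrightarrow> dr l = 0 \<and> base l = 0"
proof
  assume "dr l = 0 \<and> base l = 0"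
  then have "l = (dt l / exp (u x)) *\<^sub>R \<xi> x" by (simp add: \<xi>_eq prod_eq_iff)
  then show "l \<in> span {\<xi> x}" by (metis span_mul span_base singletonI)
qed (auto simp: span_singleton \<xi>_eq)

lemma coset_eq_iff: "coset (span {\<xi> x}) v = coset (span {\<xi> x}) w \<longleftrightarrow> dr v = dr w \<and> base v = base w"
proof
  assume "coset (span {\<xi> x}) v = coset (span {\<xi> x}) w"
  moreover have "v + 0 \<in> coset (span {\<xi> x}) v" unfolding coset_def by (rule imageI) (rule span_zero)
  ultimately have "v \<in> coset (span {\<xi> x}) w" by simp
  then show "dr v = dr w \<and> base v = base w" unfolding coset_def by (auto simp: line_iff)
next
  have sub: "coset (span {\<xi> x}) v \<subseteq> coset (span {\<xi> x}) w" if "dr v = dr w" "base v = base w"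
    for v w :: "real \<times> real \<times> 'e"
  proof
    fix y assume "y \<in> coset (span {\<xi> x}) v"
    then have "y - w \<in> span {\<xi> x}" using that unfolding coset_def by (auto simp: line_iff)
    then have "w + (y - w) \<in> coset (span {\<xi> x}) w" unfolding coset_def by (rule imageI)
    then show "y \<in> coset (span {\<xi> x}) w" by simp
  qed
  assume "dr v = dr w \<and> base v = base w"
  then show "coset (span {\<xi> x}) v = coset (span {\<xi> x}) w" using sub[of v w] sub[of w v] by auto
qed

lemma coset_mem: "v \<in> coset (span {\<xi> x}) w \<longleftrightarrow> dr v = dr w \<and> base v = base w"
proof
  assume "dr v = dr w \<and> base v = base w"
  then have "coset (span {\<xi> x}) v = coset (span {\<xi> x}) w" by (simp only: coset_eq_iff)
  moreover have "v + 0 \<in> coset (span {\<xi> x}) v" unfolding coset_def by (rule imageI) (rule span_zero)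
  ultimately show "v \<in> coset (span {\<xi> x}) w" by simp
qed (auto simp: coset_def line_iff)

lemma line_perp_iff:
  assumes x: "x \<in> points M"
  shows "v \<in> line_perp T x \<longleftrightarrow> dr v = 0"
proof
  assume "v \<in> line_perp T x"
  then have "h\<Psi> x v (\<xi> x) = 0" by (simp add: line_perp_def span_base)
  then show "dr v = 0" by (simp add: h\<Psi>_eq[OF x] \<xi>_eq bilinear_rzero[OF g_bilinear[OF x]])
qed (simp add: line_perp_def line_iff h\<Psi>_eq[OF x] bilinear_rzero[OF g_bilinear[OF x]])

lemma line_section_coefficient:
  assumes "line_section_on M T U \<sigma>"
  obtains f where "smooth_map_on M U f" "\<And>x. x \<in> U \<Longrightarrow> \<sigma> x = f x *\<^sub>R \<xi> x"
proof
  have U: "open U" "U \<subseteq> points M" and \<sigma>: "smooth_section_on M E U \<sigma>"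
    and line: "\<And>x. x \<in> U \<Longrightarrow> \<sigma> x \<in> span {\<xi> x}"
    using assms by (auto simp: line_section_on_def)
  \<comment> \<open>The \<open>dt\<close> component is the same in all trivializations, so it is a
    smooth function although \<open>\<sigma>\<close>, read in preferred charts, may jump as a map
    into the fibre.\<close>
  have "smooth_map_on M U (\<lambda>x. dt (\<sigma> x))"
  proof (rule smooth_map_on_local)
    fix x assume x: "x \<in> U"
    define c where "c = chart_at M x"
    have c: "c \<in> atlas M" "x \<in> fst c" using x U(2) chart_at_atlas chart_at_mem by (auto simp: c_def)
    have op: "open (U \<inter> fst c)" using U chart_open[OF c(1)] by blast
    have "smooth_map_on M (U \<inter> fst c) (\<lambda>x. dt (A.comp (amb_chart c) (\<Psi> x) (\<sigma> x)))"
      by (rule smooth_map_on_linear[OF op section_chart[OF \<sigma> c(1)]]) (rule linearI, simp_all)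
    then have "smooth_map_on M (U \<inter> fst c) (\<lambda>x. dt (\<sigma> x))"
      by (rule smooth_map_on_cong[OF op, rotated]) (simp add: comp_\<Psi>[OF c(1)])
    then show "\<exists>W. open W \<and> x \<in> W \<and> W \<subseteq> points M \<and> smooth_map_on M W (\<lambda>x. dt (\<sigma> x))"
      using op x c(2) U(2) by blast
  qed
  then show "smooth_map_on M U (\<lambda>x. dt (\<sigma> x) * exp (- 1 * u x))"
    by (intro smooth_map_on_mult U(1) smooth_map_on_subset[OF exp_u_smooth U(2)])
  show "\<sigma> x = (dt (\<sigma> x) * exp (- 1 * u x)) *\<^sub>R \<xi> x" if "x \<in> U" for x
    using line[OF that, unfolded line_iff] by (simp add: \<xi>_eq prod_eq_iff exp_minus)
qed

lemma Du_line_section: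
  assumes U: "open U" "U \<subseteq> points M" "x \<in> U" and f: "smooth_map_on M U f"
    and \<sigma>: "\<And>x. x \<in> U \<Longrightarrow> \<sigma> x = f x *\<^sub>R \<xi> x"
  shows "dr (Du x V \<sigma>) = 0" "base (Du x V \<sigma>) = f x *\<^sub>R V"
proof -
  note xi = P.section_subset[OF \<xi>_smooth U(2)]
  have "Du x V \<sigma> = Du x V (\<lambda>y. f y *\<^sub>R \<xi> y)"
    by (rule P.D_local[OF U(1,2) P.section_scale[OF U(1) xi f] \<sigma>[symmetric] U(3), symmetric])
  also have "\<dots> = differential M f x V *\<^sub>R \<xi> x + f x *\<^sub>R d\<Psi> x V"
    unfolding P.D_scale[OF U(1,2) xi f U(3)] using Du_\<xi> U by auto
  finally show "dr (Du x V \<sigma>) = 0" "base (Du x V \<sigma>) = f x *\<^sub>R V"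
    by (simp_all add: \<xi>_eq d\<Psi>_def)
qed

lemma beta_sec_line_section:
  assumes "line_section_on M T U \<sigma>" "x \<in> U"
  shows "tractor_beta_sec T \<sigma> x V = coset (span {\<xi> x}) (0, 0, (dt (\<sigma> x) / exp (u x)) *\<^sub>R V)"
proof -
  obtain f where f: "smooth_map_on M U f" "\<And>x. x \<in> U \<Longrightarrow> \<sigma> x = f x *\<^sub>R \<xi> x"
    by (rule line_section_coefficient[OF assms(1)]) metis
  have U: "open U" "U \<subseteq> points M" using assms(1) by (auto simp: line_section_on_def)
  have "dt (\<sigma> x) / exp (u x) = f x" by (simp add: f(2)[OF assms(2)] \<xi>_eq)
  then show ?thesis
    using Du_line_section[OF U assms(2) f] by (simp add: tractor_beta_sec_def coset_eq_iff)
qed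

lemma tractor_beta_eq:
  assumes x: "x \<in> points M"
  shows "tractor_beta M T x V = (\<lambda>l\<in>span {\<xi> x}. coset (span {\<xi> x}) (0, 0, (dt l / exp (u x)) *\<^sub>R V))"
  unfolding tractor_beta_def T_simps
proof (rule restrict_ext)
  fix l assume l: "l \<in> span {\<xi> x}"
  define P where "P \<sigma> \<longleftrightarrow> \<sigma> x = l \<and> (\<exists>U. x \<in> U \<and> line_section_on M T U \<sigma>)" for \<sigma>
  define \<sigma> where "\<sigma> = (SOME \<sigma>. P \<sigma>)"
  \<comment> \<open>A constant multiple of \<open>\<xi>\<close> through \<open>l\<close> makes the
    choice meaningful. Which section is chosen is immaterial, because the formula in
    \<open>beta_sec_line_section\<close> involves its value at \<open>x\<close> only.\<close>
  have "P (\<lambda>y. (dt l / exp (u x)) *\<^sub>R \<xi> y)"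
    unfolding P_def
  proof (intro conjI exI)
    show "(dt l / exp (u x)) *\<^sub>R \<xi> x = l" using l[unfolded line_iff] by (simp add: \<xi>_eq prod_eq_iff)
    show "line_section_on M T (points M) (\<lambda>y. (dt l / exp (u x)) *\<^sub>R \<xi> y)"
      using P.section_scale[OF open_points \<xi>_smooth smooth_map_on_const]
      by (simp add: line_section_on_def open_points span_mul span_base)
  qed (rule x)
  then have "P \<sigma>" unfolding \<sigma>_def by (rule someI[of P])
  then have "tractor_beta_sec T \<sigma> x V = coset (span {\<xi> x}) (0, 0, (dt l / exp (u x)) *\<^sub>R V)"
    unfolding P_def using beta_sec_line_section by blast
  then show "tractor_beta_sec T (SOME \<sigma>. \<sigma> x = l \<and> (\<exists>U. x \<in> U \<and> line_section_on M T U \<sigma>)) x V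
      = coset (span {\<xi> x}) (0, 0, (dt l / exp (u x)) *\<^sub>R V)"
    unfolding \<sigma>_def P_def .
qed

text \<open>A homomorphism on the line is determined by the coset it assigns to
  \<open>\<xi> x\<close>. A coset in the quotient is determined by its base component, since
  \<open>dt\<close> is divided out and \<open>dr\<close> vanishes on the orthogonal space.\<close>

lemma tractor_beta_bij:
  assumes x: "x \<in> points M"
  shows "bij_betw (tractor_beta M T x) UNIV (line_hom T x)"
  unfolding bij_betw_def
proof (intro conjI inj_onI subset_antisym)
  let ?L = "span {\<xi> x}"
  have \<xi>L: "\<xi> x \<in> ?L" by (simp add: span_base)
  fix V V' assume "tractor_beta M T x V = tractor_beta M T x V'"
  from fun_cong[OF this, of "\<xi> x"] show "V = V'"
    unfolding tractor_beta_eq[OF x] using \<xi>L by (simp add: coset_eq_iff) (simp add: \<xi>_eq)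
next
  let ?L = "span {\<xi> x}"
  show "tractor_beta M T x ` UNIV \<subseteq> line_hom T x"
  proof (rule image_subsetI)
    fix V
    have "coset ?L (0, 0, r *\<^sub>R V) \<in> line_quotient T x" for r
      unfolding line_quotient_def T_simps by (rule imageI) (simp add: line_perp_iff[OF x])
    moreover have "a *\<^sub>R l + b *\<^sub>R m \<in> ?L" if "l \<in> ?L" "m \<in> ?L" for a b l m
      using that by (intro span_add span_mul)
    ultimately show "tractor_beta M T x V \<in> line_hom T x"
      unfolding line_hom_def tractor_beta_eq[OF x] T_simps
      by (auto simp: coset_eq_iff coset_mem add_divide_distrib scaleR_add_left)
  qed
  show "line_hom T x \<subseteq> tractor_beta M T x ` UNIV"
  proof
    fix F assume F: "F \<in> line_hom T x"
    then have ext: "F \<in> ?L \<rightarrow>\<^sub>E line_quotient T x"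
      and lin: "\<And>l m v w a b. l \<in> ?L \<Longrightarrow> m \<in> ?L \<Longrightarrow> v \<in> F l \<Longrightarrow> w \<in> F m \<Longrightarrow>
        F (a *\<^sub>R l + b *\<^sub>R m) = coset ?L (a *\<^sub>R v + b *\<^sub>R w)"
      unfolding line_hom_def T_simps by blast+
    have \<xi>L: "\<xi> x \<in> ?L" by (simp add: span_base)
    have "F (\<xi> x) \<in> line_quotient T x" using ext \<xi>L by blast
    then obtain v where v: "F (\<xi> x) = coset ?L v" "dr v = 0"
      unfolding line_quotient_def T_simps using line_perp_iff[OF x] by auto
    have vF: "v \<in> F (\<xi> x)" unfolding v(1) by (simp add: coset_mem)
    have "F = tractor_beta M T x (base v)"
    proof (rule extensionalityI)
      show "F \<in> extensional ?L" using ext by (simp add: PiE_def)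
      show "tractor_beta M T x (base v) \<in> extensional ?L" unfolding tractor_beta_eq[OF x] by simp
      fix l assume l: "l \<in> ?L"
      \<comment> \<open>The zero summand only brings \<open>l\<close> into the two-term form of the
        linearity condition in \<open>line_hom\<close>.\<close>
      have "l = (dt l / exp (u x)) *\<^sub>R \<xi> x + 0 *\<^sub>R \<xi> x"
        using l[unfolded line_iff] by (simp add: \<xi>_eq prod_eq_iff)
      then have "F l = F ((dt l / exp (u x)) *\<^sub>R \<xi> x + 0 *\<^sub>R \<xi> x)" by (rule arg_cong)
      also have "\<dots> = coset ?L ((dt l / exp (u x)) *\<^sub>R v + 0 *\<^sub>R v)" by (rule lin[OF \<xi>L \<xi>L vF vF])
      finally show "F l = tractor_beta M T x (base v) l"
        using l v(2) unfolding tractor_beta_eq[OF x] by (simp add: coset_eq_iff)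
    qed
    then show "F \<in> tractor_beta M T x ` UNIV" by blast
  qed
qed

lemma conformal_tractor_bundle_T: "conformal_tractor_bundle M T"
  unfolding conformal_tractor_bundle_def
proof (intro conjI ballI)
  show "DIM(real \<times> real \<times> 'e) = DIM('e) + 2" by simp
  show "vector_bundle M (tbundle T)" using vector_bundle_E by simp
  show "lorentzian_bundle_metric M (tbundle T) (metric T)"
    unfolding lorentzian_bundle_metric_def T_simps using h\<Psi>_form h\<Psi>_lorentzian by blast
  show "oriented_line_subbundle M (tbundle T) (line T) (positive T)"
    unfolding oriented_line_subbundle_def T_simps
  proof (rule ballI)
    fix x assume "x \<in> points M"
    then show "\<exists>U \<sigma>. open U \<and> x \<in> U \<and> U \<subseteq> points M \<and> smooth_section_on M E U \<sigma> \<and>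
        (\<forall>y\<in>U. \<sigma> y \<noteq> 0 \<and> span {\<xi> y} = span {\<sigma> y} \<and> {a *\<^sub>R \<xi> y |a. 0 < a} = {a *\<^sub>R \<sigma> y |a. 0 < a})"
      by (intro exI[of _ "points M"] exI[of _ \<xi>] conjI open_points order_refl \<xi>_smooth ballI refl)
        (simp_all add: \<xi>_eq zero_prod_def)
  qed
  fix x l assume x: "x \<in> points M" and l: "l \<in> line T x"
  then show "metric T x l l = 0" by (simp add: line_iff h\<Psi>_eq[OF x] bilinear_rzero[OF g_bilinear[OF x]])
qed

lemma section_metric_conformal:
  assumes \<sigma>: "line_section_on M T U \<sigma>" "\<forall>x\<in>U. \<sigma> x \<noteq> 0" and k: "k \<in> cs"
  shows "conformal_on M U k (section_metric T \<sigma>)"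
proof -
  obtain f where f: "smooth_map_on M U f" "\<And>x. x \<in> U \<Longrightarrow> \<sigma> x = f x *\<^sub>R \<xi> x"
    by (rule line_section_coefficient[OF \<sigma>(1)]) metis
  have U: "open U" "U \<subseteq> points M" using \<sigma>(1) by (auto simp: line_section_on_def)
  have f0: "f x * f x > 0" if "x \<in> U" for x
    using \<sigma>(2) f(2)[OF that] that by (auto simp: zero_less_mult_iff linorder_neq_iff)
  obtain g0 where g0: "cs = {h. riemannian_metric M h \<and> conformal_on M (points M) g0 h}"
    using conformal unfolding conformal_structure_def by blast
  obtain a where a: "smooth_map_on M (points M) a" "\<And>x V W. x \<in> points M \<Longrightarrow> g x V W = exp (2 * a x) * g0 x V W"
    using g_cs unfolding g0 conformal_on_def by blast
  obtain b where b: "smooth_map_on M (points M) b" "\<And>x V W. x \<in> points M \<Longrightarrow> k x V W = exp (2 * b x) * g0 x V W"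
    using k unfolding g0 conformal_on_def by blast
  \<comment> \<open>The section metric is \<open>exp (2 * u x) * (f x * f x)\<close> times
    \<open>g\<close>, while \<open>g\<close> and \<open>k\<close> are multiples of the same
    \<open>g0\<close> with factors \<open>exp (2 * a x)\<close> and \<open>exp (2 * b x)\<close>;
    comparing exponents gives \<open>F\<close>. Squaring \<open>f\<close> admits sections of either
    sign.\<close>
  define F where "F x = (1 / 2) * ln (f x * f x) + (u x + (a x + (- 1) * b x))" for x
  have "smooth_map_on M U (\<lambda>x. ln (f x * f x))"
    by (rule smooth_map_on_compose[OF U(1) open_greaterThan smooth_map_on_mult[OF U(1) f(1) f(1)] smooth_on_ln])
      (use f0 in auto)
  then have "smooth_map_on M U F"
    unfolding F_def
    by (intro smooth_map_on_add[OF U(1)] smooth_map_on_mult[OF U(1)] smooth_map_on_const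
        smooth_map_on_subset[OF u_smooth U(2)] smooth_map_on_subset[OF a(1) U(2)] smooth_map_on_subset[OF b(1) U(2)])
  moreover have "section_metric T \<sigma> x V W = exp (2 * F x) * k x V W" if x: "x \<in> U" for x V W
  proof -
    have xp: "x \<in> points M" using x U(2) by blast
    have "section_metric T \<sigma> x V W = exp (2 * u x) * (f x * f x) * g x V W"
      using Du_line_section[OF U x f]
      by (simp add: section_metric_def h\<Psi>_eq[OF xp] bilinear_lmul[OF g_bilinear[OF xp]] bilinear_rmul[OF g_bilinear[OF xp]])
    also have "exp (2 * u x) * (f x * f x) * g x V W = exp (2 * u x + ln (f x * f x) + 2 * a x) * g0 x V W"
      using f0[OF x] a(2)[OF xp] by (simp add: exp_add)
    also have "2 * u x + ln (f x * f x) + 2 * a x = 2 * F x + 2 * b x" by (simp add: F_def algebra_simps)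
    also have "exp (2 * F x + 2 * b x) * g0 x V W = exp (2 * F x) * k x V W"
      using b(2)[OF xp] by (simp add: exp_add)
    finally show ?thesis .
  qed
  ultimately show ?thesis unfolding conformal_on_def by blast
qed

lemma standard_T: "standard_conformal_tractor_bundle M cs T"
  unfolding standard_conformal_tractor_bundle_def tractor_connection_def
  using conformal_tractor_bundle_T P.connection metric_connection_Du tractor_beta_bij section_metric_conformal
  by simp

section \<open>Curvature of the tractor connection and normality\<close>

lemma T_curvature_line:
  assumes x: "x \<in> points M" and "l \<in> span {\<xi> x}"
  shows "curvature M E Du x V W l = 0"
proof -
  have "l = (dt l, 0, 0)" using assms(2) by (simp add: line_iff prod_eq_iff)
  then show ?thesis
    unfolding curvature_Du[OF x] \<Psi>_eq using amb_curvature_e0[OF x exp_gt_zero] by metis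
qed

text \<open>The representative \<open>Du x Z \<sigma>\<close> has base component
  \<open>f x *\<^sub>R Z\<close> and an uncontrolled \<open>dt\<close> component. The curvature
  ignores the latter and is linear in the former, and inverting beta divides by \<open>f x\<close>
  again.\<close>

lemma T_induced_curvature:
  assumes \<sigma>: "line_section_on M T U \<sigma>" "\<forall>x\<in>U. \<sigma> x \<noteq> 0" and x: "x \<in> U"
  shows "induced_curvature M T \<sigma> x V W Z = base_curvature x V W Z"
proof -
  obtain f where f: "smooth_map_on M U f" "\<And>x. x \<in> U \<Longrightarrow> \<sigma> x = f x *\<^sub>R \<xi> x"
    by (rule line_section_coefficient[OF \<sigma>(1)]) metis
  have U: "open U" "U \<subseteq> points M" using \<sigma>(1) by (auto simp: line_section_on_def)
  have xp: "x \<in> points M" using x U(2) by blast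
  have f0: "f x \<noteq> 0" using \<sigma>(2) f(2)[OF x] x by auto
  have fx: "dt (\<sigma> x) / exp (u x) = f x" by (simp add: f(2)[OF x] \<xi>_eq)
  note beta = beta_sec_line_section[OF \<sigma>(1) x, unfolded fx]
  have inj: "inj (tractor_beta_sec T \<sigma> x)"
    by (rule injI) (use f0 in \<open>simp add: beta coset_eq_iff\<close>)
  define R where "R = curvature amb (tangent_bundle amb) D (\<Psi> x) (d\<Psi> x V) (d\<Psi> x W)"
  have R_base: "dr (R w) = 0" "base (R w) = base_curvature x V W (base w)" if "dr w = 0" for w
    unfolding R_def \<Psi>_eq using amb_curvature_base[OF xp exp_gt_zero _ _ that] by (simp_all add: d\<Psi>_def)
  have R_linear: "linear R"
    unfolding R_def \<Psi>_eq using amb_curvature_linear[OF xp exp_gt_zero] by simp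
  have "base_curvature x V W (f x *\<^sub>R Z) = base (R (f x *\<^sub>R (0, 0, Z)))"
    using R_base(2)[of "f x *\<^sub>R (0, 0, Z)"] by simp
  also have "\<dots> = f x *\<^sub>R base_curvature x V W Z"
    unfolding linear_scale[OF R_linear] using R_base(2)[of "(0, 0, Z)"] by simp
  finally have "coset (span {\<xi> x}) (R (Du x Z \<sigma>)) = tractor_beta_sec T \<sigma> x (base_curvature x V W Z)"
    unfolding beta coset_eq_iff
    using R_base[of "Du x Z \<sigma>"] Du_line_section[OF U x f] by simp
  then show ?thesis
    unfolding induced_curvature_def T_simps curvature_Du[OF xp] R_def[symmetric]
    by (simp add: inv_f_f[OF inj])
qed

text \<open>The induced endomorphism no longer mentions \<open>\<sigma>\<close>, so testing the
  trace with the global section \<open>\<xi>\<close> settles all nonvanishing sections.\<close>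

lemma normal_T_iff:
  "normal_conformal_tractor_bundle M cs T \<longleftrightarrow> (\<forall>x\<in>points M. \<forall>v w. lin_trace (\<lambda>u. base_curvature x u v w) = 0)"
proof
  assume L: "normal_conformal_tractor_bundle M cs T"
  have \<xi>: "line_section_on M T (points M) \<xi>" "\<forall>x\<in>points M. \<xi> x \<noteq> 0"
    using \<xi>_smooth open_points by (simp_all add: line_section_on_def span_base \<xi>_eq zero_prod_def)
  show "\<forall>x\<in>points M. \<forall>v w. lin_trace (\<lambda>u. base_curvature x u v w) = 0"
  proof (intro ballI allI)
    fix x v w assume x: "x \<in> points M"
    from L[unfolded normal_conformal_tractor_bundle_def, THEN conjunct2, THEN conjunct2, THEN spec, THEN spec,
        THEN mp, OF conjI[OF \<xi>], THEN bspec, OF x, THEN spec, THEN spec]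
    show "lin_trace (\<lambda>u. base_curvature x u v w) = 0"
      unfolding T_induced_curvature[OF \<xi> x] .
  qed
next
  assume R: "\<forall>x\<in>points M. \<forall>v w. lin_trace (\<lambda>u. base_curvature x u v w) = 0"
  show "normal_conformal_tractor_bundle M cs T"
    unfolding normal_conformal_tractor_bundle_def
  proof (intro conjI ballI allI impI)
    show "standard_conformal_tractor_bundle M cs T" by (rule standard_T)
    fix x V W assume "x \<in> points M"
    then show "tractor_curvature M T x V W ` line T x \<subseteq> line T x"
      using T_curvature_line by (auto simp: span_zero)
  next
    fix U \<sigma> x v w assume \<sigma>: "line_section_on M T U \<sigma> \<and> (\<forall>x\<in>U. \<sigma> x \<noteq> 0)" and x: "x \<in> U"
    have "x \<in> points M" using \<sigma> x unfolding line_section_on_def by blast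
    then have "lin_trace (\<lambda>u. base_curvature x u v w) = 0" using R by blast
    then show "lin_trace (\<lambda>V. induced_curvature M T \<sigma> x V v w) = 0"
      unfolding T_induced_curvature[OF \<sigma>[THEN conjunct1] \<sigma>[THEN conjunct2] x] .
  qed
qed

end

theorem theorem5p1:
  fixes M :: "('m::{t2_space,second_countable_topology}, 'e::euclidean_space) manifold"
    and c :: "('m \<Rightarrow> 'e \<Rightarrow> 'e \<Rightarrow> real) set"
    and g :: "'m \<Rightarrow> 'e \<Rightarrow> 'e \<Rightarrow> real"
    and \<gamma> :: "real \<Rightarrow> 'm \<Rightarrow> 'e \<Rightarrow> 'e"
    and \<delta> :: real
    and u :: "'m \<Rightarrow> real"
    and D :: "(real \<times> real \<times> 'm, real \<times> real \<times> 'e, real \<times> real \<times> 'e) connection"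
    and Du :: "('m, 'e, real \<times> real \<times> 'e) connection"
  assumes "smooth_manifold M" and "connected (points M)" and "DIM('e) \<ge> 2"
    and "conformal_structure M c" and "g \<in> c"
    and "admissible_family M c \<gamma>" and "nonsingular_within M \<gamma> \<delta>"
    and "smooth_map_on M (points M) u"
    and "levi_civita_connection (ambient_manifold M \<delta>) (ambient_metric g \<gamma>) D"
    and "pullback_connection M (ambient_manifold M \<delta>) (ambient_immersion u)
           (tangent_bundle (ambient_manifold M \<delta>)) D Du"
  shows "normal_conformal_tractor_bundle M c
           (associated_tractor_bundle M (ambient_manifold M \<delta>) (ambient_metric g \<gamma>)
              (ambient_immersion u) (ambient_normal u) Du)
         \<longleftrightarrow> (\<forall>V\<in>natural_lifts M. \<forall>W\<in>natural_lifts M.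
               \<forall>(t, r, x)\<in>points (ambient_manifold M \<delta>).
                 r = 0 \<longrightarrow> ricci (ambient_manifold M \<delta>) D (t, r, x) (V (t, r, x)) (W (t, r, x)) = 0)"
proof -
  interpret ambient_tractor M c g \<gamma> \<delta> D u Du
    using assms by unfold_locales
  show ?thesis unfolding normal_T_iff ricci_natural_lifts ..
qed

end
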